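(* Let $Z=Z_{r+1}$ be the generic stratum with respect to $H_\lambda$ and let $\mathcal{M}_\lambda$ be the algebraic $\mathcal{D}$-module on $Z$ associated with the general hypergeometric system of type $\lambda$ (defined in the context). Then its characteristic variety is $$\mathrm{Ch}(\mathcal{M}_\lambda)=\{(z,\xi)\in T^*Z\mid\xi=0\}.$$ Hence $\mathcal{M}_\lambda$ is holonomic and has no singularity on $Z$.
   Context: Let $r,N$ be positive integers with $r+1<N$ and let $\lambda=(n_1,\dots,n_\ell)$ be a partition of $N$ (all $n_k\ge1$). Generic stratum: write $z\in\mathrm{Mat}_{r+1,N}(\mathbb{C})$ in blocks $z=(z^{(1)},\dots,z^{(\ell)})$, $z^{(k)}=(z^{(k)}_0,\dots,z^{(k)}_{n_k-1})\in\mathrm{Mat}_{r+1,n_k}(\mathbb{C})$ with columns $z_j^{(k)}$. For $\mu=(m_1,\dots,m_\ell)\in\mathbb{Z}_{\ge0}^\ell$ with $0\le m_k\le n_k$ and $\sum_km_k=r+1$, put $z_\mu=(z^{(1)}_0,\dots,z^{(1)}_{m_1-1},\dots,z^{(\ell)}_0,\dots,z^{(\ell)}_{m_\ell-1})\in\mathrm{Mat}_{r+1}(\mathbb{C})$. Then $Z_{r+1}\subset\mathrm{Mat}_{r+1,N}(\mathbb{C})$ is the (Zariski open) set of $z$ with $\det z_\mu\neq0$ for all such $\mu$. Lie algebra: with $\Lambda_n=(\delta_{i+1,j})_{1\le i,j\le n}$ the shift matrix, $\mathfrak{j}(n)=\{\sum_{0\le j<n}X_j\Lambda_n^j\mid X_j\in\mathbb{C}\}$,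 and $\mathfrak{h}_\lambda=\mathfrak{j}(n_1)\oplus\cdots\oplus\mathfrak{j}(n_\ell)$, viewed as block-diagonal $N\times N$ matrices; this is the Lie algebra of the group $H_\lambda\subset\mathrm{GL}_N(\mathbb{C})$ of invertible elements of this block-diagonal algebra. Parameters: $\alpha=(\alpha^{(1)},\dots,\alpha^{(\ell)})\in\mathbb{C}^N$, $\alpha^{(k)}=(\alpha_0^{(k)},\dots,\alpha_{n_k-1}^{(k)})$, with the standing assumptions $\sum_{k}\alpha_0^{(k)}=-r-1$, and $\alpha_{n_k-1}^{(k)}\notin\mathbb{Z}$ if $n_k=1$, $\alpha_{n_k-1}^{(k)}\ne0$ if $n_k>1$. The linear map $\alpha:\mathfrak{h}_\lambda\to\mathbb{C}$ is given by $\alpha\bigl(\bigoplus_k\sum_jX_j^{(k)}\Lambda_{n_k}^j\bigr)=\sum_{k}\sum_{0\le j<n_k}\alpha_j^{(k)}X_j^{(k)}$. General hypergeometric system of type $\lambda$: with coordinates $z=(z_{ip})_{0\le i\le r,\,1\le p\le N}$, $\partial_{ip}=\partial/\partial z_{ip}$, $\partial=(\partial_{ip})$, it is the system for an unknown function $F(z)$: (i) $(\partial_{ip}\partial_{jq}-\partial_{iq}\partial_{jp})F=0$ for $0\le i,j\le r$, $1\le p,q\le N$; (ii) $\{\mathrm{Tr}({}^t(zX)\partial)-\alpha(X)\}F=0$ for $X\in\mathfrak{h}_\lambda$; (iii) $\{\mathrm{Tr}({}^t(Yz)\partial)+\mathrm{Tr}(Y)\}F=0$ for $Y\in\mathfrak{gl}_{r+1}(\mathbb{C})$.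 Here $\mathrm{Tr}({}^tA\,\partial)=\sum_{i,p}A_{ip}\partial_{ip}$. $\mathcal{M}_\lambda$ is the quotient of the sheaf $\mathcal{D}$ of algebraic differential operators on $Z$ by the left ideal generated by the operators in (i)–(iii). $T^*Z=Z\times\mathrm{Mat}_{r+1,N}(\mathbb{C})$ has fiber coordinates $\xi=(\xi_{ip})$, and $\mathrm{Ch}(\mathcal{M}_\lambda)$ is the set of common zeros in $T^*Z$ of the principal symbols of all elements of this ideal. *)

theory Defs
  imports
    "HOL-Analysis.Derivative"
    "HOL-Analysis.Abstract_Topology"
    "HOL-Library.Extended_Nat"
    "Jordan_Normal_Form.Determinant"
begin

section \<open>Zariski topologies\<close>

inductive_set poly_funs :: "('x \<Rightarrow> complex) set \<Rightarrow> ('x \<Rightarrow> complex) set"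
  for crd :: "('x \<Rightarrow> complex) set" where
  const: "(\<lambda>_. c) \<in> poly_funs crd"
| coord: "x \<in> crd \<Longrightarrow> x \<in> poly_funs crd"
| add: "p \<in> poly_funs crd \<Longrightarrow> q \<in> poly_funs crd \<Longrightarrow> (\<lambda>z. p z + q z) \<in> poly_funs crd"
| mult: "p \<in> poly_funs crd \<Longrightarrow> q \<in> poly_funs crd \<Longrightarrow> (\<lambda>z. p z * q z) \<in> poly_funs crd"

definition zariski :: "('x \<Rightarrow> complex) set \<Rightarrow> 'x set \<Rightarrow> 'x topology" where
  "zariski crd X = topology (\<lambda>U. \<exists>S\<subseteq>poly_funs crd. U = {x \<in> X. \<exists>p\<in>S. p x \<noteq> 0})"

lemma openin_zariski:
  "openin (zariski crd X) U \<longleftrightarrow> (\<exists>S\<subseteq>poly_funs crd. U = {x \<in> X. \<exists>p\<in>S. p x \<noteq> 0})"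
proof -
  let ?O = "\<lambda>U. \<exists>S\<subseteq>poly_funs crd. U = {x \<in> X. \<exists>p\<in>S. p x \<noteq> 0}"
  have "istopology ?O"
    unfolding istopology_def
  proof (intro conjI allI impI)
    fix U V assume "?O U" "?O V"
    then obtain S T where S: "S \<subseteq> poly_funs crd" "U = {x \<in> X. \<exists>p\<in>S. p x \<noteq> 0}"
      and T: "T \<subseteq> poly_funs crd" "V = {x \<in> X. \<exists>p\<in>T. p x \<noteq> 0}" by blast
    let ?R = "{\<lambda>x. p x * q x | p q. p \<in> S \<and> q \<in> T}"
    have "?R \<subseteq> poly_funs crd" using S(1) T(1) by (auto intro!: poly_funs.mult)
    moreover have "U \<inter> V = {x \<in> X. \<exists>p\<in>?R. p x \<noteq> 0}"
    proof (intro Set.set_eqI iffI)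
      fix x assume "x \<in> U \<inter> V"
      then obtain p q where "x \<in> X" "p \<in> S" "p x \<noteq> 0" "q \<in> T" "q x \<noteq> 0"
        unfolding S(2) T(2) by blast
      then show "x \<in> {x \<in> X. \<exists>p\<in>?R. p x \<noteq> 0}"
        by (intro CollectI conjI bexI[of _ "\<lambda>x. p x * q x"]) auto
    next
      fix x assume "x \<in> {x \<in> X. \<exists>p\<in>?R. p x \<noteq> 0}"
      then show "x \<in> U \<inter> V" unfolding S(2) T(2) by auto
    qed
    ultimately show "?O (U \<inter> V)" by blast
  next
    fix K assume "\<forall>U\<in>K. ?O U"
    from bchoice[OF this] obtain S where
      S: "\<forall>U\<in>K. S U \<subseteq> poly_funs crd \<and> U = {x \<in> X. \<exists>p\<in>S U. p x \<noteq> 0}" ..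
    have "\<Union>K = (\<Union>U\<in>K. {x \<in> X. \<exists>p\<in>S U. p x \<noteq> 0})"
      using S by (metis (no_types, lifting) SUP_cong image_ident)
    also have "\<dots> = {x \<in> X. \<exists>p\<in>(\<Union>U\<in>K. S U). p x \<noteq> 0}" by blast
    finally have "\<Union>K = {x \<in> X. \<exists>p\<in>(\<Union>U\<in>K. S U). p x \<noteq> 0}" .
    moreover have "(\<Union>U\<in>K. S U) \<subseteq> poly_funs crd"
      using S by (meson UN_least)
    ultimately show "?O (\<Union>K)" by (intro exI[of _ "\<Union>U\<in>K. S U"] conjI)
  qed
  then show ?thesis unfolding zariski_def by (simp add: topology_inverse')
qed

definition irreducible_closed :: "'x topology \<Rightarrow> 'x set \<Rightarrow> bool" where
  "irreducible_closed T C \<longleftrightarrow> closedin T C \<and> C \<noteq> {} \<and>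
     (\<forall>A B. closedin T A \<longrightarrow> closedin T B \<longrightarrow> C \<subseteq> A \<union> B \<longrightarrow> C \<subseteq> A \<or> C \<subseteq> B)"

text \<open>Supremum of the lengths of strict chains of irreducible closed sets.\<close>

definition krull_dim :: "'x topology \<Rightarrow> enat" where
  "krull_dim T = Sup {enat n | n. \<exists>C. (\<forall>i\<le>n. irreducible_closed T (C i)) \<and>
     (\<forall>i<n. C i \<subset> C (Suc i))}"

text \<open>
  The affine space of \<open>nr \<times> nc\<close> matrices and its cotangent bundle.  Rows and columns are
  both indexed from 0.
\<close>

definition mat_coords :: "nat \<Rightarrow> nat \<Rightarrow> (complex mat \<Rightarrow> complex) set" where
  "mat_coords nr nc = {\<lambda>z. z $$ (i, p) | i p. i < nr \<and> p < nc}"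

definition cot_coords :: "nat \<Rightarrow> nat \<Rightarrow> (complex mat \<times> complex mat \<Rightarrow> complex) set" where
  "cot_coords nr nc = {\<lambda>w. fst w $$ (i, p) | i p. i < nr \<and> p < nc} \<union>
     {\<lambda>w. snd w $$ (i, p) | i p. i < nr \<and> p < nc}"

abbreviation zar_mat :: "nat \<Rightarrow> nat \<Rightarrow> complex mat topology" where
  "zar_mat nr nc \<equiv> zariski (mat_coords nr nc) (carrier_mat nr nc)"

abbreviation zar_cot :: "nat \<Rightarrow> nat \<Rightarrow> (complex mat \<times> complex mat) topology" where
  "zar_cot nr nc \<equiv> zariski (cot_coords nr nc) (carrier_mat nr nc \<times> carrier_mat nr nc)"

definition regular_on :: "nat \<Rightarrow> nat \<Rightarrow> complex mat set \<Rightarrow> (complex mat \<Rightarrow> complex) \<Rightarrow> bool" where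
  "regular_on nr nc U f \<longleftrightarrow> (\<forall>z\<in>U. \<exists>p\<in>poly_funs (mat_coords nr nc). \<exists>q\<in>poly_funs (mat_coords nr nc).
     q z \<noteq> 0 \<and> (\<forall>w\<in>U. q w \<noteq> 0 \<longrightarrow> f w = p w / q w))"

section \<open>Algebraic differential operators\<close>

definition upd_mat :: "complex mat \<Rightarrow> nat \<Rightarrow> nat \<Rightarrow> complex \<Rightarrow> complex mat" where
  "upd_mat z i p t = mat (dim_row z) (dim_col z) (\<lambda>ab. if ab = (i, p) then t else z $$ ab)"

definition pdiff :: "nat \<Rightarrow> nat \<Rightarrow> (complex mat \<Rightarrow> complex) \<Rightarrow> complex mat \<Rightarrow> complex" where
  "pdiff i p f z = deriv (\<lambda>t. f (upd_mat z i p t)) (z $$ (i, p))"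

type_synonym multi_index = "nat \<times> nat \<Rightarrow> nat"

definition multi_indices :: "nat \<Rightarrow> nat \<Rightarrow> multi_index set" where
  "multi_indices nr nc = {\<beta>. \<forall>ip. ip \<notin> {..<nr} \<times> {..<nc} \<longrightarrow> \<beta> ip = 0}"

definition mi_deg :: "nat \<Rightarrow> nat \<Rightarrow> multi_index \<Rightarrow> nat" where
  "mi_deg nr nc \<beta> = (\<Sum>ip\<in>{..<nr} \<times> {..<nc}. \<beta> ip)"

definition mi_monom :: "nat \<Rightarrow> nat \<Rightarrow> multi_index \<Rightarrow> complex mat \<Rightarrow> complex" where
  "mi_monom nr nc \<beta> \<xi> = (\<Prod>ip\<in>{..<nr} \<times> {..<nc}. (\<xi> $$ ip) ^ \<beta> ip)"

text \<open>
  The order in which the partial derivatives are taken is immaterial, since these operators are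
  only ever applied to regular functions, at points of the open set where these are regular.
\<close>

definition mi_diff ::
  "nat \<Rightarrow> nat \<Rightarrow> multi_index \<Rightarrow> (complex mat \<Rightarrow> complex) \<Rightarrow> complex mat \<Rightarrow> complex" where
  "mi_diff nr nc \<beta> f = foldr (\<lambda>(i, p). pdiff i p ^^ \<beta> (i, p)) (List.product [0..<nr] [0..<nc]) f"

text \<open>
  On a Zariski open subset \<open>U\<close> of the matrix space, \<open>\<D>(U)\<close> is the free left \<open>\<O>(U)\<close>-module on the
  \<open>\<partial>\<^sup>\<beta>\<close>.  An operator \<open>\<Sum>\<^sub>\<beta> a\<^sub>\<beta> \<partial>\<^sup>\<beta>\<close> is therefore given by its family \<open>a\<close> of coefficients; only the
  values of \<open>a\<^sub>\<beta>\<close> on \<open>U\<close> matter, so that restriction to a smaller open set leaves \<open>a\<close> unchanged.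
\<close>

type_synonym coeffs = "multi_index \<Rightarrow> complex mat \<Rightarrow> complex"

definition coeff_supp :: "complex mat set \<Rightarrow> coeffs \<Rightarrow> multi_index set" where
  "coeff_supp U a = {\<beta>. \<exists>z\<in>U. a \<beta> z \<noteq> 0}"

definition diff_ops :: "nat \<Rightarrow> nat \<Rightarrow> complex mat set \<Rightarrow> coeffs set" where
  "diff_ops nr nc U = {a. finite (coeff_supp U a) \<and> coeff_supp U a \<subseteq> multi_indices nr nc \<and>
     (\<forall>\<beta>. regular_on nr nc U (a \<beta>))}"

definition act ::
  "nat \<Rightarrow> nat \<Rightarrow> complex mat set \<Rightarrow> coeffs \<Rightarrow> (complex mat \<Rightarrow> complex) \<Rightarrow> complex mat \<Rightarrow> complex" where
  "act nr nc U a f z = (\<Sum>\<beta>\<in>coeff_supp U a. a \<beta> z * mi_diff nr nc \<beta> f z)"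

definition op_order :: "nat \<Rightarrow> nat \<Rightarrow> complex mat set \<Rightarrow> coeffs \<Rightarrow> nat" where
  "op_order nr nc U a = Max (mi_deg nr nc ` coeff_supp U a)"

text \<open>The principal symbol of the zero operator is 0 (empty sum).\<close>

definition principal_symbol ::
  "nat \<Rightarrow> nat \<Rightarrow> complex mat set \<Rightarrow> coeffs \<Rightarrow> complex mat \<Rightarrow> complex mat \<Rightarrow> complex" where
  "principal_symbol nr nc U a z \<xi> =
     (\<Sum>\<beta> | \<beta> \<in> coeff_supp U a \<and> mi_deg nr nc \<beta> = op_order nr nc U a. a \<beta> z * mi_monom nr nc \<beta> \<xi>)"

section \<open>Cyclic D-modules and their characteristic varieties\<close>

type_synonym fun_op = "(complex mat \<Rightarrow> complex) \<Rightarrow> complex mat \<Rightarrow> complex"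

text \<open>
  The operators \<open>\<Sum>\<^sub>k Q\<^sub>k \<circ> P\<^sub>k\<close> with \<open>Q\<^sub>k \<in> \<D>(U)\<close>, \<open>P\<^sub>k \<in> G\<close>.  The product of differential operators is
  their composition as endomorphisms of \<open>\<O>(U)\<close>; an operator is determined by this action,
  because \<open>\<O>(U)\<close> contains the polynomials.
\<close>

definition left_span :: "nat \<Rightarrow> nat \<Rightarrow> fun_op set \<Rightarrow> complex mat set \<Rightarrow> coeffs set" where
  "left_span nr nc G U = {a \<in> diff_ops nr nc U. \<exists>L :: (coeffs \<times> fun_op) list.
     set L \<subseteq> diff_ops nr nc U \<times> G \<and>
     (\<forall>f. regular_on nr nc U f \<longrightarrow>
       (\<forall>z\<in>U. act nr nc U a f z = (\<Sum>(b, P)\<leftarrow>L. act nr nc U b (P f) z)))}"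

text \<open>
  The sheaf of left ideals generated by \<open>G\<close>, given by its sections over each open set.  In what
  follows a sheaf \<open>\<I>\<close> of left ideals of \<open>\<D>\<close> on an open set \<open>X\<close> stands for the cyclic module \<open>\<D>/\<I>\<close>.
\<close>

type_synonym ideal_sheaf = "complex mat set \<Rightarrow> coeffs set"

definition generated_ideal :: "nat \<Rightarrow> nat \<Rightarrow> fun_op set \<Rightarrow> ideal_sheaf" where
  "generated_ideal nr nc G U = {a \<in> diff_ops nr nc U.
     \<forall>z\<in>U. \<exists>V. openin (zar_mat nr nc) V \<and> z \<in> V \<and> V \<subseteq> U \<and> a \<in> left_span nr nc G V}"

definition char_variety ::
  "nat \<Rightarrow> nat \<Rightarrow> complex mat set \<Rightarrow> ideal_sheaf \<Rightarrow> (complex mat \<times> complex mat) set" where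
  "char_variety nr nc X I = {(z, \<xi>). z \<in> X \<and> \<xi> \<in> carrier_mat nr nc \<and>
     (\<forall>U a. openin (zar_mat nr nc) U \<longrightarrow> U \<subseteq> X \<longrightarrow> z \<in> U \<longrightarrow> a \<in> I U \<longrightarrow>
       principal_symbol nr nc U a z \<xi> = 0)}"

definition zero_module :: "nat \<Rightarrow> nat \<Rightarrow> complex mat set \<Rightarrow> ideal_sheaf \<Rightarrow> bool" where
  "zero_module nr nc X I \<longleftrightarrow>
     (\<forall>U. openin (zar_mat nr nc) U \<longrightarrow> U \<subseteq> X \<longrightarrow> I U = diff_ops nr nc U)"

text \<open>
  Coherence is not required separately: \<open>\<D>/\<I>\<close> with \<open>\<I>\<close> generated by global operators is coherent,
  as \<open>\<D>\<close> is a coherent sheaf of Noetherian rings.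
\<close>

definition holonomic :: "nat \<Rightarrow> nat \<Rightarrow> complex mat set \<Rightarrow> ideal_sheaf \<Rightarrow> bool" where
  "holonomic nr nc X I \<longleftrightarrow> zero_module nr nc X I \<or>
     krull_dim (subtopology (zar_cot nr nc) (char_variety nr nc X I)) =
     krull_dim (subtopology (zar_mat nr nc) X)"

text \<open>The projection to \<open>X\<close> of the characteristic variety minus the zero section.\<close>

definition singular_locus :: "nat \<Rightarrow> nat \<Rightarrow> complex mat set \<Rightarrow> ideal_sheaf \<Rightarrow> complex mat set" where
  "singular_locus nr nc X I = {z. \<exists>\<xi>. (z, \<xi>) \<in> char_variety nr nc X I \<and> \<xi> \<noteq> 0\<^sub>m nr nc}"

section \<open>The general hypergeometric system\<close>

text \<open>
  A partition \<open>\<lambda> = (n\<^sub>1, \<dots>, n\<^sub>\<ell>)\<close> is the list \<open>ns\<close> of its parts, with blocks numbered from 0.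
  The parts need not be in decreasing order.
\<close>

definition block_start :: "nat list \<Rightarrow> nat \<Rightarrow> nat" where
  "block_start ns k = sum_list (take k ns)"

definition sub_weights :: "nat \<Rightarrow> nat list \<Rightarrow> nat list set" where
  "sub_weights r ns =
     {ms. length ms = length ns \<and> (\<forall>k<length ns. ms ! k \<le> ns ! k) \<and> sum_list ms = r + 1}"

definition z_sub :: "nat \<Rightarrow> nat list \<Rightarrow> nat list \<Rightarrow> complex mat \<Rightarrow> complex mat" where
  "z_sub r ns ms z = mat_of_cols (r + 1)
     (concat (map (\<lambda>k. map (\<lambda>j. col z (block_start ns k + j)) [0..<ms ! k]) [0..<length ns]))"

definition generic_stratum :: "nat \<Rightarrow> nat list \<Rightarrow> complex mat set" where
  "generic_stratum r ns = {z \<in> carrier_mat (r + 1) (sum_list ns).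
     \<forall>ms\<in>sub_weights r ns. det (z_sub r ns ms z) \<noteq> 0}"

definition shift_mat :: "nat \<Rightarrow> complex mat" where
  "shift_mat n = mat n n (\<lambda>(i, j). if j = i + 1 then 1 else 0)"

definition jordan_elem :: "nat \<Rightarrow> (nat \<Rightarrow> complex) \<Rightarrow> complex mat" where
  "jordan_elem n x = mat n n (\<lambda>ab. \<Sum>j<n. x j * (shift_mat n ^\<^sub>m j) $$ ab)"

text \<open>
  The element \<open>\<Oplus>\<^sub>k \<Sum>\<^sub>j X\<^sub>j\<^sup>(\<^sup>k\<^sup>) \<Lambda>\<^sup>j\<close> of the Lie algebra, with \<open>X\<^sub>j\<^sup>(\<^sup>k\<^sup>) = x k j\<close>, and the value of the
  linear form \<open>\<alpha>\<close> on it.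
\<close>

definition h_elem :: "nat list \<Rightarrow> (nat \<Rightarrow> nat \<Rightarrow> complex) \<Rightarrow> complex mat" where
  "h_elem ns x = diag_block_mat (map (\<lambda>k. jordan_elem (ns ! k) (x k)) [0..<length ns])"

definition h_char :: "nat list \<Rightarrow> (nat \<Rightarrow> nat \<Rightarrow> complex) \<Rightarrow> (nat \<Rightarrow> nat \<Rightarrow> complex) \<Rightarrow> complex" where
  "h_char ns \<alpha> x = (\<Sum>k<length ns. \<Sum>j<ns ! k. \<alpha> k j * x k j)"

text \<open>The operator \<open>Tr(\<^sup>tA \<partial>)\<close> for a matrix \<open>A\<close> depending on \<open>z\<close>.\<close>

definition trace_diff :: "nat \<Rightarrow> nat \<Rightarrow> (complex mat \<Rightarrow> complex mat) \<Rightarrow> fun_op" where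
  "trace_diff nr nc A f z = (\<Sum>i<nr. \<Sum>p<nc. A z $$ (i, p) * pdiff i p f z)"

definition hg_operators :: "nat \<Rightarrow> nat list \<Rightarrow> (nat \<Rightarrow> nat \<Rightarrow> complex) \<Rightarrow> fun_op set" where
  "hg_operators r ns \<alpha> =
     {\<lambda>f z. pdiff i p (pdiff j q f) z - pdiff i q (pdiff j p f) z | i j p q.
        i \<le> r \<and> j \<le> r \<and> p < sum_list ns \<and> q < sum_list ns} \<union>
     {\<lambda>f z. trace_diff (r + 1) (sum_list ns) (\<lambda>z. z * h_elem ns x) f z - h_char ns \<alpha> x * f z | x. True} \<union>
     {\<lambda>f z. trace_diff (r + 1) (sum_list ns) (\<lambda>z. Y * z) f z + (\<Sum>i<r + 1. Y $$ (i, i)) * f z | Y.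
        Y \<in> carrier_mat (r + 1) (r + 1)}"

definition hg_ideal :: "nat \<Rightarrow> nat list \<Rightarrow> (nat \<Rightarrow> nat \<Rightarrow> complex) \<Rightarrow> ideal_sheaf" where
  "hg_ideal r ns \<alpha> = generated_ideal (r + 1) (sum_list ns) (hg_operators r ns \<alpha>)"

end

theory Submission
  imports Defs "HOL-Library.Poly_Mapping" "HOL-Computational_Algebra.Polynomial_FPS"
    "HOL-Analysis.Gamma_Function" "HOL-Analysis.Continuum_Not_Denumerable"
begin

text \<open>
  The zero section contains the characteristic variety because a prime ideal that contains the
  symbols of the system at \<open>z\<close> contains all the variables \<open>\<xi>\<^sub>i\<^sub>p\<close>.

  Conversely, an operator of order zero in the ideal must vanish, that is, the fibre of the module
  at each point of the stratum is nonzero.  The symbol computation shows that this fibre is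
  spanned by derivatives of bounded order, so its vanishing would persist under small changes of
  the system.  Now deform the nilpotent algebras \<open>\<complex>[x]/x\<^sup>n\<close> to the semisimple
  \<open>\<complex>[x]/(x (x - s) \<cdots> (x - (n - 1) s))\<close>, and the exponents to non-integral ones.  The deformed system
  has the formal solution \<open>\<integral> \<Prod>\<^sub>l (t z\<^sub>l)^(a\<^sub>l) dt\<close> at a suitable point, where its derivatives are
  products of Gamma values (continued analytically), and it does not vanish there.  A Taylor
  expansion along the line between the two points gives a contradiction.
\<close>

text \<open>The obstacle is nonvanishing: a confluent system has no evident closed formula for a
  formal solution. The question is therefore put into a fibre. Modulo the maximal ideal of a point,
  operators become polynomials in the derivatives, and after transposition the left ideal becomes
  the span of explicit polynomials; a formal solution is a linear functional that kills them. A
  function in the ideal that is nonzero at the point acts on the fibre as a nonzero scalar up to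
  terms of lower degree, so it would make the fibre vanish. Two facts rule out a plain continuity
  argument: the explicit solution lives at a point \<open>z0\<close> that depends on the
  deformation, and its exponents may blow up as the algebra degenerates. Hence continuity is used
  only at the fixed point \<open>z1\<close> of the stratum, to keep one determinant nonzero. The
  passage from \<open>z0\<close> to \<open>z1\<close> is algebraic: the relations are affine in the
  point, so along the line the determinant is a polynomial in the line parameter, and power series
  over the complex numbers form a domain. The bound on the parameters is thus uniform in
  \<open>z0\<close>.\<close>

type_synonym 'v mpoly = "('v \<Rightarrow>\<^sub>0 nat) \<Rightarrow>\<^sub>0 complex"

section \<open>Polynomials as finitely supported coefficient maps, and functionals on them\<close>

abbreviation lookup where "lookup \<equiv> Poly_Mapping.lookup"
abbreviation single where "single \<equiv> Poly_Mapping.single"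
abbreviation keys where "keys \<equiv> Poly_Mapping.keys"

definition Var :: "'v \<Rightarrow> 'v mpoly" where "Var x = single (single x 1) 1"
definition Con :: "complex \<Rightarrow> 'v mpoly" where "Con c = single 0 c"

definition mdeg :: "('v \<Rightarrow>\<^sub>0 nat) \<Rightarrow> nat" where "mdeg m = (\<Sum>x\<in>keys m. lookup m x)"

text \<open>A functional is recorded by its values \<open>\<phi>\<close> on all monomials, with no
  bound on the degree: this is a formal power series at a point, the values being its
  derivatives.\<close>

definition lin :: "('m \<Rightarrow> complex) \<Rightarrow> ('m \<Rightarrow>\<^sub>0 complex) \<Rightarrow> complex" where
  "lin \<phi> w = (\<Sum>m\<in>keys w. lookup w m * \<phi> m)"

text \<open>The polynomial type admits all variables of type \<open>'v\<close>, while a system lives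
  on finitely many cells; \<open>G\<close> singles them out.\<close>

definition gpol :: "'v set \<Rightarrow> 'v mpoly set" where
  "gpol G = {w. \<forall>m\<in>keys w. keys m \<subseteq> G}"

definition mons :: "'v set \<Rightarrow> nat \<Rightarrow> ('v \<Rightarrow>\<^sub>0 nat) set" where
  "mons G n = {m. keys m \<subseteq> G \<and> mdeg m < n}"

text \<open>The degree bound is strict, so that \<open>Pol G 0\<close> is the zero space and
  inductions on the degree start there.\<close>

definition Pol :: "'v set \<Rightarrow> nat \<Rightarrow> 'v mpoly set" where
  "Pol G n = {w. keys w \<subseteq> mons G n}"

lemma Con_0 [simp]: "Con 0 = 0" and Con_1 [simp]: "Con 1 = 1"
  by (simp_all add: Con_def)

lemma Con_add: "Con (a + b) = Con a + Con b" by (simp add: Con_def single_add)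
lemma Con_mult: "Con (a * b) = Con a * Con b" by (simp add: Con_def mult_single)
lemma Con_uminus: "Con (- a) = - Con a" by (simp add: Con_def single_uminus)
lemma Con_diff: "Con (a - b) = Con a - Con b" by (simp add: Con_def single_diff)
lemma Con_sum: "Con (sum f A) = (\<Sum>x\<in>A. Con (f x))"
  by (induction A rule: infinite_finite_induct) (simp_all add: Con_add)

lemma Con_of_nat: "Con (of_nat n) = of_nat n"
  by (induction n) (simp_all add: Con_add)

lemma Con_hom: "comm_ring_hom Con"
  by unfold_locales (simp_all add: Con_add Con_mult)

lemma lookup_Con_mult [simp]: "lookup (Con c * w) m = c * lookup w m"
proof -
  have "Con c * w = Poly_Mapping.map ((*) c) w"
    by (simp add: Con_def mult_map_scale_conv_mult)
  then show ?thesis by (simp add: Poly_Mapping.map.rep_eq when_def)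
qed

lemma Con_mult_single: "Con c * single m d = single m (c * d)"
  by (simp add: Con_def mult_single)

lemma keys_Con_mult: "keys (Con c * w) \<subseteq> keys w"
  by (auto simp: in_keys_iff)

lemma mpoly_sum_single: "(w :: 'm \<Rightarrow>\<^sub>0 complex) = (\<Sum>m\<in>keys w. single m (lookup w m))"
  by (intro poly_mapping_eqI) (simp add: lookup_sum lookup_single when_def sum.delta in_keys_iff)

lemma mpoly_single_induct [case_names zero single add]:
  fixes w :: "'m \<Rightarrow>\<^sub>0 complex"
  assumes 0: "Q 0" and s: "\<And>m. m \<in> keys w \<Longrightarrow> Q (single m (lookup w m))"
    and a: "\<And>u v. Q u \<Longrightarrow> Q v \<Longrightarrow> Q (u + v)"
  shows "Q w"
proof -
  have "Q (\<Sum>m\<in>A. single m (lookup w m))" if "finite A" "A \<subseteq> keys w" for A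
    using that by (induction A rule: finite_induct) (auto simp: 0 intro!: a s)
  from this[of "keys w"] show ?thesis using mpoly_sum_single[of w] by simp
qed

lemma sum_keys_superset:
  assumes "finite S" "keys w \<subseteq> S" "\<And>m. f m 0 = 0"
  shows "(\<Sum>m\<in>keys w. f m (lookup w m)) = (\<Sum>m\<in>S. f m (lookup w m))"
  by (intro sum.mono_neutral_left) (use assms in \<open>auto simp: in_keys_iff\<close>)

lemma mdeg_superset: "finite S \<Longrightarrow> keys m \<subseteq> S \<Longrightarrow> mdeg m = (\<Sum>x\<in>S. lookup m x)"
  unfolding mdeg_def by (rule sum_keys_superset[where f="\<lambda>_ x. x"]) auto

lemma mdeg_0 [simp]: "mdeg 0 = 0" by (simp add: mdeg_def)

lemma mdeg_add: "mdeg (m + n) = mdeg m + mdeg n"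
proof -
  let ?S = "keys m \<union> keys n"
  have "keys (m + n) \<subseteq> ?S" by (rule keys_add)
  then show ?thesis
    by (simp add: mdeg_superset[of ?S] lookup_add sum.distrib)
qed

lemma mdeg_single [simp]: "mdeg (single x k) = k"
  by (cases "k = 0") (simp_all add: mdeg_def)

lemma mdeg_eq_0 [simp]: "mdeg m = 0 \<longleftrightarrow> m = 0"
proof
  assume "mdeg m = 0"
  then have "\<forall>x\<in>keys m. lookup m x = 0" by (simp add: mdeg_def)
  then show "m = 0" by (intro poly_mapping_eqI) (auto simp: in_keys_iff)
qed simp

lemma monom_split:
  assumes "m \<noteq> (0 :: 'v \<Rightarrow>\<^sub>0 nat)"
  obtains x m' where "m = single x 1 + m'" "x \<in> keys m" "keys m' \<subseteq> keys m"
proof -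
  obtain x where x: "lookup m x \<noteq> 0" using assms by (metis poly_mapping_eqI lookup_zero)
  have "m = single x 1 + (m - single x 1)"
    using x by (intro poly_mapping_eqI) (auto simp: lookup_add lookup_minus lookup_single when_def)
  moreover have "keys (m - single x 1) \<subseteq> keys m" by (auto simp: in_keys_iff lookup_minus)
  ultimately show ?thesis using that x by (metis in_keys_iff)
qed

lemma keys_add_nat: "keys (m + n :: 'v \<Rightarrow>\<^sub>0 nat) = keys m \<union> keys n"
  by (auto simp: in_keys_iff lookup_add)

lemma Var_mult_single: "Var x * single m c = single (single x 1 + m) c"
  by (simp add: Var_def mult_single)

lemma gpol_add: "u \<in> gpol G \<Longrightarrow> v \<in> gpol G \<Longrightarrow> u + v \<in> gpol G"
  using keys_add[of u v] by (auto simp: gpol_def)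

lemma gpol_single: "keys m \<subseteq> G \<Longrightarrow> single m c \<in> gpol G"
  by (simp add: gpol_def)

lemma gpol_Con [simp]: "Con c \<in> gpol G"
  by (simp add: Con_def gpol_def)

lemma gpol_Var [simp]: "x \<in> G \<Longrightarrow> Var x \<in> gpol G"
  by (simp add: Var_def gpol_def)

lemma gpol_0 [simp]: "0 \<in> gpol G" by (simp add: gpol_def)

lemma gpol_mult: "u \<in> gpol G \<Longrightarrow> v \<in> gpol G \<Longrightarrow> u * v \<in> gpol G"
  unfolding gpol_def by (auto dest!: subsetD[OF keys_mult] simp: keys_add_nat; blast)

lemma gpol_uminus: "u \<in> gpol G \<Longrightarrow> - u \<in> gpol G" by (simp add: gpol_def)

lemma gpol_diff: "u \<in> gpol G \<Longrightarrow> v \<in> gpol G \<Longrightarrow> u - v \<in> gpol G"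
  using gpol_add[OF _ gpol_uminus, of u G v] by simp

lemma gpol_sum: "(\<And>x. x \<in> A \<Longrightarrow> f x \<in> gpol G) \<Longrightarrow> sum f A \<in> gpol G"
  by (induction A rule: infinite_finite_induct) (auto intro: gpol_add)

lemma gpol_UNIV: "w \<in> gpol UNIV" by (simp add: gpol_def)

lemma mpoly_ginduct [consumes 1, case_names Con Var add]:
  assumes "w \<in> gpol G" and c: "\<And>c. Q (Con c)"
    and x: "\<And>x w. x \<in> G \<Longrightarrow> w \<in> gpol G \<Longrightarrow> Q w \<Longrightarrow> Q (Var x * w)"
    and a: "\<And>u v. Q u \<Longrightarrow> Q v \<Longrightarrow> Q (u + v)"
  shows "Q w"
proof (induction w rule: mpoly_single_induct)
  case zero
  show ?case using c[of 0] by simp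
next
  case (single m)
  then have "keys m \<subseteq> G" using assms(1) by (auto simp: gpol_def)
  then have "Q (single m d)" for d
  proof (induction "mdeg m" arbitrary: m)
    case 0
    then show ?case using c[of d] by (simp add: Con_def)
  next
    case (Suc n)
    then have "m \<noteq> 0" by auto
    then obtain y m' where m: "m = single y 1 + m'" "y \<in> keys m" "keys m' \<subseteq> keys m"
      by (rule monom_split)
    then have "n = mdeg m'" using Suc.hyps(2) by (simp add: mdeg_add)
    then have "Q (single m' d)" using Suc m by blast
    then have "Q (Var y * single m' d)" using m Suc.prems by (intro x gpol_single) auto
    then show ?case using m(1) by (simp add: Var_mult_single)
  qed
  then show ?case .
qed (use a in auto)

lemma mpoly_induct [case_names Con Var add]:
  assumes "\<And>c. Q (Con c)" "\<And>x w. Q w \<Longrightarrow> Q (Var x * w)" "\<And>u v. Q u \<Longrightarrow> Q v \<Longrightarrow> Q (u + v)"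
  shows "Q w"
  by (rule mpoly_ginduct[OF gpol_UNIV]) (use assms in auto)

lemma lin_superset: "finite S \<Longrightarrow> keys w \<subseteq> S \<Longrightarrow> lin \<phi> w = (\<Sum>m\<in>S. lookup w m * \<phi> m)"
  unfolding lin_def by (rule sum_keys_superset[where f="\<lambda>m x. x * \<phi> m"]) auto

lemma lin_add: "lin \<phi> (u + v) = lin \<phi> u + lin \<phi> v"
proof -
  let ?S = "keys u \<union> keys v"
  show ?thesis
    using keys_add[of u v] by (simp add: lin_superset[of ?S] lookup_add algebra_simps sum.distrib)
qed

lemma lin_0 [simp]: "lin \<phi> 0 = 0" by (simp add: lin_def)

lemma lin_uminus: "lin \<phi> (- u) = - lin \<phi> u"
  using lin_add[of \<phi> u "- u"] by (simp add: add_eq_0_iff)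

lemma lin_diff: "lin \<phi> (u - v) = lin \<phi> u - lin \<phi> v"
  using lin_add[of \<phi> u "- v"] by (simp add: lin_uminus)

lemma lin_sum: "lin \<phi> (sum f A) = (\<Sum>x\<in>A. lin \<phi> (f x))"
  by (induction A rule: infinite_finite_induct) (simp_all add: lin_add)

lemma lin_Con_mult: "lin \<phi> (Con c * w) = c * lin \<phi> w"
proof -
  have "lin \<phi> (Con c * w) = (\<Sum>m\<in>keys w. lookup (Con c * w) m * \<phi> m)"
    by (rule lin_superset[OF _ keys_Con_mult]) simp
  then show ?thesis by (simp add: lin_def sum_distrib_left mult.assoc)
qed

lemma lin_single [simp]: "lin \<phi> (single m c) = c * \<phi> m"
  by (cases "c = 0") (simp_all add: lin_def)

section \<open>Derivations\<close>

definition D :: "'v \<Rightarrow> 'v mpoly \<Rightarrow> 'v mpoly" where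
  "D x w = Poly_Mapping.Abs_poly_mapping (\<lambda>m. of_nat (lookup m x + 1) * lookup w (m + single x 1))"

lemma lookup_D: "lookup (D x w) m = of_nat (lookup m x + 1) * lookup w (m + single x 1)"
proof -
  have "{m. of_nat (lookup m x + 1) * lookup w (m + single x 1) \<noteq> 0} \<subseteq> (\<lambda>m. m + single x 1) -` keys w"
    by (auto simp: in_keys_iff)
  moreover have "finite ((\<lambda>m. m + single x 1) -` keys w)"
    by (rule finite_vimageI) (auto simp: inj_on_def)
  ultimately have "finite {m. of_nat (lookup m x + 1) * lookup w (m + single x 1) \<noteq> 0}"
    by (rule finite_subset)
  then show ?thesis unfolding D_def by simp
qed

lemma D_add: "D x (u + v) = D x u + D x v"
  by (rule poly_mapping_eqI) (simp add: lookup_D lookup_add algebra_simps)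

lemma D_0 [simp]: "D x 0 = 0"
  by (rule poly_mapping_eqI) (simp add: lookup_D)

lemma D_diff: "D x (u - v) = D x u - D x v"
  by (rule poly_mapping_eqI) (simp add: lookup_D lookup_minus algebra_simps)

lemma D_Con_mult: "D x (Con c * w) = Con c * D x w"
  by (rule poly_mapping_eqI) (simp add: lookup_D)

lemma D_sum: "D x (sum f A) = (\<Sum>y\<in>A. D x (f y))"
  by (induction A rule: infinite_finite_induct) (simp_all add: D_add)

lemma D_Con [simp]: "D x (Con c) = 0"
proof (rule poly_mapping_eqI)
  fix m :: "'a \<Rightarrow>\<^sub>0 nat"
  have "m + single x 1 \<noteq> 0" by (metis One_nat_def add_is_0 lookup_add lookup_single_eq lookup_zero nat.simps(3))
  then show "lookup (D x (Con c)) m = lookup 0 m"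
    by (simp add: lookup_D Con_def lookup_single when_def)
qed

lemma D_comm: "D x (D y w) = D y (D x w)"
  by (rule poly_mapping_eqI) (auto simp: lookup_D lookup_add add_ac lookup_single when_def)

lemma D_single: "D x (single m c) = single (m - single x 1) (of_nat (lookup m x) * c)"
proof (rule poly_mapping_eqI)
  fix k
  show "lookup (D x (single m c)) k = lookup (single (m - single x 1) (of_nat (lookup m x) * c)) k"
  proof (cases "lookup m x = 0")
    case True
    then have "m \<noteq> k + single x 1" by (auto simp: lookup_add)
    then show ?thesis using True by (simp add: lookup_D lookup_single when_def)
  next
    case False
    have "m = (m - single x 1) + single x 1"
      using False by (intro poly_mapping_eqI) (auto simp: lookup_add lookup_minus lookup_single when_def)
    then have "m = k + single x 1 \<longleftrightarrow> m - single x 1 = k" by (metis add_right_imp_eq)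
    then show ?thesis using False
      by (cases "m - single x 1 = k") (auto simp: lookup_D lookup_single when_def lookup_add lookup_minus)
  qed
qed

lemma D_Var_mult: "D x (Var y * w) = (if x = y then w else 0) + Var y * D x w"
proof (induction w rule: mpoly_single_induct)
  case (single m)
  show ?case
  proof (cases "x = y")
    case True
    show ?thesis
    proof (cases "lookup m x = 0")
      case True
      then show ?thesis using \<open>x = y\<close> by (simp add: Var_mult_single D_single lookup_add)
    next
      case False
      have "m = (m - single x 1) + single x 1"
        using False by (intro poly_mapping_eqI) (auto simp: lookup_add lookup_minus lookup_single when_def)
      then have *: "single x 1 + (m - single x 1) = m" by (simp add: add.commute)
      have "single (single x 1 + m - single x 1) (of_nat (Suc (lookup m x)) * lookup w m)
         = single m (lookup w m) + single m (of_nat (lookup m x) * lookup w m)"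
        by (simp add: single_add[symmetric] algebra_simps)
      then show ?thesis using \<open>x = y\<close> * by (simp add: Var_mult_single D_single lookup_add)
    qed
  next
    case False
    have "single y 1 + m - single x 1 = single y 1 + (m - single x 1)" if "lookup m x \<noteq> 0"
      using that False
      by (intro poly_mapping_eqI) (auto simp: lookup_add lookup_minus lookup_single when_def)
    then show ?thesis using False
      by (cases "lookup m x = 0") (auto simp: Var_mult_single D_single lookup_add lookup_single when_def)
  qed
qed (auto simp: D_add algebra_simps split: if_splits)

lemma D_mult: "D x (u * v) = D x u * v + u * D x v"
proof (induction u rule: mpoly_induct)
  case (Con c)
  then show ?case by (simp add: D_Con_mult)
next
  case (Var y u)
  have "D x (Var y * u * v) = (if x = y then u * v else 0) + Var y * (D x u * v + u * D x v)"
    by (simp add: mult.assoc D_Var_mult Var)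
  moreover have "D x (Var y * u) = (if x = y then u else 0) + Var y * D x u" by (rule D_Var_mult)
  ultimately show ?case by (simp only: mult.assoc[symmetric]) (auto simp: algebra_simps)
qed (simp add: D_add distrib_left distrib_right)

lemma D_Var: "D x (Var y) = (if x = y then 1 else 0)"
proof -
  have "D x (1 :: 'a mpoly) = 0" using D_Con[of x 1] by simp
  then show ?thesis using D_Var_mult[of x y 1] by (simp split: if_splits)
qed

lemma D_power: "D x (u ^ Suc n) = of_nat (Suc n) * u ^ n * D x u"
proof (induction n)
  case (Suc n)
  have "D x (u ^ Suc (Suc n)) = D x u * u ^ Suc n + u * D x (u ^ Suc n)"
    using D_mult[of x u "u ^ Suc n"] by simp
  then show ?case unfolding Suc by (simp add: algebra_simps)
qed simp

lemma gpol_D: "w \<in> gpol G \<Longrightarrow> D x w \<in> gpol G"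
proof -
  assume w: "w \<in> gpol G"
  have "keys m \<subseteq> G" if "m \<in> keys (D x w)" for m
  proof -
    have "m + single x 1 \<in> keys w" using that by (auto simp: in_keys_iff lookup_D)
    then have "keys (m + single x 1) \<subseteq> G" using w by (auto simp: gpol_def)
    then show ?thesis by (simp add: keys_add_nat)
  qed
  then show ?thesis by (auto simp: gpol_def)
qed

section \<open>The filtration by degree\<close>

lemma Pol_add: "u \<in> Pol G n \<Longrightarrow> v \<in> Pol G n \<Longrightarrow> u + v \<in> Pol G n"
  using keys_add[of u v] by (auto simp: Pol_def)

lemma Pol_0 [simp]: "0 \<in> Pol G n" by (simp add: Pol_def)

lemma Pol_uminus: "u \<in> Pol G n \<Longrightarrow> - u \<in> Pol G n" by (simp add: Pol_def)

lemma Pol_diff: "u \<in> Pol G n \<Longrightarrow> v \<in> Pol G n \<Longrightarrow> u - v \<in> Pol G n"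
  using Pol_add[OF _ Pol_uminus, of u G n v] by simp

lemma Pol_sum: "(\<And>x. x \<in> A \<Longrightarrow> f x \<in> Pol G n) \<Longrightarrow> sum f A \<in> Pol G n"
  by (induction A rule: infinite_finite_induct) (auto intro: Pol_add)

lemma Pol_Con_mult: "u \<in> Pol G n \<Longrightarrow> Con c * u \<in> Pol G n"
  using keys_Con_mult[of c u] by (auto simp: Pol_def)

lemma Pol_mono: "u \<in> Pol G m \<Longrightarrow> m \<le> n \<Longrightarrow> u \<in> Pol G n"
  by (fastforce simp: Pol_def mons_def)

lemma Pol_single: "m \<in> mons G n \<Longrightarrow> single m c \<in> Pol G n"
  by (simp add: Pol_def)

lemma Pol_Var_mult: "u \<in> Pol G n \<Longrightarrow> x \<in> G \<Longrightarrow> Var x * u \<in> Pol G (Suc n)"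
proof -
  assume u: "u \<in> Pol G n" and x: "x \<in> G"
  have "k \<in> mons G (Suc n)" if k: "k \<in> keys (Var x * u)" for k
  proof -
    obtain b where "k = single x 1 + b" "b \<in> keys u"
      using subsetD[OF keys_mult k] by (auto simp: Var_def)
    then show ?thesis using u x by (auto simp: Pol_def mons_def keys_add_nat mdeg_add subset_iff)
  qed
  then show ?thesis by (auto simp: Pol_def)
qed

lemma Pol_D: assumes "u \<in> Pol G (Suc n)" shows "D x u \<in> Pol G n"
  unfolding Pol_def mons_def
proof safe
  fix m assume "m \<in> keys (D x u)"
  then have "m + single x 1 \<in> keys u" by (auto simp: in_keys_iff lookup_D)
  then have "m + single x 1 \<in> mons G (Suc n)" using assms by (auto simp: Pol_def)
  then show "mdeg m < n" "\<And>y. y \<in> keys m \<Longrightarrow> y \<in> G" by (auto simp: mons_def mdeg_add keys_add_nat)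
qed

lemma Pol_gpol: "u \<in> Pol G n \<Longrightarrow> u \<in> gpol G"
  by (auto simp: Pol_def gpol_def mons_def)

lemma Pol_Zero_iff: "u \<in> Pol G 0 \<longleftrightarrow> u = 0"
  by (auto simp: Pol_def mons_def)

lemma gpol_imp_Pol: assumes "u \<in> gpol G" obtains n where "u \<in> Pol G n"
proof -
  have "\<forall>m\<in>keys u. mdeg m < Suc (Max (mdeg ` keys u))" by (simp add: le_imp_less_Suc)
  then show ?thesis using assms that[of "Suc (Max (mdeg ` keys u))"]
    by (auto simp: Pol_def mons_def gpol_def)
qed

lemma finite_mons: assumes "finite G" shows "finite (mons G n)"
proof (induction n)
  case (Suc n)
  have "mons G (Suc n) \<subseteq> {0} \<union> (\<lambda>(x, m). single x 1 + m) ` (G \<times> mons G n)"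
  proof
    fix m assume m: "m \<in> mons G (Suc n)"
    show "m \<in> {0} \<union> (\<lambda>(x, m). single x 1 + m) ` (G \<times> mons G n)"
    proof (cases "m = 0")
      case False
      then obtain x m' where *: "m = single x 1 + m'" "x \<in> keys m" "keys m' \<subseteq> keys m"
        by (rule monom_split)
      then have "m' \<in> mons G n" "x \<in> G" using m by (auto simp: mons_def mdeg_add)
      then show ?thesis using * by auto
    qed simp
  qed
  then show ?case using Suc assms by (meson finite_SigmaI finite_Un finite_imageI finite.intros finite_subset)
qed (simp add: mons_def)

section \<open>Evaluation\<close>

definition mev :: "('v \<Rightarrow> 'b) \<Rightarrow> ('v \<Rightarrow>\<^sub>0 nat) \<Rightarrow> 'b::comm_ring_1" where
  "mev \<phi> m = (\<Prod>x\<in>keys m. \<phi> x ^ lookup m x)"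

text \<open>Coefficients pass through a ring map \<open>h\<close>, so that one definition serves for
  numerical values (\<open>h\<close> the identity) and for substitution of polynomials
  (\<open>h = Con\<close>).\<close>

definition peval :: "(complex \<Rightarrow> 'b) \<Rightarrow> ('v \<Rightarrow> 'b) \<Rightarrow> 'v mpoly \<Rightarrow> 'b::comm_ring_1" where
  "peval h \<phi> w = (\<Sum>m\<in>keys w. h (lookup w m) * mev \<phi> m)"

lemma mev_superset: "finite S \<Longrightarrow> keys m \<subseteq> S \<Longrightarrow> mev \<phi> m = (\<Prod>x\<in>S. \<phi> x ^ lookup m x)"
  unfolding mev_def by (rule prod.mono_neutral_left) (auto simp: in_keys_iff)

lemma mev_add: "mev \<phi> (m + n) = mev \<phi> m * mev \<phi> n"
proof -
  let ?S = "keys m \<union> keys n"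
  show ?thesis
    by (simp add: mev_superset[of ?S] keys_add_nat lookup_add power_add prod.distrib)
qed

lemma mev_0 [simp]: "mev \<phi> 0 = 1" by (simp add: mev_def)

lemma mev_single [simp]: "mev \<phi> (single x k) = \<phi> x ^ k"
  by (cases "k = 0") (simp_all add: mev_def)

context
  fixes h :: "complex \<Rightarrow> 'b::comm_ring_1" assumes h: "comm_ring_hom h"
begin

interpretation comm_ring_hom h by (rule h)

lemma peval_superset:
  "finite S \<Longrightarrow> keys w \<subseteq> S \<Longrightarrow> peval h \<phi> w = (\<Sum>m\<in>S. h (lookup w m) * mev \<phi> m)"
  unfolding peval_def by (rule sum_keys_superset[where f="\<lambda>m x. h x * mev \<phi> m"]) auto

lemma peval_add: "peval h \<phi> (u + v) = peval h \<phi> u + peval h \<phi> v"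
proof -
  let ?S = "keys u \<union> keys v"
  show ?thesis
    using keys_add[of u v]
    by (simp add: peval_superset[of ?S] lookup_add hom_add distrib_right sum.distrib)
qed

lemma peval_0: "peval h \<phi> 0 = 0" by (simp add: peval_def)

lemma peval_single: "peval h \<phi> (single m c) = h c * mev \<phi> m"
  by (cases "c = 0") (simp_all add: peval_def)

lemma peval_Con: "peval h \<phi> (Con c) = h c"
  by (simp add: Con_def peval_single)

lemma peval_Var: "peval h \<phi> (Var x) = \<phi> x"
  by (simp add: Var_def peval_single)

lemma peval_Var_mult: "peval h \<phi> (Var x * w) = \<phi> x * peval h \<phi> w"
  by (induction w rule: mpoly_single_induct)
     (simp_all add: peval_0 Var_mult_single peval_single mev_add peval_add distrib_left mult_ac)

lemma peval_Con_mult: "peval h \<phi> (Con c * w) = h c * peval h \<phi> w"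
  by (induction w rule: mpoly_single_induct)
     (simp_all add: peval_0 Con_mult_single peval_single hom_mult peval_add distrib_left mult_ac)

lemma peval_mult: "peval h \<phi> (u * v) = peval h \<phi> u * peval h \<phi> v"
  by (induction u rule: mpoly_induct)
     (simp_all add: peval_Con_mult peval_Con peval_Var_mult mult.assoc peval_add distrib_right)

lemma peval_diff: "peval h \<phi> (u - v) = peval h \<phi> u - peval h \<phi> v"
  using peval_add[of \<phi> "u - v" v] by simp

lemma peval_sum: "peval h \<phi> (sum f A) = (\<Sum>x\<in>A. peval h \<phi> (f x))"
  by (induction A rule: infinite_finite_induct) (simp_all add: peval_0 peval_add)

lemma peval_1: "peval h \<phi> 1 = 1"
  using peval_Con[of \<phi> 1] by simp

lemma peval_power: "peval h \<phi> (u ^ n) = peval h \<phi> u ^ n"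
  by (induction n) (simp_all add: peval_1 peval_mult)

end

lemma id_hom: "comm_ring_hom (\<lambda>x::complex. x)"
  by unfold_locales auto

section \<open>The apolar pairing\<close>

definition mfact :: "('v \<Rightarrow>\<^sub>0 nat) \<Rightarrow> complex" where
  "mfact m = (\<Prod>x\<in>keys m. fact (lookup m x))"

lemma mfact_superset: "finite S \<Longrightarrow> keys m \<subseteq> S \<Longrightarrow> mfact m = (\<Prod>x\<in>S. fact (lookup m x))"
  unfolding mfact_def by (rule prod.mono_neutral_left) (auto simp: in_keys_iff)

lemma mfact_nz [simp]: "mfact m \<noteq> 0" by (simp add: mfact_def)

lemma mfact_Suc: "mfact (m + single x 1) = of_nat (lookup m x + 1) * mfact m"
proof -
  let ?S = "insert x (keys m)"
  have "mfact (m + single x 1) = (\<Prod>y\<in>?S. fact (lookup (m + single x 1) y))"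
    by (rule mfact_superset) (auto simp: keys_add_nat)
  also have "\<dots> = fact (lookup m x + 1) * (\<Prod>y\<in>keys m - {x}. fact (lookup m y))"
    by (subst prod.insert_remove)
       (auto simp: lookup_add lookup_single when_def intro!: prod.cong split: if_splits)
  also have "\<dots> = of_nat (lookup m x + 1) * (\<Prod>y\<in>?S. fact (lookup m y))"
    by (subst prod.insert_remove) (auto)
  also have "(\<Prod>y\<in>?S. fact (lookup m y)) = mfact m"
    by (rule mfact_superset[symmetric]) auto
  finally show ?thesis .
qed

text \<open>The value at the origin of the constant-coefficient operator
  \<open>v(\<partial>)\<close> applied to \<open>w\<close>. The factorials make multiplication by a
  variable and differentiation transposes of each other.\<close>

definition pr :: "'v mpoly \<Rightarrow> 'v mpoly \<Rightarrow> complex" where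
  "pr v w = lin (\<lambda>m. mfact m * lookup w m) v"

lemma pr_add_left: "pr (u + v) w = pr u w + pr v w" by (simp add: pr_def lin_add)
lemma pr_0_left [simp]: "pr 0 w = 0" by (simp add: pr_def)
lemma pr_diff_left: "pr (u - v) w = pr u w - pr v w" by (simp add: pr_def lin_diff)
lemma pr_sum_left: "pr (sum f A) w = (\<Sum>x\<in>A. pr (f x) w)" by (simp add: pr_def lin_sum)
lemma pr_Con_left: "pr (Con c * v) w = c * pr v w" by (simp add: pr_def lin_Con_mult)

lemma pr_comm: "pr v w = pr w v"
proof -
  let ?S = "keys v \<union> keys w"
  have "pr v w = (\<Sum>m\<in>?S. lookup v m * (mfact m * lookup w m))"
    unfolding pr_def by (rule lin_superset) auto
  moreover have "pr w v = (\<Sum>m\<in>?S. lookup w m * (mfact m * lookup v m))"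
    unfolding pr_def by (rule lin_superset) auto
  ultimately show ?thesis by (simp add: mult_ac)
qed

lemma pr_add_right: "pr w (u + v) = pr w u + pr w v" by (simp add: pr_comm[of w] pr_add_left)
lemma pr_diff_right: "pr w (u - v) = pr w u - pr w v" by (simp add: pr_comm[of w] pr_diff_left)
lemma pr_sum_right: "pr w (sum f A) = (\<Sum>x\<in>A. pr w (f x))" by (simp add: pr_comm[of w] pr_sum_left)
lemma pr_Con_right: "pr w (Con c * v) = c * pr w v" by (simp add: pr_comm[of w] pr_Con_left)

lemma pr_Var_left: "pr (Var x * v) w = pr v (D x w)"
proof (induction v rule: mpoly_single_induct)
  case (single m)
  show ?case
    by (simp add: pr_def Var_mult_single lookup_D add.commute[of _ m] mfact_Suc[unfolded One_nat_def] mult_ac)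
qed (simp_all add: distrib_left pr_add_left)

lemma pr_Var_right: "pr v (Var x * w) = pr (D x v) w"
  by (metis pr_Var_left pr_comm)

lemma pr_single_right: "pr v (single m 1) = mfact m * lookup v m"
  by (subst pr_comm) (simp add: pr_def)

lemma pr_eqI:
  assumes "u \<in> gpol G" "v \<in> gpol G" "\<And>w. w \<in> gpol G \<Longrightarrow> pr u w = pr v w"
  shows "u = v"
proof (rule poly_mapping_eqI)
  fix m
  show "lookup u m = lookup v m"
  proof (cases "keys m \<subseteq> G")
    case True
    then show ?thesis using assms(3)[OF gpol_single[OF True, of 1]] by (simp add: pr_single_right)
  next
    case False
    then have "m \<notin> keys u" "m \<notin> keys v" using assms(1,2) by (auto simp: gpol_def)
    then show ?thesis by (simp add: in_keys_iff)
  qed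
qed

text \<open>The transpose of multiplication by \<open>h\<close> is \<open>h(D)\<close>, built along
  \<open>h\<close>. A variable becomes a derivation and lowers the degree, so only the constant
  coefficient preserves it; the transpose is therefore triangular, and invertible when
  \<open>h\<close> is nonzero at the centre.\<close>

lemma mult_adjoint:
  assumes "h \<in> gpol G"
  shows "\<exists>A. (\<forall>v w. pr v (h * w) = pr (A v) w) \<and> (\<forall>n. \<forall>v\<in>Pol G n. A v \<in> Pol G n) \<and>
    (\<forall>n. \<forall>v\<in>Pol G (Suc n). A v - Con (lookup h 0) * v \<in> Pol G n)"
  using assms
proof (induction h rule: mpoly_ginduct)
  case (Con c)
  have "lookup (Con c :: 'a mpoly) 0 = c" by (simp add: Con_def)
  then show ?case
    by (intro exI[of _ "\<lambda>v. Con c * v"]) (simp add: pr_Con_left pr_Con_right Pol_Con_mult)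
next
  case (Var x w)
  then obtain A where A: "\<forall>v u. pr v (w * u) = pr (A v) u" "\<forall>n. \<forall>v\<in>Pol G n. A v \<in> Pol G n"
    by blast
  have nz: "single x 1 + m \<noteq> (0 :: 'a \<Rightarrow>\<^sub>0 nat)" for m
    using mdeg_add[of "single x 1" m] by (metis add_is_0 mdeg_0 mdeg_single one_neq_zero)
  have "0 \<notin> keys (Var x * w)"
  proof
    assume "0 \<in> keys (Var x * w)"
    then have "0 \<in> {a + b |a b. a \<in> keys (Var x) \<and> b \<in> keys w}" using keys_mult by blast
    then show False using nz by (auto simp: Var_def)
  qed
  then have "lookup (Var x * w) 0 = 0" by (simp add: in_keys_iff)
  moreover have "A (D x v) \<in> Pol G n" if "v \<in> Pol G (Suc n)" for v n
    using A(2) Pol_D[OF that] by blast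
  moreover have "A (D x v) \<in> Pol G n" if "v \<in> Pol G n" for v n
    using A(2) Pol_D[OF Pol_mono[OF that, of "Suc n"]] by simp
  ultimately show ?case using A(1)
    by (intro exI[of _ "\<lambda>v. A (D x v)"]) (simp add: mult.assoc pr_Var_right)
next
  case (add u v)
  obtain A where A: "\<forall>v w. pr v (u * w) = pr (A v) w" "\<forall>n. \<forall>v\<in>Pol G n. A v \<in> Pol G n"
    "\<forall>n. \<forall>v\<in>Pol G (Suc n). A v - Con (lookup u 0) * v \<in> Pol G n" using add by blast
  obtain B where B: "\<forall>u w. pr u (v * w) = pr (B u) w" "\<forall>n. \<forall>v\<in>Pol G n. B v \<in> Pol G n"
    "\<forall>n. \<forall>u\<in>Pol G (Suc n). B u - Con (lookup v 0) * u \<in> Pol G n" using add by blast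
  have eq: "A w + B w - Con (lookup (u + v) 0) * w
      = (A w - Con (lookup u 0) * w) + (B w - Con (lookup v 0) * w)" for w
    by (simp add: lookup_add Con_add algebra_simps)
  have "A w + B w - Con (lookup (u + v) 0) * w \<in> Pol G n" if "w \<in> Pol G (Suc n)" for w n
    unfolding eq using that A(3) B(3) by (intro Pol_add) auto
  then show ?case using A B
    by (intro exI[of _ "\<lambda>w. A w + B w"])
       (auto simp: distrib_right pr_add_left pr_add_right intro: Pol_add)
qed

section \<open>Prime ideals\<close>

definition idl :: "'a::comm_ring_1 set \<Rightarrow> bool" where
  "idl I \<longleftrightarrow> 0 \<in> I \<and> (\<forall>a\<in>I. \<forall>b\<in>I. a + b \<in> I) \<and> (\<forall>a\<in>I. \<forall>r. r * a \<in> I)"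

lemma idl_0: "idl I \<Longrightarrow> 0 \<in> I"
  and idl_add: "idl I \<Longrightarrow> a \<in> I \<Longrightarrow> b \<in> I \<Longrightarrow> a + b \<in> I"
  and idl_mult: "idl I \<Longrightarrow> a \<in> I \<Longrightarrow> r * a \<in> I"
  by (auto simp: idl_def)

lemma idl_mult_right: "idl I \<Longrightarrow> a \<in> I \<Longrightarrow> a * r \<in> I"
  by (metis idl_mult mult.commute)

lemma idl_uminus: "idl I \<Longrightarrow> a \<in> I \<Longrightarrow> - a \<in> I"
  using idl_mult[of I a "-1"] by simp

lemma idl_diff: "idl I \<Longrightarrow> a \<in> I \<Longrightarrow> b \<in> I \<Longrightarrow> a - b \<in> I"
  using idl_add[OF _ _ idl_uminus, of I a b] by simp

lemma idl_sum: "idl I \<Longrightarrow> (\<And>x. x \<in> A \<Longrightarrow> f x \<in> I) \<Longrightarrow> sum f A \<in> I"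
  by (induction A rule: infinite_finite_induct) (auto intro: idl_0 idl_add)

lemma idl_cong_diff: "idl I \<Longrightarrow> a - b \<in> I \<Longrightarrow> a \<in> I \<longleftrightarrow> b \<in> I"
  using idl_add[of I "a - b" b] idl_diff[of I a "a - b"] by auto

text \<open>Zorn's lemma: an ideal that is maximal among those containing \<open>J\<close> and
  missing all powers of \<open>x\<close> is prime. It turns a computation modulo prime ideals into
  nilpotency modulo \<open>J\<close>.\<close>

lemma prime_ideal_avoiding_powers:
  fixes x :: "'a::comm_ring_1"
  assumes J: "idl J" and x: "\<And>n. x ^ n \<notin> J"
  obtains M where "idl M" "J \<subseteq> M" "\<And>n. x ^ n \<notin> M" "\<And>a b. a * b \<in> M \<Longrightarrow> a \<in> M \<or> b \<in> M"
proof -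
  define S where "S = {I. idl I \<and> J \<subseteq> I \<and> (\<forall>n. x ^ n \<notin> I)}"
  have "J \<in> S" using J x by (auto simp: S_def)
  moreover have "\<Union>C \<in> S" if C: "C \<noteq> {}" "subset.chain S C" for C
  proof -
    have sub: "C \<subseteq> S" and tot: "\<And>I K. I \<in> C \<Longrightarrow> K \<in> C \<Longrightarrow> I \<subseteq> K \<or> K \<subseteq> I"
      using C(2) by (auto simp: subset.chain_def)
    have "idl (\<Union>C)"
      unfolding idl_def
    proof (intro conjI ballI allI)
      obtain I where "I \<in> C" using C(1) by blast
      then have "idl I" using sub by (auto simp: S_def)
      then show "0 \<in> \<Union>C" using \<open>I \<in> C\<close> idl_0 by blast
    next
      fix a b assume "a \<in> \<Union>C" "b \<in> \<Union>C"
      then obtain I K where "I \<in> C" "K \<in> C" "a \<in> I" "b \<in> K" by blast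
      moreover have "idl I" "idl K" using sub \<open>I \<in> C\<close> \<open>K \<in> C\<close> by (auto simp: S_def)
      ultimately show "a + b \<in> \<Union>C" using tot[of I K] by (meson UnionI idl_add subsetD)
    next
      fix a r assume "a \<in> \<Union>C"
      then obtain I where I: "I \<in> C" "a \<in> I" by blast
      then have "idl I" using sub by (auto simp: S_def)
      then show "r * a \<in> \<Union>C" using I idl_mult by blast
    qed
    moreover have "J \<subseteq> \<Union>C" using C(1) sub by (auto simp: S_def)
    moreover have "x ^ n \<notin> \<Union>C" for n using sub by (auto simp: S_def)
    ultimately show ?thesis by (simp add: S_def)
  qed
  ultimately obtain M where M: "M \<in> S" "\<And>I. I \<in> S \<Longrightarrow> M \<subseteq> I \<Longrightarrow> I = M"
    using subset_Zorn_nonempty[of S] by blast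
  have iM: "idl M" "J \<subseteq> M" "\<And>n. x ^ n \<notin> M" using M(1) by (auto simp: S_def)
  \<comment> \<open>By maximality, the ideal generated by \<open>M\<close> and \<open>a\<close> must
    contain a power of \<open>x\<close>.\<close>
  have ex: "\<exists>n r m. m \<in> M \<and> x ^ n = m + r * a" if "a \<notin> M" for a
  proof (rule ccontr)
    assume neg: "\<not> ?thesis"
    let ?I = "{m + r * a | m r. m \<in> M}"
    have "idl ?I"
      unfolding idl_def
    proof (intro conjI ballI allI)
      show "0 \<in> ?I" using idl_0[OF iM(1)] by (intro CollectI exI[of _ 0]) auto
    next
      fix u v assume "u \<in> ?I" "v \<in> ?I"
      then obtain m r m' r' where "u = m + r * a" "v = m' + r' * a" "m \<in> M" "m' \<in> M" by blast
      then show "u + v \<in> ?I" using idl_add[OF iM(1)]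
        by (intro CollectI exI[of _ "m + m'"] exI[of _ "r + r'"]) (auto simp: algebra_simps)
    next
      fix u s assume "u \<in> ?I"
      then obtain m r where "u = m + r * a" "m \<in> M" by blast
      then show "s * u \<in> ?I" using idl_mult[OF iM(1)]
        by (intro CollectI exI[of _ "s * m"] exI[of _ "s * r"]) (auto simp: algebra_simps)
    qed
    moreover have sub: "M \<subseteq> ?I"
    proof
      fix m assume "m \<in> M"
      then show "m \<in> ?I" by (intro CollectI exI[of _ m] exI[of _ 0]) simp
    qed
    ultimately have "?I \<in> S" using neg iM(2) by (auto simp: S_def)
    then have "?I = M" using M(2) sub by blast
    moreover have "a \<in> ?I" using idl_0[OF iM(1)] by (intro CollectI exI[of _ 0] exI[of _ 1]) auto
    ultimately show False using that by simp
  qed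
  have "a \<in> M \<or> b \<in> M" if ab: "a * b \<in> M" for a b
  proof (rule ccontr)
    assume "\<not> ?thesis"
    then obtain n r m k s q where *: "m \<in> M" "x ^ n = m + r * a" "q \<in> M" "x ^ k = q + s * b"
      using ex[of a] ex[of b] by blast
    have "x ^ (n + k) = (q + s * b) * m + (r * a) * q + (r * s) * (a * b)"
      by (simp add: power_add * algebra_simps)
    also have "\<dots> \<in> M" by (intro idl_add idl_mult iM * ab)
    finally show False using iM(3) by blast
  qed
  then show ?thesis using that iM by blast
qed

section \<open>Blocks of columns\<close>

text \<open>Block number and position in the block of column \<open>p\<close>, inverse to
  \<open>block_start ns k + j\<close>. The empty list is reached only for \<open>p\<close> beyond
  the last column.\<close>

fun loc :: "nat list \<Rightarrow> nat \<Rightarrow> nat \<times> nat" where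
  "loc [] p = (0, p)"
| "loc (n # ns) p = (if p < n then (0, p) else (Suc (fst (loc ns (p - n))), snd (loc ns (p - n))))"

lemma block_start_0 [simp]: "block_start ns 0 = 0"
  by (simp add: block_start_def)

lemma block_start_Cons_Suc [simp]: "block_start (n # ns) (Suc k) = n + block_start ns k"
  by (simp add: block_start_def)

lemma loc_block_start: "k < length ns \<Longrightarrow> j < ns ! k \<Longrightarrow> loc ns (block_start ns k + j) = (k, j)"
proof (induction ns arbitrary: k)
  case (Cons n ns)
  then show ?case by (cases k) auto
qed simp

lemma loc_inverse:
  "p < sum_list ns \<Longrightarrow> fst (loc ns p) < length ns \<and> snd (loc ns p) < ns ! fst (loc ns p) \<and>
     p = block_start ns (fst (loc ns p)) + snd (loc ns p)"
proof (induction ns arbitrary: p)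
  case (Cons n ns)
  show ?case
  proof (cases "p < n")
    case False
    then have "p - n < sum_list ns" using Cons.prems by auto
    from Cons.IH[OF this] False show ?thesis by auto
  qed simp
qed simp

lemma block_start_less: "k < length ns \<Longrightarrow> j < ns ! k \<Longrightarrow> block_start ns k + j < sum_list ns"
proof (induction ns arbitrary: k)
  case (Cons n ns)
  then show ?case by (cases k) (auto simp: add.assoc)
qed simp

lemma sum_blocks:
  "(\<Sum>p<sum_list ns. f p) = (\<Sum>k<length ns. \<Sum>j<ns ! k. f (block_start ns k + j) :: 'a::comm_monoid_add)"
proof -
  have L: "loc ns p \<in> (SIGMA k:{..<length ns}. {..<ns ! k})" if "p < sum_list ns" for p
    using loc_inverse[OF that] by (cases "loc ns p") simp
  have W: "block_start ns (fst (loc ns p)) + snd (loc ns p) = p" if "p < sum_list ns" for p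
    using loc_inverse[OF that] by simp
  have "(\<Sum>k<length ns. \<Sum>j<ns ! k. f (block_start ns k + j))
      = (\<Sum>(k, j)\<in>(SIGMA k:{..<length ns}. {..<ns ! k}). f (block_start ns k + j))"
    by (simp add: sum.Sigma)
  also have "\<dots> = (\<Sum>p<sum_list ns. f p)"
    by (rule sum.reindex_bij_witness[of _ "loc ns" "\<lambda>(k, j). block_start ns k + j"])
       (use L W in \<open>auto simp: loc_block_start block_start_less case_prod_unfold\<close>)
  finally show ?thesis by simp
qed

text \<open>Greedy filling of the entries from the left. It serves both to enlarge a family of
  cut-offs to a weight of total \<open>r + 1\<close> and to shrink one to such a weight.\<close>

lemma exists_intermediate_weight:
  assumes "length ms = length ns" "\<forall>k<length ns. ms ! k \<le> ns ! k" "sum_list ms \<le> t" "t \<le> sum_list ns"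
  shows "\<exists>\<mu>. length \<mu> = length ns \<and> (\<forall>k<length ns. ms ! k \<le> \<mu> ! k \<and> \<mu> ! k \<le> ns ! k) \<and> sum_list \<mu> = (t::nat)"
  using assms
proof (induction ns arbitrary: ms t)
  case Nil
  then show ?case by auto
next
  case (Cons n ns)
  then obtain m ms' where ms: "ms = m # ms'" by (cases ms) auto
  have mn: "m \<le> n" "\<forall>k<length ns. ms' ! k \<le> ns ! k" using Cons.prems(2) ms by force+
  have le: "sum_list ms' \<le> sum_list ns"
    using mn(2) Cons.prems(1) ms by (intro sum_list_mono2) auto
  \<comment> \<open>The first entry takes as much as it can while the later ones keep their lower
    bounds.\<close>
  define a where "a = min n (t - sum_list ms')"
  have a: "m \<le> a" "a \<le> n" "sum_list ms' \<le> t - a" "t - a \<le> sum_list ns" "a \<le> t"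
    using Cons.prems(3,4) ms mn le by (auto simp: a_def)
  from Cons.IH[of ms' "t - a"] a mn Cons.prems(1) ms obtain \<mu> where
    \<mu>: "length \<mu> = length ns" "\<forall>k<length ns. ms' ! k \<le> \<mu> ! k \<and> \<mu> ! k \<le> ns ! k" "sum_list \<mu> = t - a"
    by auto
  show ?case
    using \<mu> a by (intro exI[of _ "a # \<mu>"]) (auto simp: ms nth_Cons split: nat.splits)
qed

definition sub_cols :: "nat list \<Rightarrow> nat list \<Rightarrow> nat list" where
  "sub_cols ns \<mu> = concat (map (\<lambda>k. map (\<lambda>j. block_start ns k + j) [0..<\<mu> ! k]) [0..<length ns])"

lemma set_sub_cols: "set (sub_cols ns \<mu>) = {block_start ns k + j | k j. k < length ns \<and> j < \<mu> ! k}"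
proof -
  have "set (sub_cols ns \<mu>) = (\<Union>k\<in>{..<length ns}. (\<lambda>j. block_start ns k + j) ` {..<\<mu> ! k})"
    by (simp add: sub_cols_def lessThan_atLeast0)
  also have "\<dots> = {block_start ns k + j | k j. k < length ns \<and> j < \<mu> ! k}"
    by (rule Set.set_eqI) (unfold UN_iff image_iff mem_Collect_eq lessThan_iff Bex_def, blast)
  finally show ?thesis .
qed

lemma length_sub_cols: assumes "length \<mu> = length ns" shows "length (sub_cols ns \<mu>) = sum_list \<mu>"
proof -
  have "map (\<lambda>k. \<mu> ! k) [0..<length ns] = \<mu>" using assms by (metis map_nth)
  then show ?thesis by (simp add: sub_cols_def length_concat o_def)
qed

lemma distinct_sub_cols: assumes "\<forall>k<length ns. \<mu> ! k \<le> ns ! k" shows "distinct (sub_cols ns \<mu>)"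
proof -
  have inj: "k = k'" if "k < length ns" "k' < length ns" "block_start ns k \<le> x" "block_start ns k' \<le> x"
    "x < \<mu> ! k + block_start ns k" "x < \<mu> ! k' + block_start ns k'" for k k' x
  proof -
    have "x - block_start ns k < ns ! k" "x - block_start ns k' < ns ! k'"
      using that assms by (metis add.commute less_diff_conv2 order_less_le_trans)+
    then show ?thesis
      using loc_block_start[of k ns "x - block_start ns k"] loc_block_start[of k' ns "x - block_start ns k'"] that
      by simp
  qed
  have "distinct (concat (map (\<lambda>k. map (\<lambda>j. block_start ns k + j) [0..<\<mu> ! k]) ks))"
    if "distinct ks" "set ks \<subseteq> {..<length ns}" for ks
    using that
  proof (induction ks)
    case (Cons k ks)
    let ?f = "\<lambda>k. map (\<lambda>j. block_start ns k + j) [0..<\<mu> ! k]"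
    have "set (?f k) \<inter> set (?f k') = {}" if "k' \<in> set ks" for k'
    proof (rule equals0I)
      fix x assume "x \<in> set (?f k) \<inter> set (?f k')"
      then have "k = k'" using Cons.prems that by (intro inj[of k k' x]) auto
      then show False using that Cons.prems by auto
    qed
    then have "set (?f k) \<inter> (\<Union>k'\<in>set ks. set (?f k')) = {}" by blast
    moreover have "distinct (?f k)" by (simp add: distinct_map inj_on_def)
    moreover have "distinct (concat (map ?f ks))" using Cons by auto
    ultimately show ?case
      unfolding list.map concat.simps distinct_append set_concat set_map image_image by blast
  qed simp
  from this[of "[0..<length ns]"] show ?thesis by (simp add: sub_cols_def atLeast0LessThan)
qed

lemma z_sub_cols:
  assumes z: "z \<in> carrier_mat (r + 1) (sum_list ns)" and \<mu>: "\<mu> \<in> sub_weights r ns"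
  shows "z_sub r ns \<mu> z \<in> carrier_mat (r + 1) (r + 1)"
    and "i < r + 1 \<Longrightarrow> c < r + 1 \<Longrightarrow> z_sub r ns \<mu> z $$ (i, c) = z $$ (i, sub_cols ns \<mu> ! c)"
    and "set (sub_cols ns \<mu>) \<subseteq> {..<sum_list ns}" "length (sub_cols ns \<mu>) = r + 1"
    "distinct (sub_cols ns \<mu>)"
proof -
  have *: "z_sub r ns \<mu> z = mat_of_cols (r + 1) (map (col z) (sub_cols ns \<mu>))"
    unfolding z_sub_def sub_cols_def by (simp add: map_concat o_def)
  have \<mu>': "length \<mu> = length ns" "\<forall>k<length ns. \<mu> ! k \<le> ns ! k" "sum_list \<mu> = r + 1"
    using \<mu> by (auto simp: sub_weights_def)
  show len: "length (sub_cols ns \<mu>) = r + 1" using length_sub_cols \<mu>' by metis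
  show sub: "set (sub_cols ns \<mu>) \<subseteq> {..<sum_list ns}"
  proof
    fix p assume "p \<in> set (sub_cols ns \<mu>)"
    then obtain k j where p: "p = block_start ns k + j" "k < length ns" "j < \<mu> ! k"
      unfolding set_sub_cols by blast
    then have "j < ns ! k" using \<mu>'(2) by (metis order_less_le_trans)
    then show "p \<in> {..<sum_list ns}" using block_start_less p by simp
  qed
  show "distinct (sub_cols ns \<mu>)" using \<mu>' by (intro distinct_sub_cols)
  show "z_sub r ns \<mu> z \<in> carrier_mat (r + 1) (r + 1)" using len by (simp add: * mat_of_cols_def)
  assume "i < r + 1" "c < r + 1"
  moreover have "sub_cols ns \<mu> ! c < sum_list ns"
    using sub nth_mem[of c "sub_cols ns \<mu>"] \<open>c < r + 1\<close> unfolding len by blast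
  ultimately show "z_sub r ns \<mu> z $$ (i, c) = z $$ (i, sub_cols ns \<mu> ! c)"
    using len z by (simp add: * mat_of_cols_index)
qed

lemma z_sub_inverse:
  assumes z: "z \<in> generic_stratum r ns" and \<mu>: "\<mu> \<in> sub_weights r ns"
  obtains W where "W \<in> carrier_mat (r + 1) (r + 1)" "z_sub r ns \<mu> z * W = 1\<^sub>m (r + 1)"
    "W * z_sub r ns \<mu> z = 1\<^sub>m (r + 1)"
proof -
  have c: "z_sub r ns \<mu> z \<in> carrier_mat (r + 1) (r + 1)"
    using z_sub_cols(1) z \<mu> by (auto simp: generic_stratum_def)
  have "det (z_sub r ns \<mu> z) \<noteq> 0" using z \<mu> by (auto simp: generic_stratum_def)
  from det_non_zero_imp_unit[OF c this, of "()"] show ?thesis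
    using that c by (auto simp: Units_def ring_mat_def)
qed

section \<open>The common zeros of the symbols\<close>

lemma idl_cancel: "idl I \<Longrightarrow> x \<in> I \<Longrightarrow> x = a + b \<Longrightarrow> b \<in> I \<Longrightarrow> a \<in> I"
  using idl_diff[of I x b] by simp

text \<open>
  Modulo a prime ideal containing the symbols, the matrix of variables has rank one, say
  \<open>a\<^sub>i b\<^sub>p\<close>.  With \<open>c = a z\<close>, the relations \<open>\<Sum>\<^sub>j c\<^sub>j b\<^sub>j\<^sub>+\<^sub>m = 0\<close> in a block of size \<open>n\<close> force a
  cut-off \<open>m\<^sub>k\<close> with \<open>c\<^sub>j = 0\<close> for \<open>j < m\<^sub>k\<close> and \<open>b\<^sub>j = 0\<close> for \<open>j \<ge> m\<^sub>k\<close>, and then one of the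
  invertible matrices \<open>z\<^sub>\<mu>\<close> annihilates \<open>a\<close> or \<open>b\<close>.
\<close>

lemma Var_in_prime_ideal:
  fixes M :: "(nat \<times> nat) mpoly set"
  assumes M: "idl M" and prime: "\<And>a b. a * b \<in> M \<Longrightarrow> a \<in> M \<or> b \<in> M"
    and minors: "\<And>i j p q. i < r + 1 \<Longrightarrow> j < r + 1 \<Longrightarrow> p < sum_list ns \<Longrightarrow> q < sum_list ns \<Longrightarrow>
      Var (i, p) * Var (j, q) - Var (i, q) * Var (j, p) \<in> M"
    and tor: "\<And>k m. k < length ns \<Longrightarrow> m < ns ! k \<Longrightarrow> (\<Sum>j<ns ! k - m. \<Sum>i<r + 1.
      Con (z $$ (i, block_start ns k + j)) * Var (i, block_start ns k + j + m)) \<in> M"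
    and row: "\<And>i j. i < r + 1 \<Longrightarrow> j < r + 1 \<Longrightarrow> (\<Sum>p<sum_list ns. Con (z $$ (j, p)) * Var (i, p)) \<in> M"
    and z: "z \<in> generic_stratum r ns" and rN: "r + 1 \<le> sum_list ns"
    and i0: "i0 < r + 1" and p0: "p0 < sum_list ns"
  shows "Var (i0, p0) \<in> M"
proof (rule ccontr)
  let ?N = "sum_list ns" and ?bs = "block_start ns"
  assume v: "Var (i0, p0) \<notin> M"
  have zc: "z \<in> carrier_mat (r + 1) ?N" using z by (auto simp: generic_stratum_def)
  \<comment> \<open>The rank-one factors are not elements of the ring, so column \<open>p0\<close>
    stands for the factor \<open>a\<close> and row \<open>i0\<close> for the factor
    \<open>b\<close>; thus \<open>c q\<close> represents the entry of \<open>a z\<close> at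
    \<open>q\<close>.\<close>
  define c where "c q = (\<Sum>i<r + 1. Con (z $$ (i, q)) * Var (i, p0))" for q
  have rank1: "Var (i, p) * Var (i0, p0) - Var (i, p0) * Var (i0, p) \<in> M"
    if "i < r + 1" "p < ?N" for i p
    using minors[OF that(1) i0 that(2) p0] by simp
  have cb: "(\<Sum>j<ns ! k - m. c (?bs k + j) * Var (i0, ?bs k + j + m)) \<in> M"
    if k: "k < length ns" "m < ns ! k" for k m
  proof -
    have "(\<Sum>j<ns ! k - m. \<Sum>i<r + 1. Con (z $$ (i, ?bs k + j)) * Var (i, ?bs k + j + m)) * Var (i0, p0)
       - (\<Sum>j<ns ! k - m. c (?bs k + j) * Var (i0, ?bs k + j + m))
       = (\<Sum>j<ns ! k - m. \<Sum>i<r + 1. Con (z $$ (i, ?bs k + j)) *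
           (Var (i, ?bs k + j + m) * Var (i0, p0) - Var (i, p0) * Var (i0, ?bs k + j + m)))"
      unfolding c_def sum_distrib_right sum_subtractf[symmetric]
      by (intro sum.cong refl) (simp only: right_diff_distrib mult_ac)
    also have "\<dots> \<in> M"
    proof (rule idl_sum[OF M], rule idl_sum[OF M], rule idl_mult[OF M], rule rank1)
      fix j assume "j \<in> {..<ns ! k - m}"
      then show "?bs k + j + m < ?N" using block_start_less[of k ns "j + m"] k by (simp add: add.assoc)
    qed simp
    finally show ?thesis
      using idl_cong_diff[OF M] idl_mult_right[OF M tor[OF that], of "Var (i0, p0)"] by (simp only:)
  qed
  \<comment> \<open>The cut-off of block \<open>k\<close>: the first position where \<open>c\<close>
    leaves \<open>M\<close>, or the block size if there is none.\<close>
  define mm where "mm k = (LEAST j. j = ns ! k \<or> c (?bs k + j) \<notin> M)" for k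
  have mm: "mm k = ns ! k \<or> c (?bs k + mm k) \<notin> M" "mm k \<le> ns ! k" for k
    unfolding mm_def by (rule LeastI[of _ "ns ! k"], simp, rule Least_le, simp)
  have mm_less: "c (?bs k + j) \<in> M" if "j < mm k" for j k
    using not_less_Least[OF that[unfolded mm_def]] by simp
  have bM: "Var (i0, ?bs k + q) \<in> M" if "k < length ns" "mm k \<le> q" "q < ns ! k" for k q
    using that(2,3)
  proof (induction "ns ! k - q" arbitrary: q rule: less_induct)
    case less
    \<comment> \<open>In the relation with shift \<open>q - mm k\<close>, the product of
      \<open>c\<close> at the cut-off and \<open>b\<close> at \<open>q\<close> is the only term not
      yet known to lie in \<open>M\<close>: before the cut-off \<open>c\<close> lies in
      \<open>M\<close>, and behind it the induction, descending from the end of the block, covers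
      \<open>b\<close>.\<close>
    define m where "m = q - mm k"
    have m: "m < ns ! k" "mm k < ns ! k - m" using less.prems by (auto simp: m_def)
    let ?f = "\<lambda>j. c (?bs k + j) * Var (i0, ?bs k + j + m)"
    have "(\<Sum>j<ns ! k - m. ?f j) = ?f (mm k) + (\<Sum>j\<in>{..<ns ! k - m} - {mm k}. ?f j)"
      using m by (intro sum.remove) auto
    moreover have "(\<Sum>j\<in>{..<ns ! k - m} - {mm k}. ?f j) \<in> M"
    proof (rule idl_sum[OF M])
      fix j assume j: "j \<in> {..<ns ! k - m} - {mm k}"
      show "?f j \<in> M"
      proof (cases "j < mm k")
        case True
        then show ?thesis using idl_mult_right[OF M mm_less] by blast
      next
        case False
        then have "q < j + m" "j + m < ns ! k" using j less.prems by (auto simp: m_def)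
        then have "Var (i0, ?bs k + (j + m)) \<in> M" using less.prems by (intro less.hyps) auto
        then show ?thesis using idl_mult[OF M] by (simp add: add.assoc)
      qed
    qed
    ultimately have "?f (mm k) \<in> M" by (rule idl_cancel[OF M cb[OF that(1) m(1)]])
    then have "c (?bs k + mm k) \<in> M \<or> Var (i0, ?bs k + mm k + m) \<in> M" by (rule prime)
    moreover have "c (?bs k + mm k) \<notin> M" using mm(1)[of k] less.prems by simp
    moreover have "?bs k + mm k + m = ?bs k + q" using less.prems by (simp add: m_def)
    ultimately show ?case by simp
  qed
  define ms where "ms = map mm [0..<length ns]"
  have ms: "length ms = length ns" "\<forall>k<length ns. ms ! k = mm k" by (auto simp: ms_def)
  show False
  proof (cases "sum_list ms \<le> r + 1")
    \<comment> \<open>The cut-offs are enlarged to a weight \<open>\<mu>\<close>. Outside the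
      columns of \<open>\<mu>\<close>, row \<open>i0\<close> lies in \<open>M\<close>, so the row
      relations reduce to the square system with matrix \<open>z_sub r ns \<mu> z\<close>, which is
      invertible.\<close>
    case True
    with ms mm(2) rN obtain \<mu> where \<mu>: "length \<mu> = length ns"
      "\<forall>k<length ns. ms ! k \<le> \<mu> ! k \<and> \<mu> ! k \<le> ns ! k" "sum_list \<mu> = r + 1"
      using exists_intermediate_weight[of ms ns "r + 1"] by auto
    then have sw: "\<mu> \<in> sub_weights r ns" by (auto simp: sub_weights_def)
    note zs = z_sub_cols[OF zc sw]
    obtain W where W: "W \<in> carrier_mat (r + 1) (r + 1)" "W * z_sub r ns \<mu> z = 1\<^sub>m (r + 1)"
      using z_sub_inverse[OF z sw] by blast
    let ?cs = "sub_cols ns \<mu>"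
    have outside: "Var (i0, p) \<in> M" if "p < ?N" "p \<notin> set ?cs" for p
    proof -
      have "p < ?N" by fact
      then obtain k j where kj: "k < length ns" "j < ns ! k" "p = ?bs k + j"
        using loc_inverse by blast
      then have "\<not> j < \<mu> ! k" using that(2) unfolding set_sub_cols by blast
      moreover have "mm k \<le> \<mu> ! k" using \<mu>(2)[rule_format, of k] ms(2) kj(1) by simp
      ultimately have "mm k \<le> j" by simp
      then show ?thesis using bM kj by blast
    qed
    have zb: "(\<Sum>c'<r + 1. Con (z_sub r ns \<mu> z $$ (j, c')) * Var (i0, ?cs ! c')) \<in> M" if "j < r + 1" for j
    proof -
      let ?g = "\<lambda>p. Con (z $$ (j, p)) * Var (i0, p)"
      have "(\<Sum>p<?N. ?g p) = (\<Sum>p\<in>set ?cs. ?g p) + (\<Sum>p\<in>{..<?N} - set ?cs. ?g p)"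
        using sum.subset_diff[OF zs(3), of ?g] by (simp only: finite_lessThan add.commute)
      moreover have "(\<Sum>p\<in>{..<?N} - set ?cs. ?g p) \<in> M"
        by (rule idl_sum[OF M], rule idl_mult[OF M], rule outside) auto
      ultimately have "(\<Sum>p\<in>set ?cs. ?g p) \<in> M" by (rule idl_cancel[OF M row[OF i0 that]])
      moreover have "(\<Sum>c'<r + 1. ?g (?cs ! c')) = (\<Sum>p\<in>set ?cs. ?g p)"
        using zs(4) by (intro sum.reindex_bij_betw bij_betw_nth zs(5)) simp_all
      moreover have "(\<Sum>c'<r + 1. Con (z_sub r ns \<mu> z $$ (j, c')) * Var (i0, ?cs ! c')) = (\<Sum>c'<r + 1. ?g (?cs ! c'))"
        using zs(2)[OF that] by (intro sum.cong) simp_all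
      ultimately show ?thesis by (simp only:)
    qed
    have "Var (i0, ?cs ! c') \<in> M" if c': "c' < r + 1" for c'
    proof -
      have "(\<Sum>j<r + 1. Con (W $$ (c', j)) * (\<Sum>d<r + 1. Con (z_sub r ns \<mu> z $$ (j, d)) * Var (i0, ?cs ! d))) \<in> M"
        by (rule idl_sum[OF M], rule idl_mult[OF M], rule zb) simp
      also have "(\<Sum>j<r + 1. Con (W $$ (c', j)) * (\<Sum>d<r + 1. Con (z_sub r ns \<mu> z $$ (j, d)) * Var (i0, ?cs ! d)))
         = (\<Sum>d<r + 1. Con (\<Sum>j<r + 1. W $$ (c', j) * z_sub r ns \<mu> z $$ (j, d)) * Var (i0, ?cs ! d))"
        by (unfold Con_sum Con_mult sum_distrib_left sum_distrib_right mult.assoc) (rule sum.swap)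
      also have "\<dots> = (\<Sum>d<r + 1. Con (1\<^sub>m (r + 1) $$ (c', d)) * Var (i0, ?cs ! d))"
        using c' W(1) zs(1) unfolding W(2)[symmetric]
        by (intro sum.cong refl arg_cong2[of _ _ _ _ "(*)"] arg_cong[of _ _ Con])
           (auto simp: scalar_prod_def lessThan_atLeast0)
      also have "\<dots> = (\<Sum>d<r + 1. if d = c' then Var (i0, ?cs ! d) else 0)"
        using c' by (intro sum.cong) auto
      also have "\<dots> = Var (i0, ?cs ! c')" using c' by simp
      finally show ?thesis .
    qed
    then have "Var (i0, p) \<in> M" if "p \<in> set ?cs" for p
    proof -
      from that obtain c' where "c' < r + 1" "p = ?cs ! c'" unfolding in_set_conv_nth zs(4) by blast
      then show ?thesis using \<open>\<And>c'. c' < r + 1 \<Longrightarrow> Var (i0, ?cs ! c') \<in> M\<close> by simp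
    qed
    then show False using outside[OF p0] v by blast
  next
    \<comment> \<open>The cut-offs are shrunk to a weight \<open>\<mu>\<close>. Now \<open>c\<close>
      lies in \<open>M\<close> on all columns of \<open>\<mu>\<close>, and inverting
      \<open>z_sub r ns \<mu> z\<close> recovers \<open>Var (i0, p0)\<close> from these entries of
      \<open>a z\<close>.\<close>
    case False
    have "length (map (\<lambda>_. 0) [0..<length ns]) = length ms" using ms by simp
    with False obtain \<mu> where \<mu>: "length \<mu> = length ms"
      "\<forall>k<length ms. \<mu> ! k \<le> ms ! k" "sum_list \<mu> = r + 1"
      using exists_intermediate_weight[of "map (\<lambda>_. 0) [0..<length ns]" ms "r + 1"] ms(1) by auto
    have "\<mu> ! k \<le> ns ! k" if "k < length ns" for k
      using \<mu>(2)[rule_format, of k] ms mm(2)[of k] that by simp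
    then have sw: "\<mu> \<in> sub_weights r ns" using \<mu> ms by (simp add: sub_weights_def)
    note zs = z_sub_cols[OF zc sw]
    obtain W where W: "W \<in> carrier_mat (r + 1) (r + 1)" "z_sub r ns \<mu> z * W = 1\<^sub>m (r + 1)"
      using z_sub_inverse[OF z sw] by blast
    let ?cs = "sub_cols ns \<mu>"
    have cM: "c (?cs ! d) \<in> M" if "d < r + 1" for d
    proof -
      have "?cs ! d \<in> set ?cs" using zs(4) that by auto
      then obtain k j where "?cs ! d = ?bs k + j" "k < length ns" "j < \<mu> ! k"
        unfolding set_sub_cols by blast
      moreover have "\<mu> ! k \<le> mm k" using \<mu>(2)[rule_format, of k] ms \<open>k < length ns\<close> by simp
      ultimately show ?thesis using mm_less[of j k] by simp
    qed
    have "(\<Sum>d<r + 1. Con (W $$ (d, i0)) * c (?cs ! d)) \<in> M"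
      by (rule idl_sum[OF M], rule idl_mult[OF M], rule cM) simp
    also have "(\<Sum>d<r + 1. Con (W $$ (d, i0)) * c (?cs ! d))
       = (\<Sum>d<r + 1. \<Sum>i<r + 1. Con (z_sub r ns \<mu> z $$ (i, d) * W $$ (d, i0)) * Var (i, p0))"
      unfolding c_def sum_distrib_left
      using zs(2) by (intro sum.cong refl) (simp only: lessThan_iff Con_mult mult_ac)
    also have "\<dots> = (\<Sum>i<r + 1. Con (\<Sum>d<r + 1. z_sub r ns \<mu> z $$ (i, d) * W $$ (d, i0)) * Var (i, p0))"
      by (subst sum.swap) (simp only: Con_sum sum_distrib_right)
    also have "\<dots> = (\<Sum>i<r + 1. Con (1\<^sub>m (r + 1) $$ (i, i0)) * Var (i, p0))"
      using i0 W(1) zs(1) unfolding W(2)[symmetric]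
      by (intro sum.cong refl arg_cong2[of _ _ _ _ "(*)"] arg_cong[of _ _ Con])
         (auto simp: scalar_prod_def lessThan_atLeast0)
    also have "\<dots> = (\<Sum>i<r + 1. if i = i0 then Var (i, p0) else 0)"
      using i0 by (intro sum.cong) auto
    also have "\<dots> = Var (i0, p0)" using i0 by simp
    finally show False using v by simp
  qed
qed

section \<open>The generators of the system and their formal adjoints\<close>

text \<open>
  Column \<open>j\<close> of a block corresponds to the Newton polynomial \<open>N\<^sub>j(x) = x (x - s) \<cdots> (x - (j - 1) s)\<close>, and
  \<open>newton_mult s m q p\<close> is the coefficient of \<open>N\<^sub>p\<close> in \<open>N\<^sub>m N\<^sub>q\<close>.  At \<open>s = 0\<close> this is the
  \<open>m\<close>-th power of the shift matrix; for \<open>s \<noteq> 0\<close> the algebra is semisimple modulo \<open>N\<^sub>n\<close>.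
\<close>

fun newton_mult :: "complex \<Rightarrow> nat \<Rightarrow> nat \<Rightarrow> nat \<Rightarrow> complex" where
  "newton_mult s 0 q p = (if p = q then 1 else 0)"
| "newton_mult s (Suc m) q p =
     (if p = 0 then 0 else newton_mult s m q (p - 1)) + s * (of_nat p - of_nat m) * newton_mult s m q p"

definition hmat :: "nat list \<Rightarrow> complex \<Rightarrow> (nat \<Rightarrow> nat \<Rightarrow> complex) \<Rightarrow> nat \<Rightarrow> nat \<Rightarrow> complex" where
  "hmat ns s x q p = (if fst (loc ns q) = fst (loc ns p)
     then \<Sum>m<ns ! fst (loc ns q). x (fst (loc ns q)) m * newton_mult s m (snd (loc ns q)) (snd (loc ns p))
     else 0)"

text \<open>One index type for the three families of equations: second-order minors, the action of
  the block algebra on columns (an element is given by its coordinates), and the action of a matrix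
  on rows.\<close>

datatype gen = Minor nat nat nat nat | Tor "nat \<Rightarrow> nat \<Rightarrow> complex" | Row "complex mat"

definition cells :: "nat \<Rightarrow> nat list \<Rightarrow> (nat \<times> nat) set" where
  "cells r ns = {..<r + 1} \<times> {..<sum_list ns}"

fun valid :: "nat \<Rightarrow> nat list \<Rightarrow> gen \<Rightarrow> bool" where
  "valid r ns (Minor i j p q) = (i < r + 1 \<and> j < r + 1 \<and> p < sum_list ns \<and> q < sum_list ns)"
| "valid r ns _ = True"

fun gord :: "gen \<Rightarrow> nat" where
  "gord (Minor i j p q) = 2"
| "gord _ = 1"

text \<open>The coefficient of \<open>z b\<close> times the derivative at \<open>a\<close> in a
  first-order generator; for \<open>Tor\<close> it is taken in the deformed algebra.\<close>

fun tens :: "nat list \<Rightarrow> complex \<Rightarrow> gen \<Rightarrow> nat \<times> nat \<Rightarrow> nat \<times> nat \<Rightarrow> complex" where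
  "tens ns s (Tor x) a b = (if fst a = fst b then hmat ns s x (snd b) (snd a) else 0)"
| "tens ns s (Row Y) a b = (if snd a = snd b then Y $$ (fst a, fst b) else 0)"
| "tens ns s (Minor i j p q) a b = 0"

fun cst :: "nat \<Rightarrow> nat list \<Rightarrow> (nat \<Rightarrow> nat \<Rightarrow> complex) \<Rightarrow> gen \<Rightarrow> complex" where
  "cst r ns \<alpha> (Tor x) = - h_char ns \<alpha> x"
| "cst r ns \<alpha> (Row Y) = (\<Sum>i<r + 1. Y $$ (i, i))"
| "cst r ns \<alpha> (Minor i j p q) = 0"

text \<open>
  The operator \<open>\<Sum> L\<^sub>a\<^sub>b z\<^sub>b \<partial>\<^sub>a + c\<close>, in coordinates centred at \<open>z\<close>, is the transpose of
  \<open>first_order\<close> for the apolar pairing.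
\<close>

definition first_order :: "'v set \<Rightarrow> ('v \<Rightarrow> complex) \<Rightarrow> ('v \<Rightarrow> 'v \<Rightarrow> complex) \<Rightarrow> complex \<Rightarrow> 'v mpoly \<Rightarrow> 'v mpoly" where
  "first_order G z L c w =
     (\<Sum>a\<in>G. \<Sum>b\<in>G. Con (L a b) * (Con (z b) * (Var a * w) + Var a * D b w)) + Con c * w"

text \<open>The transposed action of a generator on polynomials in the derivatives, at the point
  \<open>z\<close>. The second-order generators have constant coefficients and become plain
  multiplications.\<close>

fun gop :: "nat \<Rightarrow> nat list \<Rightarrow> complex \<Rightarrow> (nat \<Rightarrow> nat \<Rightarrow> complex) \<Rightarrow> (nat \<times> nat \<Rightarrow> complex) \<Rightarrow> gen \<Rightarrow>
    (nat \<times> nat) mpoly \<Rightarrow> (nat \<times> nat) mpoly" where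
  "gop r ns s \<alpha> z (Minor i j p q) w = (Var (i, p) * Var (j, q) - Var (i, q) * Var (j, p)) * w"
| "gop r ns s \<alpha> z (Tor x) w = first_order (cells r ns) z (tens ns s (Tor x)) (cst r ns \<alpha> (Tor x)) w"
| "gop r ns s \<alpha> z (Row Y) w = first_order (cells r ns) z (tens ns s (Row Y)) (cst r ns \<alpha> (Row Y)) w"

fun symb :: "nat \<Rightarrow> nat list \<Rightarrow> (nat \<times> nat \<Rightarrow> complex) \<Rightarrow> gen \<Rightarrow> (nat \<times> nat) mpoly" where
  "symb r ns z (Minor i j p q) = Var (i, p) * Var (j, q) - Var (i, q) * Var (j, p)"
| "symb r ns z g = (\<Sum>a\<in>cells r ns. Con (\<Sum>b\<in>cells r ns. tens ns 0 g a b * z b) * Var a)"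

lemma finite_cells [simp]: "finite (cells r ns)"
  by (simp add: cells_def)

lemma first_order_Con_mult: "first_order G z L c (Con d * u) = Con d * first_order G z L c u"
  unfolding first_order_def D_Con_mult distrib_left sum_distrib_left
  by (simp only: mult_ac)

lemma gop_Con_mult: "gop r ns s \<alpha> z g (Con c * u) = Con c * gop r ns s \<alpha> z g u"
  by (cases g) (simp_all add: first_order_Con_mult mult.left_commute)

lemma Pol_Var_D: assumes "w \<in> Pol G k" "a \<in> G" shows "Var a * D b w \<in> Pol G k"
proof (cases k)
  case 0
  then show ?thesis using assms by (simp add: Pol_Zero_iff)
next
  case (Suc k')
  then show ?thesis using Pol_Var_mult[OF Pol_D assms(2), of w k' b] assms(1) by simp
qed

lemma Pol_first_order: assumes "w \<in> Pol G k" shows "first_order G z L c w \<in> Pol G (k + 1)"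
proof -
  have "Con (L a b) * (Con (z b) * (Var a * w) + Var a * D b w) \<in> Pol G (k + 1)" if "a \<in> G" for a b
    using assms that Pol_Var_mult[OF assms that] Pol_mono[OF Pol_Var_D[OF assms that, of b], of "k + 1"]
    by (intro Pol_Con_mult Pol_add) auto
  moreover have "Con c * w \<in> Pol G (k + 1)" by (rule Pol_Con_mult[OF Pol_mono[OF assms]]) simp
  ultimately show ?thesis unfolding first_order_def by (intro Pol_add Pol_sum)
qed

text \<open>What remains after removing the symbol are terms \<open>Var a * D b\<close> and a
  constant, and neither raises the degree.\<close>

lemma first_order_symbol:
  assumes "w \<in> Pol G k"
  shows "(\<Sum>a\<in>G. Con (\<Sum>b\<in>G. L a b * z b) * Var a) * w - first_order G z L c w \<in> Pol G k"
proof -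
  have "(\<Sum>a\<in>G. Con (\<Sum>b\<in>G. L a b * z b) * Var a) * w - first_order G z L c w
     = (\<Sum>a\<in>G. \<Sum>b\<in>G. Con (- L a b) * (Var a * D b w)) + Con (- c) * w"
    unfolding first_order_def
    unfolding Con_sum Con_mult Con_uminus sum_distrib_right sum_distrib_left distrib_left sum.distrib
      minus_mult_left[symmetric] sum_negf
    by (simp add: mult_ac)
  also have "\<dots> \<in> Pol G k"
    using assms by (intro Pol_add Pol_sum Pol_Con_mult Pol_Var_D)
  finally show ?thesis .
qed

lemma Pol_gop:
  assumes "w \<in> Pol (cells r ns) k" "valid r ns g"
  shows "gop r ns s \<alpha> z g w \<in> Pol (cells r ns) (k + gord g)"
proof (cases g)
  case (Minor i j p q)
  have "Var (i, p) * (Var (j, q) * w) - Var (i, q) * (Var (j, p) * w) \<in> Pol (cells r ns) (Suc (Suc k))"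
    using assms Minor by (intro Pol_diff Pol_Var_mult) (auto simp: cells_def)
  then show ?thesis using Minor by (simp add: left_diff_distrib mult.assoc)
qed (use Pol_first_order[OF assms(1)] in auto)

text \<open>A homogeneous part restricted to monomials in \<open>G\<close>: the multipliers in
  \<open>symbol_ideal\<close> are arbitrary polynomials, and this projection discards foreign
  variables.\<close>

definition hpart :: "'v set \<Rightarrow> nat \<Rightarrow> 'v mpoly \<Rightarrow> 'v mpoly" where
  "hpart G n w = Poly_Mapping.Abs_poly_mapping (\<lambda>m. if keys m \<subseteq> G \<and> mdeg m = n then lookup w m else 0)"

lemma lookup_hpart: "lookup (hpart G n w) m = (if keys m \<subseteq> G \<and> mdeg m = n then lookup w m else 0)"
proof -
  have "finite {m. (if keys m \<subseteq> G \<and> mdeg m = n then lookup w m else 0) \<noteq> 0}"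
    by (rule finite_subset[of _ "keys w"]) (auto simp: in_keys_iff split: if_splits)
  then show ?thesis unfolding hpart_def by simp
qed

lemma hpart_add: "hpart G n (u + v) = hpart G n u + hpart G n v"
  by (rule poly_mapping_eqI) (simp add: lookup_hpart lookup_add)

lemma hpart_0 [simp]: "hpart G n 0 = 0"
  by (rule poly_mapping_eqI) (simp add: lookup_hpart)

lemma hpart_diff: "hpart G n (u - v) = hpart G n u - hpart G n v"
  by (rule poly_mapping_eqI) (simp add: lookup_hpart lookup_minus)

lemma hpart_Con_mult: "hpart G n (Con c * u) = Con c * hpart G n u"
  by (rule poly_mapping_eqI) (simp add: lookup_hpart)

lemma hpart_sum: "hpart G n (sum f A) = (\<Sum>x\<in>A. hpart G n (f x))"
  by (induction A rule: infinite_finite_induct) (simp_all add: hpart_add)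

lemma hpart_single: "hpart G n (single m c) = (if keys m \<subseteq> G \<and> mdeg m = n then single m c else 0)"
  by (rule poly_mapping_eqI) (auto simp: lookup_hpart lookup_single when_def)

lemma hpart_Var_mult:
  assumes "x \<in> G"
  shows "hpart G n (Var x * u) = (case n of 0 \<Rightarrow> 0 | Suc k \<Rightarrow> Var x * hpart G k u)"
  using assms
  by (induction u rule: mpoly_single_induct)
     (auto simp: hpart_add distrib_left hpart_single Var_mult_single keys_add_nat mdeg_add split: nat.splits)

lemma Pol_hpart: "hpart G n u \<in> Pol G (Suc n)"
  unfolding Pol_def mons_def
proof (intro CollectI subsetI)
  fix m assume "m \<in> keys (hpart G n u)"
  then have "keys m \<subseteq> G \<and> mdeg m = n" by (metis in_keys_iff lookup_hpart)
  then show "keys m \<subseteq> G \<and> mdeg m < Suc n" by simp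
qed

section \<open>The fibre of the system at a point\<close>

text \<open>The quotient of \<open>gpol (cells r ns)\<close> by the union of these spaces over
  \<open>m\<close> is the fibre at \<open>z\<close>. The order bound is imposed on each summand
  rather than on the sum, so that the same combination stays in \<open>Pol (cells r ns) m\<close>
  when the parameters and the point change.\<close>

definition fibre_rel :: "nat \<Rightarrow> nat list \<Rightarrow> (nat \<Rightarrow> nat \<Rightarrow> complex) \<Rightarrow> (nat \<times> nat \<Rightarrow> complex) \<Rightarrow> nat \<Rightarrow>
    (nat \<times> nat) mpoly set" where
  "fibre_rel r ns \<alpha> z m = {(\<Sum>(g, v)\<leftarrow>L. gop r ns 0 \<alpha> z g v) | L.
     \<forall>(g, v)\<in>set L. valid r ns g \<and> (\<exists>k. v \<in> Pol (cells r ns) k \<and> k + gord g \<le> m)}"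

lemma fibre_rel_0: "0 \<in> fibre_rel r ns \<alpha> z m"
  unfolding fibre_rel_def by (intro CollectI exI[of _ "[]"]) auto

lemma fibre_rel_gop:
  "valid r ns g \<Longrightarrow> v \<in> Pol (cells r ns) k \<Longrightarrow> k + gord g \<le> m \<Longrightarrow> gop r ns 0 \<alpha> z g v \<in> fibre_rel r ns \<alpha> z m"
  unfolding fibre_rel_def by (intro CollectI exI[of _ "[(g, v)]"]) auto

lemma fibre_rel_add:
  assumes "u \<in> fibre_rel r ns \<alpha> z m" "v \<in> fibre_rel r ns \<alpha> z m"
  shows "u + v \<in> fibre_rel r ns \<alpha> z m"
proof -
  obtain L1 L2 where
    "u = (\<Sum>(g, v)\<leftarrow>L1. gop r ns 0 \<alpha> z g v)" "v = (\<Sum>(g, v)\<leftarrow>L2. gop r ns 0 \<alpha> z g v)"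
    "\<forall>(g, v)\<in>set L1. valid r ns g \<and> (\<exists>k. v \<in> Pol (cells r ns) k \<and> k + gord g \<le> m)"
    "\<forall>(g, v)\<in>set L2. valid r ns g \<and> (\<exists>k. v \<in> Pol (cells r ns) k \<and> k + gord g \<le> m)"
    using assms unfolding fibre_rel_def by blast
  then show ?thesis unfolding fibre_rel_def by (intro CollectI exI[of _ "L1 @ L2"]) auto
qed

lemma fibre_rel_Con_mult:
  assumes "u \<in> fibre_rel r ns \<alpha> z m"
  shows "Con c * u \<in> fibre_rel r ns \<alpha> z m"
proof -
  obtain L where L: "u = (\<Sum>(g, v)\<leftarrow>L. gop r ns 0 \<alpha> z g v)"
    "\<forall>(g, v)\<in>set L. valid r ns g \<and> (\<exists>k. v \<in> Pol (cells r ns) k \<and> k + gord g \<le> m)"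
    using assms unfolding fibre_rel_def by blast
  let ?L = "map (\<lambda>(g, v). (g, Con c * v)) L"
  have "Con c * (\<Sum>(g, v)\<leftarrow>L. gop r ns 0 \<alpha> z g v) = (\<Sum>(g, v)\<leftarrow>map (\<lambda>(g, v). (g, Con c * v)) L. gop r ns 0 \<alpha> z g v)"
    by (induction L) (auto simp: distrib_left gop_Con_mult)
  moreover have "valid r ns g \<and> (\<exists>k. w \<in> Pol (cells r ns) k \<and> k + gord g \<le> m)" if gw: "(g, w) \<in> set ?L" for g w
  proof -
    obtain v where v: "(g, v) \<in> set L" "w = Con c * v" using gw by auto
    then obtain k where "valid r ns g" "v \<in> Pol (cells r ns) k" "k + gord g \<le> m" using L(2) by blast
    then show ?thesis using v Pol_Con_mult by blast
  qed
  then have "\<forall>(g, w)\<in>set ?L. valid r ns g \<and> (\<exists>k. w \<in> Pol (cells r ns) k \<and> k + gord g \<le> m)" by blast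
  ultimately show ?thesis unfolding fibre_rel_def L(1) by blast
qed

lemma fibre_rel_mono: "m \<le> n \<Longrightarrow> fibre_rel r ns \<alpha> z m \<subseteq> fibre_rel r ns \<alpha> z n"
proof
  fix u assume mn: "m \<le> n" and "u \<in> fibre_rel r ns \<alpha> z m"
  then obtain L where L: "u = (\<Sum>(g, v)\<leftarrow>L. gop r ns 0 \<alpha> z g v)"
    "\<forall>(g, v)\<in>set L. valid r ns g \<and> (\<exists>k. v \<in> Pol (cells r ns) k \<and> k + gord g \<le> m)"
    unfolding fibre_rel_def by blast
  have "\<forall>(g, v)\<in>set L. valid r ns g \<and> (\<exists>k. v \<in> Pol (cells r ns) k \<and> k + gord g \<le> n)"
    using L(2) mn le_trans by blast
  then show "u \<in> fibre_rel r ns \<alpha> z n" unfolding fibre_rel_def using L(1) by blast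
qed

lemma fibre_rel_sum:
  "(\<And>x. x \<in> A \<Longrightarrow> f x \<in> fibre_rel r ns \<alpha> z m) \<Longrightarrow> sum f A \<in> fibre_rel r ns \<alpha> z m"
  by (induction A rule: infinite_finite_induct) (auto intro: fibre_rel_add fibre_rel_0)

lemma fibre_rel_poly:
  assumes "\<And>k. k \<in> keys v \<Longrightarrow> single k 1 \<in> fibre_rel r ns \<alpha> z m"
  shows "v \<in> fibre_rel r ns \<alpha> z m"
proof -
  have "v = (\<Sum>k\<in>keys v. Con (lookup v k) * single k 1)"
    using mpoly_sum_single[of v] by (simp add: Con_mult_single)
  also have "\<dots> \<in> fibre_rel r ns \<alpha> z m" by (intro fibre_rel_sum fibre_rel_Con_mult assms)
  finally show ?thesis .
qed

section \<open>Finiteness of the fibre\<close>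

inductive_set symbol_ideal :: "nat \<Rightarrow> nat list \<Rightarrow> (nat \<times> nat \<Rightarrow> complex) \<Rightarrow> (nat \<times> nat) mpoly set"
  for r ns z where
  zero: "0 \<in> symbol_ideal r ns z"
| step: "v \<in> symbol_ideal r ns z \<Longrightarrow> valid r ns g \<Longrightarrow> u * symb r ns z g + v \<in> symbol_ideal r ns z"

lemma idl_symbol_ideal: "idl (symbol_ideal r ns z)"
  unfolding idl_def
proof (intro conjI ballI allI)
  fix a b assume "a \<in> symbol_ideal r ns z" "b \<in> symbol_ideal r ns z"
  then show "a + b \<in> symbol_ideal r ns z"
    by (induction a rule: symbol_ideal.induct) (auto simp: add.assoc intro: symbol_ideal.intros)
next
  fix a u assume "a \<in> symbol_ideal r ns z"
  then show "u * a \<in> symbol_ideal r ns z"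
    by (induction a rule: symbol_ideal.induct)
       (auto simp: distrib_left mult.assoc[symmetric] intro: symbol_ideal.intros)
qed (rule symbol_ideal.zero)

lemma symb_in_symbol_ideal: "valid r ns g \<Longrightarrow> symb r ns z g \<in> symbol_ideal r ns z"
  using symbol_ideal.step[OF symbol_ideal.zero, of r ns g 1 z] by simp

lemma newton_mult_0: "newton_mult 0 m q p = (if p = q + m then 1 else 0)"
  by (induction m arbitrary: p) auto

lemma sum_cells: "(\<Sum>a\<in>cells r ns. f a) = (\<Sum>i<r + 1. \<Sum>p<sum_list ns. f (i, p))"
  unfolding cells_def by (simp add: sum.cartesian_product)

text \<open>An elementary matrix isolates a single row relation, in the form used modulo a prime
  ideal.\<close>

lemma symb_Row_unit:
  assumes "i < r + 1" "j < r + 1"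
  shows "symb r ns z (Row (mat (r + 1) (r + 1) (\<lambda>ab. if ab = (i, j) then 1 else 0)))
     = (\<Sum>p<sum_list ns. Con (z (j, p)) * Var (i, p))"
proof -
  let ?Y = "mat (r + 1) (r + 1) (\<lambda>ab. if ab = (i, j) then 1 else 0) :: complex mat"
  have "(\<Sum>b\<in>cells r ns. tens ns 0 (Row ?Y) (i', p) b * z b) = (if i' = i then z (j, p) else 0)"
    if "i' < r + 1" "p < sum_list ns" for i' p
  proof -
    have "(\<Sum>b\<in>cells r ns. tens ns 0 (Row ?Y) (i', p) b * z b)
        = (\<Sum>j'<r + 1. \<Sum>p'<sum_list ns. if p' = p then ?Y $$ (i', j') * z (j', p) else 0)"
      unfolding sum_cells by (intro sum.cong) auto
    also have "\<dots> = (\<Sum>j'<r + 1. if j' = j then (if i' = i then z (j, p) else 0) else 0)"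
      using that by (intro sum.cong) auto
    finally show ?thesis using assms by simp
  qed
  then have "symb r ns z (Row ?Y)
     = (\<Sum>i'<r + 1. if i' = i then (\<Sum>p<sum_list ns. Con (z (j, p)) * Var (i, p)) else 0)"
    unfolding symb.simps by (subst sum_cells) (intro sum.cong, auto)
  then show ?thesis using assms by simp
qed

text \<open>A power of one shift matrix isolates the relation at distance \<open>m\<close> within
  block \<open>k\<close>; only \<open>ns ! k - m\<close> columns take part because the shift runs
  out of the block.\<close>

lemma symb_Tor_unit:
  assumes k: "k < length ns" and m: "m < ns ! k"
  shows "symb r ns z (Tor (\<lambda>k' m'. if k' = k \<and> m' = m then 1 else 0))
    = (\<Sum>j<ns ! k - m. \<Sum>i<r + 1. Con (z (i, block_start ns k + j)) * Var (i, block_start ns k + j + m))"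
proof -
  let ?x = "\<lambda>k' m'. if k' = k \<and> m' = m then 1 else 0 :: complex"
  have h: "hmat ns 0 ?x (block_start ns k1 + j1) (block_start ns k2 + j2)
      = (if k1 = k \<and> k2 = k \<and> j2 = j1 + m then 1 else 0)"
    if "k1 < length ns" "k2 < length ns" "j1 < ns ! k1" "j2 < ns ! k2" for k1 k2 j1 j2
  proof (cases "k1 = k \<and> k2 = k")
    case True
    have "(\<Sum>m'<ns ! k. (if m' = m then 1 else 0) * newton_mult 0 m' j1 j2)
      = (\<Sum>m'<ns ! k. if m' = m then newton_mult 0 m' j1 j2 else 0)"
      by (rule sum.cong) auto
    then show ?thesis using True m that by (simp add: hmat_def loc_block_start newton_mult_0)
  qed (use that in \<open>auto simp: hmat_def loc_block_start intro!: sum.neutral\<close>)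
  have inner: "(\<Sum>b\<in>cells r ns. tens ns 0 (Tor ?x) (i, p) b * z b) = (\<Sum>q<sum_list ns. hmat ns 0 ?x q p * z (i, q))"
    if "i < r + 1" for i p
  proof -
    have "(\<Sum>b\<in>cells r ns. tens ns 0 (Tor ?x) (i, p) b * z b)
       = (\<Sum>i'<r + 1. if i' = i then \<Sum>q<sum_list ns. hmat ns 0 ?x q p * z (i, q) else 0)"
      unfolding sum_cells by (intro sum.cong) auto
    then show ?thesis using that by simp
  qed
  have row: "(\<Sum>p<sum_list ns. Con (\<Sum>q<sum_list ns. hmat ns 0 ?x q p * z (i, q)) * Var (i, p))
     = (\<Sum>j<ns ! k - m. Con (z (i, block_start ns k + j)) * Var (i, block_start ns k + j + m))" for i
  proof -
    have col: "(\<Sum>q<sum_list ns. hmat ns 0 ?x q (block_start ns k2 + j2) * z (i, q))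
       = (if k2 = k \<and> m \<le> j2 then z (i, block_start ns k + (j2 - m)) else 0)"
      if k2: "k2 < length ns" "j2 < ns ! k2" for k2 j2
    proof -
      have "(\<Sum>q<sum_list ns. hmat ns 0 ?x q (block_start ns k2 + j2) * z (i, q))
        = (\<Sum>k1<length ns. if k1 = k then (\<Sum>j1<ns ! k. if j1 = j2 - m then
             (if k2 = k \<and> m \<le> j2 then z (i, block_start ns k + (j2 - m)) else 0) else 0) else 0)"
        unfolding sum_blocks
      proof (intro sum.cong refl, goal_cases)
        case (1 k1)
        show ?case
        proof (cases "k1 = k")
          case True
          have "hmat ns 0 ?x (block_start ns k + j1) (block_start ns k2 + j2) * z (i, block_start ns k + j1)
             = (if j1 = j2 - m then if k2 = k \<and> m \<le> j2 then z (i, block_start ns k + (j2 - m)) else 0 else 0)"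
            if "j1 < ns ! k" for j1
            using h[OF k k2(1) that k2(2)] by auto
          then show ?thesis unfolding True by (simp only: simp_thms if_True) (intro sum.cong refl, simp)
        next
          case False
          then show ?thesis using 1 k2 h[of k1 k2 _ j2] by simp
        qed
      qed
      then show ?thesis using k k2 by auto
    qed
    have "(\<Sum>p<sum_list ns. Con (\<Sum>q<sum_list ns. hmat ns 0 ?x q p * z (i, q)) * Var (i, p))
      = (\<Sum>k2<length ns. if k2 = k then (\<Sum>j2<ns ! k. if m \<le> j2 then
          Con (z (i, block_start ns k + (j2 - m))) * Var (i, block_start ns k + j2) else 0) else 0)"
      unfolding sum_blocks[of "\<lambda>p. Con (\<Sum>q<sum_list ns. hmat ns 0 ?x q p * z (i, q)) * Var (i, p)"]
    proof (intro sum.cong refl, goal_cases)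
      case (1 k2)
      show ?case
      proof (cases "k2 = k")
        case True
        have "Con (\<Sum>q<sum_list ns. hmat ns 0 ?x q (block_start ns k + j2) * z (i, q)) * Var (i, block_start ns k + j2)
           = (if m \<le> j2 then Con (z (i, block_start ns k + (j2 - m))) * Var (i, block_start ns k + j2) else 0)"
          if "j2 < ns ! k" for j2
          unfolding col[OF k that] by simp
        then show ?thesis unfolding True by (simp only: simp_thms if_True) (intro sum.cong refl, simp)
      next
        case False
        then show ?thesis using 1 by (simp add: col)
      qed
    qed
    also have "\<dots> = (\<Sum>j2\<in>{m..<ns ! k}. Con (z (i, block_start ns k + (j2 - m))) * Var (i, block_start ns k + j2))"
      using k by (simp add: sum.If_cases) (intro sum.cong, auto)
    also have "\<dots> = (\<Sum>j<ns ! k - m. Con (z (i, block_start ns k + j)) * Var (i, block_start ns k + j + m))"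
      by (rule sum.reindex_bij_witness[of _ "\<lambda>j. j + m" "\<lambda>j. j - m"]) (auto simp: add_ac)
    finally show ?thesis .
  qed
  have "symb r ns z (Tor ?x) = (\<Sum>i<r + 1. \<Sum>p<sum_list ns. Con (\<Sum>q<sum_list ns. hmat ns 0 ?x q p * z (i, q)) * Var (i, p))"
    unfolding symb.simps by (subst sum_cells) (intro sum.cong refl, simp only: lessThan_iff inner)
  also have "\<dots> = (\<Sum>i<r + 1. \<Sum>j<ns ! k - m. Con (z (i, block_start ns k + j)) * Var (i, block_start ns k + j + m))"
    by (simp only: row)
  finally show ?thesis by (simp only: sum.swap[of _ "{..<ns ! k - m}"])
qed

text \<open>If no power of the variable lay in the symbol ideal, a prime ideal above it would miss
  the variable, against \<open>Var_in_prime_ideal\<close>. Nilpotency is the algebraic form of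
  having only the origin as common zero, and it also bounds degrees in the fibre.\<close>

lemma Var_nilpotent:
  assumes z: "z \<in> generic_stratum r ns" and rN: "r + 1 \<le> sum_list ns" and x: "x \<in> cells r ns"
  shows "\<exists>n. Var x ^ n \<in> symbol_ideal r ns (\<lambda>ip. z $$ ip)"
proof (rule ccontr)
  let ?J = "symbol_ideal r ns (\<lambda>ip. z $$ ip)"
  assume "\<nexists>n. Var x ^ n \<in> ?J"
  then have "Var x ^ n \<notin> ?J" for n by blast
  from prime_ideal_avoiding_powers[OF idl_symbol_ideal this] obtain M where M: "idl M" "?J \<subseteq> M" "\<And>n. Var x ^ n \<notin> M" "\<And>a b. a * b \<in> M \<Longrightarrow> a \<in> M \<or> b \<in> M"
    by blast
  have sM: "symb r ns (\<lambda>ip. z $$ ip) g \<in> M" if "valid r ns g" for g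
    using symb_in_symbol_ideal[OF that] M(2) by blast
  have "Var (fst x, snd x) \<in> M"
  proof (rule Var_in_prime_ideal[OF M(1,4) _ _ _ z rN])
    show "Var (i, p) * Var (j, q) - Var (i, q) * Var (j, p) \<in> M"
      if "i < r + 1" "j < r + 1" "p < sum_list ns" "q < sum_list ns" for i j p q
      using sM[of "Minor i j p q"] that by simp
    show "(\<Sum>j<ns ! k - m. \<Sum>i<r + 1. Con (z $$ (i, block_start ns k + j)) * Var (i, block_start ns k + j + m)) \<in> M"
      if "k < length ns" "m < ns ! k" for k m
      using sM[of "Tor (\<lambda>k' m'. if k' = k \<and> m' = m then 1 else 0)"] symb_Tor_unit[OF that] by simp
    show "(\<Sum>p<sum_list ns. Con (z $$ (j, p)) * Var (i, p)) \<in> M" if "i < r + 1" "j < r + 1" for i j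
      using sM[of "Row (mat (r + 1) (r + 1) (\<lambda>ab. if ab = (i, j) then 1 else 0))"]
      unfolding symb_Row_unit[OF that] by simp
  qed (use x in \<open>auto simp: cells_def\<close>)
  then show False using M(3)[of 1] by simp
qed

text \<open>The symbols are homogeneous, so the part of degree \<open>n\<close> of a multiple
  involves only one homogeneous part of the multiplier. Replacing the symbol by \<open>gop\<close>
  then costs terms of lower degree only, and \<open>\<alpha>\<close> enters only there.\<close>

lemma symbol_ideal_hpart:
  assumes "w \<in> symbol_ideal r ns z"
  shows "\<exists>u\<in>fibre_rel r ns \<alpha> z (Suc n). hpart (cells r ns) n w - u \<in> Pol (cells r ns) n"
  using assms
proof (induction w rule: symbol_ideal.induct)
  case zero
  show ?case by (intro bexI[of _ 0] fibre_rel_0) simp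
next
  case (step v g u)
  let ?G = "cells r ns"
  obtain u' where u': "u' \<in> fibre_rel r ns \<alpha> z (Suc n)" "hpart ?G n v - u' \<in> Pol ?G n"
    using step.IH by blast
  have "\<exists>u''\<in>fibre_rel r ns \<alpha> z (Suc n). hpart ?G n (symb r ns z g * u) - u'' \<in> Pol ?G n"
  proof (cases "\<exists>i j p q. g = Minor i j p q")
    case True
    then obtain i j p q where g: "g = Minor i j p q" by blast
    with step.hyps have mem: "(i, p) \<in> ?G" "(j, q) \<in> ?G" "(i, q) \<in> ?G" "(j, p) \<in> ?G" by (auto simp: cells_def)
    have eq: "hpart ?G n (symb r ns z g * u)
        = hpart ?G n (Var (i, p) * (Var (j, q) * u)) - hpart ?G n (Var (i, q) * (Var (j, p) * u))"
      by (simp add: g left_diff_distrib mult.assoc hpart_diff)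
    show ?thesis
    proof (cases "n < 2")
      case True
      then have "hpart ?G n (symb r ns z g * u) = 0"
        unfolding eq using mem by (auto simp: hpart_Var_mult split: nat.split)
      then show ?thesis by (intro bexI[of _ 0] fibre_rel_0) simp
    next
      case False
      then obtain n' where n': "n = Suc (Suc n')" by (metis add_2_eq_Suc le_Suc_ex not_less)
      have "hpart ?G n (symb r ns z g * u) = gop r ns 0 \<alpha> z g (hpart ?G n' u)"
        unfolding eq using mem by (simp add: hpart_Var_mult n' g left_diff_distrib mult.assoc)
      moreover have "gop r ns 0 \<alpha> z g (hpart ?G n' u) \<in> fibre_rel r ns \<alpha> z (Suc n)"
        using fibre_rel_gop[OF step.hyps(2) Pol_hpart, of n' "Suc n"] by (simp add: g n')
      ultimately show ?thesis by (intro bexI) auto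
    qed
  next
    case False
    then have fo: "gord g = 1" "gop r ns 0 \<alpha> z g w = first_order ?G z (tens ns 0 g) (cst r ns \<alpha> g) w"
      "symb r ns z g = (\<Sum>a\<in>?G. Con (\<Sum>b\<in>?G. tens ns 0 g a b * z b) * Var a)" for w
      by (cases g; simp)+
    have eq: "hpart ?G n (symb r ns z g * u) = (case n of 0 \<Rightarrow> 0 | Suc k \<Rightarrow> symb r ns z g * hpart ?G k u)"
      unfolding fo sum_distrib_right hpart_sum mult.assoc hpart_Con_mult
      by (cases n) (auto simp: hpart_Var_mult mult.assoc intro!: sum.neutral sum.cong)
    show ?thesis
    proof (cases n)
      case 0
      then show ?thesis unfolding eq by (intro bexI[of _ 0] fibre_rel_0) simp
    next
      case (Suc k)
      have "gop r ns 0 \<alpha> z g (hpart ?G k u) \<in> fibre_rel r ns \<alpha> z (Suc n)"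
        using fibre_rel_gop[OF step.hyps(2) Pol_hpart, of k "Suc n"] by (simp add: fo(1) Suc)
      moreover have "symb r ns z g * hpart ?G k u - gop r ns 0 \<alpha> z g (hpart ?G k u) \<in> Pol ?G n"
        using first_order_symbol[OF Pol_hpart[of ?G k u], of "tens ns 0 g" z "cst r ns \<alpha> g"]
        unfolding fo Suc .
      ultimately show ?thesis using eq Suc by (intro bexI) auto
    qed
  qed
  then obtain u'' where u'': "u'' \<in> fibre_rel r ns \<alpha> z (Suc n)" "hpart ?G n (symb r ns z g * u) - u'' \<in> Pol ?G n"
    by blast
  have eq: "hpart ?G n (u * symb r ns z g + v) - (u'' + u')
    = (hpart ?G n (symb r ns z g * u) - u'') + (hpart ?G n v - u')"
    by (simp add: hpart_add mult.commute)
  have "hpart ?G n (u * symb r ns z g + v) - (u'' + u') \<in> Pol ?G n"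
    unfolding eq by (rule Pol_add[OF u''(2) u'(2)])
  then show ?case using fibre_rel_add[OF u''(1) u'(1)] by blast
qed

lemma Var_power: "Var x ^ n = single (single x n) 1"
  by (induction n) (simp_all add: Var_mult_single[where c=1, unfolded One_nat_def] single_add[symmetric])

text \<open>Pigeonhole: a monomial of large degree contains a high power of some cell
  variable.\<close>

lemma monomials_in_symbol_ideal:
  assumes z: "z \<in> generic_stratum r ns" and rN: "r + 1 \<le> sum_list ns"
  obtains d where "\<And>m. keys m \<subseteq> cells r ns \<Longrightarrow> d \<le> mdeg m \<Longrightarrow> single m 1 \<in> symbol_ideal r ns (\<lambda>ip. z $$ ip)"
proof -
  let ?G = "cells r ns" and ?J = "symbol_ideal r ns (\<lambda>ip. z $$ ip)"
  obtain e where e: "\<And>x. x \<in> ?G \<Longrightarrow> Var x ^ e x \<in> ?J"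
    using Var_nilpotent[OF z rN] by metis
  define E where "E = sum e ?G"
  have "single m 1 \<in> ?J" if m: "keys m \<subseteq> ?G" "card ?G * E + 1 \<le> mdeg m" for m
  proof -
    have "\<exists>x\<in>?G. E < lookup m x"
    proof (rule ccontr)
      assume "\<not> ?thesis"
      then have "mdeg m \<le> (\<Sum>x\<in>?G. E)"
        unfolding mdeg_superset[OF finite_cells m(1)] by (intro sum_mono) auto
      then show False using m(2) by simp
    qed
    then obtain x where x: "x \<in> ?G" "E < lookup m x" by blast
    have "e x \<le> E" unfolding E_def by (rule member_le_sum) (use x in auto)
    have "m = (m - single x (e x)) + single x (e x)"
      using x \<open>e x \<le> E\<close>
      by (intro poly_mapping_eqI) (auto simp: lookup_add lookup_minus lookup_single when_def)
    then have "single m 1 = single (m - single x (e x)) 1 * Var x ^ e x"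
      by (metis Var_power mult_single mult_1)
    then show ?thesis using idl_mult[OF idl_symbol_ideal e[OF x(1)]] by simp
  qed
  then show ?thesis by (rule that)
qed

text \<open>Monomials of degree at least \<open>d\<close> reduce to lower degree by relations of
  their own order, and each of the finitely many others is itself a relation of some order. The
  outcome is a closed finite linear system, to which determinants apply.\<close>

lemma fibre_finite:
  assumes z: "z \<in> generic_stratum r ns" and rN: "r + 1 \<le> sum_list ns"
    and all: "\<And>v. v \<in> gpol (cells r ns) \<Longrightarrow> \<exists>m. v \<in> fibre_rel r ns \<alpha> (\<lambda>ip. z $$ ip) m"
  obtains m where "0 < m" "Pol (cells r ns) m \<subseteq> fibre_rel r ns \<alpha> (\<lambda>ip. z $$ ip) m"
proof -
  let ?G = "cells r ns" and ?z = "\<lambda>ip. z $$ ip"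
  obtain d where d: "\<And>m. keys m \<subseteq> ?G \<Longrightarrow> d \<le> mdeg m \<Longrightarrow> single m 1 \<in> symbol_ideal r ns ?z"
    by (rule monomials_in_symbol_ideal[OF z rN]) blast
  have "\<exists>e. single k 1 \<in> fibre_rel r ns \<alpha> ?z e" if "k \<in> mons ?G d" for k
    using that by (intro all gpol_single) (simp add: mons_def)
  then obtain e where e: "\<And>k. k \<in> mons ?G d \<Longrightarrow> single k 1 \<in> fibre_rel r ns \<alpha> ?z (e k)" by metis
  \<comment> \<open>At least \<open>d\<close> and at least the order of each relation for a monomial
    of degree below \<open>d\<close>; the successor makes it positive.\<close>
  define m where "m = Suc (d + sum e (mons ?G d))"
  have e_le: "e k \<le> m" if "k \<in> mons ?G d" for k
    using member_le_sum[of k "mons ?G d" e] that finite_mons[of ?G d] by (simp add: m_def)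
  have "Pol ?G n \<subseteq> fibre_rel r ns \<alpha> ?z m" if "d \<le> n" "n \<le> m" for n
    using that
  proof (induction n rule: dec_induct)
    case base
    show ?case
    proof
      fix v assume v: "v \<in> Pol ?G d"
      show "v \<in> fibre_rel r ns \<alpha> ?z m"
      proof (rule fibre_rel_poly)
        fix k assume "k \<in> keys v"
        then have "k \<in> mons ?G d" using v by (auto simp: Pol_def)
        then show "single k 1 \<in> fibre_rel r ns \<alpha> ?z m"
          using e fibre_rel_mono[OF e_le] by blast
      qed
    qed
  next
    case (step n)
    show ?case
    proof
      fix v assume v: "v \<in> Pol ?G (Suc n)"
      show "v \<in> fibre_rel r ns \<alpha> ?z m"
      proof (rule fibre_rel_poly)
        fix k assume "k \<in> keys v"
        then have k: "keys k \<subseteq> ?G" "mdeg k \<le> n" using v by (auto simp: Pol_def mons_def)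
        have IH: "Pol ?G n \<subseteq> fibre_rel r ns \<alpha> ?z m" using step by simp
        show "single k 1 \<in> fibre_rel r ns \<alpha> ?z m"
        proof (cases "mdeg k = n")
          case True
          then have "single k 1 \<in> symbol_ideal r ns ?z" using d[OF k(1)] step by simp
          from symbol_ideal_hpart[OF this, of \<alpha> n] k True obtain u where
            u: "u \<in> fibre_rel r ns \<alpha> ?z (Suc n)" "single k 1 - u \<in> Pol ?G n" by (auto simp: hpart_single)
          have "u + (single k 1 - u) \<in> fibre_rel r ns \<alpha> ?z m"
            using u IH fibre_rel_mono[of "Suc n" m r ns \<alpha> ?z] step.prems
            by (intro fibre_rel_add) blast+
          then show ?thesis by simp
        next
          case False
          then have "single k 1 \<in> Pol ?G n" using k by (intro Pol_single) (simp add: mons_def)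
          then show ?thesis using IH by blast
        qed
      qed
    qed
  qed
  from this[of m] show ?thesis using that[of m] by (simp add: m_def)
qed

section \<open>Formal solutions and deformation\<close>

lemma continuous_newton_mult: "continuous_on UNIV (\<lambda>s. newton_mult s m q p)"
proof (induction m arbitrary: p)
  case (Suc m)
  then show ?case by (cases "p = 0") (auto intro!: continuous_intros)
qed simp

lemma continuous_tens: "continuous_on UNIV (\<lambda>s. tens ns s g a b)"
proof (cases g)
  case (Tor x)
  have "continuous_on UNIV (\<lambda>s. hmat ns s x (snd b) (snd a))"
    unfolding hmat_def
    by (cases "fst (loc ns (snd b)) = fst (loc ns (snd a))")
       (auto intro!: continuous_intros continuous_newton_mult)
  then show ?thesis using Tor by (cases "fst a = fst b") auto
qed auto

lemma lookup_sum_list: "lookup (sum_list ws) k = (\<Sum>w\<leftarrow>ws. lookup w k)"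
  by (induction ws) (simp_all add: lookup_add)

text \<open>Coefficientwise continuity in the parameters at a fixed point \<open>z\<close>, as the
  determinant argument uses it.\<close>

lemma continuous_gop:
  assumes "\<And>k j. continuous_on UNIV (\<lambda>p. \<alpha> p k j)" "continuous_on UNIV (\<sigma> :: 'p::topological_space \<Rightarrow> complex)"
  shows "continuous_on UNIV (\<lambda>p. lookup (gop r ns (\<sigma> p) (\<alpha> p) z g w) k)"
proof -
  have t: "continuous_on UNIV (\<lambda>p. tens ns (\<sigma> p) g a b)" for a b
    using continuous_on_compose2[OF continuous_tens assms(2), of ns g a b] by simp
  have c: "continuous_on UNIV (\<lambda>p. cst r ns (\<alpha> p) g)"
    by (cases g) (auto simp: h_char_def intro!: continuous_intros assms)
  have "continuous_on UNIV (\<lambda>p. lookup (first_order (cells r ns) z (tens ns (\<sigma> p) g) (cst r ns (\<alpha> p) g) w) k)"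
    unfolding first_order_def
    by (simp only: lookup_add lookup_sum lookup_Con_mult) (intro continuous_intros t c)
  then show ?thesis by (cases g) auto
qed

section \<open>Taylor expansion along the line between two points\<close>

lemma gop_affine:
  "gop r ns s \<alpha> z1 g w - gop r ns s \<alpha> z0 g w =
     (\<Sum>a\<in>cells r ns. \<Sum>b\<in>cells r ns. Con (tens ns s g a b * (z1 b - z0 b)) * (Var a * w))"
proof -
  have "first_order G z1 L c w - first_order G z0 L c w =
      (\<Sum>a\<in>G. \<Sum>b\<in>G. Con (L a b * (z1 b - z0 b)) * (Var a * w))" for G L c
    unfolding first_order_def by (simp add: sum_subtractf[symmetric] Con_mult Con_diff algebra_simps)
  then show ?thesis by (cases g) auto
qed

text \<open>\<open>Y\<close> stands for the derivative in the direction from \<open>z0\<close> to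
  \<open>z1\<close>. Its commutator with \<open>gop\<close> arises from
  \<open>D b Y = Con (z1 b - z0 b)\<close> and equals the difference of \<open>gop\<close> at the
  two points; this difference is a multiplication and commutes with \<open>Y\<close>, whence the
  factor \<open>Suc n\<close>.\<close>

lemma gop_translate:
  assumes Y: "Y = (\<Sum>b\<in>cells r ns. Con (z1 b - z0 b) * Var b)" and g: "valid r ns g"
  shows "gop r ns s \<alpha> z0 g (Y ^ Suc n * w) = Y ^ Suc n * gop r ns s \<alpha> z0 g w
    + of_nat (Suc n) * Y ^ n * (gop r ns s \<alpha> z1 g w - gop r ns s \<alpha> z0 g w)"
proof -
  let ?G = "cells r ns"
  have DY: "D b Y = Con (z1 b - z0 b)" if "b \<in> ?G" for b
  proof -
    have "D b Y = (\<Sum>c\<in>?G. if c = b then Con (z1 c - z0 c) else 0)"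
      unfolding Y D_sum by (intro sum.cong refl) (auto simp: D_Con_mult D_Var)
    then show ?thesis using that by simp
  qed
  have D1: "D b (Y ^ Suc n * w) = Y ^ Suc n * D b w + of_nat (Suc n) * Y ^ n * (Con (z1 b - z0 b) * w)" if "b \<in> ?G" for b
    unfolding D_mult D_power DY[OF that] by (simp add: algebra_simps)
  have fo: "first_order ?G z0 L c (Y ^ Suc n * w) = Y ^ Suc n * first_order ?G z0 L c w
      + of_nat (Suc n) * Y ^ n * (\<Sum>a\<in>?G. \<Sum>b\<in>?G. Con (L a b * (z1 b - z0 b)) * (Var a * w))" for L c
  proof -
    have "Con (L a b) * (Con (z0 b) * (Var a * (Y ^ Suc n * w)) + Var a * D b (Y ^ Suc n * w))
       = Y ^ Suc n * (Con (L a b) * (Con (z0 b) * (Var a * w) + Var a * D b w))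
       + of_nat (Suc n) * Y ^ n * (Con (L a b * (z1 b - z0 b)) * (Var a * w))" if "b \<in> ?G" for a b
      unfolding D1[OF that] Con_mult by (simp only: distrib_left mult_ac add_ac)
    then have "first_order ?G z0 L c (Y ^ Suc n * w)
      = (\<Sum>a\<in>?G. \<Sum>b\<in>?G. Y ^ Suc n * (Con (L a b) * (Con (z0 b) * (Var a * w) + Var a * D b w))
       + of_nat (Suc n) * Y ^ n * (Con (L a b * (z1 b - z0 b)) * (Var a * w))) + Con c * (Y ^ Suc n * w)"
      unfolding first_order_def by (intro arg_cong2[of _ _ _ _ "(+)"] sum.cong refl)
    then show ?thesis
      unfolding first_order_def sum.distrib sum_distrib_left[symmetric] distrib_left
      by (simp only: mult_ac add_ac)
  qed
  show ?thesis
  proof (cases g)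
    case (Minor i j p q)
    then show ?thesis by (simp only: gop.simps diff_self mult_zero_right mult_zero_left add_0_right mult_ac)
  next
    case (Tor x)
    then show ?thesis unfolding gop_affine using fo by (simp only: gop.simps)
  next
    case (Row M)
    then show ?thesis unfolding gop_affine using fo by (simp only: gop.simps)
  qed
qed

text \<open>For a formal solution \<open>F\<close> at \<open>z0\<close>, this is the expansion of
  its derivative \<open>w\<close> in the parameter of the line from \<open>z0\<close> to
  \<open>z1\<close>.\<close>

definition taylor :: "('m::comm_monoid_add \<Rightarrow> complex) \<Rightarrow> ('m \<Rightarrow>\<^sub>0 complex) \<Rightarrow> ('m \<Rightarrow>\<^sub>0 complex) \<Rightarrow> complex fps" where
  "taylor F Y w = Abs_fps (\<lambda>n. lin F (Y ^ n * w) / fact n)"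

lemma taylor_add: "taylor F Y (u + v) = taylor F Y u + taylor F Y v"
  by (simp add: taylor_def fps_eq_iff distrib_left lin_add add_divide_distrib)

lemma taylor_diff: "taylor F Y (u - v) = taylor F Y u - taylor F Y v"
  by (simp add: taylor_def fps_eq_iff right_diff_distrib lin_diff diff_divide_distrib)

lemma taylor_0 [simp]: "taylor F Y 0 = 0"
  by (simp add: taylor_def fps_eq_iff)

lemma taylor_Con_mult: "taylor F Y (Con c * w) = fps_const c * taylor F Y w"
  by (simp add: taylor_def fps_eq_iff mult.left_commute lin_Con_mult)

lemma taylor_sum: "taylor F Y (sum f A) = (\<Sum>x\<in>A. taylor F Y (f x))"
  by (induction A rule: infinite_finite_induct) (simp_all add: taylor_add)

text \<open>As \<open>gop\<close> is affine in the point, the left side is the relation at the point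
  with line parameter \<open>fps_X\<close>. Its coefficient at \<open>Suc k\<close> is the relation
  for \<open>Y ^ Suc k * w\<close> at \<open>z0\<close>, rewritten by
  \<open>gop_translate\<close>.\<close>

lemma taylor_relation:
  assumes F: "\<And>v. lin F (gop r ns s \<alpha> z0 g v) = 0" and g: "valid r ns g"
    and Y: "Y = (\<Sum>b\<in>cells r ns. Con (z1 b - z0 b) * Var b)"
  shows "taylor F Y (gop r ns s \<alpha> z0 g w)
    + fps_X * taylor F Y (gop r ns s \<alpha> z1 g w - gop r ns s \<alpha> z0 g w) = 0"
proof (rule fps_ext)
  fix n
  show "fps_nth (taylor F Y (gop r ns s \<alpha> z0 g w)
    + fps_X * taylor F Y (gop r ns s \<alpha> z1 g w - gop r ns s \<alpha> z0 g w)) n = fps_nth 0 n"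
  proof (cases n)
    case 0
    then show ?thesis using F by (simp add: taylor_def)
  next
    case (Suc k)
    let ?d = "gop r ns s \<alpha> z1 g w - gop r ns s \<alpha> z0 g w"
    have "0 = lin F (Y ^ Suc k * gop r ns s \<alpha> z0 g w + Con (of_nat (Suc k)) * (Y ^ k * ?d))"
      using F[of "Y ^ Suc k * w"] gop_translate[OF Y g, of s \<alpha> k w] unfolding Con_of_nat by (simp add: mult.assoc)
    then have "lin F (Y ^ Suc k * gop r ns s \<alpha> z0 g w) + of_nat (Suc k) * lin F (Y ^ k * ?d) = 0"
      unfolding lin_add lin_Con_mult by (simp only:)
    then have "lin F (Y ^ Suc k * gop r ns s \<alpha> z0 g w) = - (of_nat (Suc k) * lin F (Y ^ k * ?d))"
      by (simp only: eq_neg_iff_add_eq_0)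
    moreover have "(fact (Suc k) :: complex) = of_nat (Suc k) * fact k" by (rule fact_Suc)
    moreover have "(of_nat (Suc k) :: complex) \<noteq> 0" by (rule of_nat_neq_0)
    ultimately show ?thesis unfolding Suc
      by (simp add: taylor_def del: power_Suc of_nat_Suc fact_Suc)
  qed
qed

text \<open>
  If the fibre of the system at \<open>z\<^sub>1\<close> vanishes, then a square system of relations among the
  derivatives of order less than \<open>m\<close> is invertible at \<open>z\<^sub>1\<close>, also for nearby parameters.  Along the
  line from \<open>z\<^sub>0\<close> to \<open>z\<^sub>1\<close> its determinant is then a nonzero polynomial, which forces the
  Taylor expansion at \<open>z\<^sub>0\<close> of a formal solution to vanish.
\<close>

lemma no_nearby_solution:
  fixes \<alpha> :: "complex \<times> complex \<Rightarrow> nat \<Rightarrow> nat \<Rightarrow> complex"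
  assumes m: "0 < m" and sub: "Pol (cells r ns) m \<subseteq> fibre_rel r ns (\<alpha> (0, 0)) z1 m"
    and cont: "\<And>k j. continuous_on UNIV (\<lambda>p. \<alpha> p k j)"
  obtains \<epsilon> where "\<epsilon> > 0"
    "\<And>s \<tau> F z0. norm s < \<epsilon> \<Longrightarrow> norm \<tau> < \<epsilon> \<Longrightarrow>
       (\<And>g v. valid r ns g \<Longrightarrow> lin F (gop r ns s (\<alpha> (s, \<tau>)) z0 g v) = 0) \<Longrightarrow> F 0 = 0"
proof -
  let ?G = "cells r ns"
  obtain ms where ms: "set ms = mons ?G m" "distinct ms"
    using finite_distinct_list[OF finite_mons[OF finite_cells]] by metis
  let ?n = "length ms"
  have nth_ms: "ms ! i \<in> mons ?G m" if "i < ?n" for i using that ms(1) nth_mem by blast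
  have "\<exists>L. single k 1 = (\<Sum>(g, v)\<leftarrow>L. gop r ns 0 (\<alpha> (0, 0)) z1 g v) \<and>
     (\<forall>(g, v)\<in>set L. valid r ns g \<and> (\<exists>d. v \<in> Pol ?G d \<and> d + gord g \<le> m))" if "k \<in> mons ?G m" for k
    using sub Pol_single[OF that, of 1] unfolding fibre_rel_def by blast
  then have "\<forall>k\<in>mons ?G m. \<exists>L. single k 1 = (\<Sum>(g, v)\<leftarrow>L. gop r ns 0 (\<alpha> (0, 0)) z1 g v) \<and>
     (\<forall>(g, v)\<in>set L. valid r ns g \<and> (\<exists>d. v \<in> Pol ?G d \<and> d + gord g \<le> m))" by blast
  from bchoice[OF this] obtain L where
    L': "\<forall>k\<in>mons ?G m. single k 1 = (\<Sum>(g, v)\<leftarrow>L k. gop r ns 0 (\<alpha> (0, 0)) z1 g v) \<and>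
     (\<forall>(g, v)\<in>set (L k). valid r ns g \<and> (\<exists>d. v \<in> Pol ?G d \<and> d + gord g \<le> m))" by blast
  have L: "single k 1 = (\<Sum>(g, v)\<leftarrow>L k. gop r ns 0 (\<alpha> (0, 0)) z1 g v)" if "k \<in> mons ?G m" for k
    using L' that by blast
  have valL: "valid r ns g \<and> (\<exists>d. v \<in> Pol ?G d \<and> d + gord g \<le> m)"
    if "k \<in> mons ?G m" "(g, v) \<in> set (L k)" for k g v
    using bspec[OF conjunct2[OF bspec[OF L' that(1)]] that(2)] by simp
  \<comment> \<open>The combination that yields the monomial \<open>k\<close> at \<open>z1\<close>
    with the original parameters, kept frozen while parameters and point vary.\<close>
  define row where "row p z k = (\<Sum>(g, v)\<leftarrow>L k. gop r ns (fst p) (\<alpha> p) z g v)" for p z k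
  have row_Pol: "row p z k \<in> Pol ?G m" if "k \<in> mons ?G m" for p z k
  proof -
    have "(\<Sum>(g, v)\<leftarrow>Q. gop r ns (fst p) (\<alpha> p) z g v) \<in> Pol ?G m"
      if "\<And>g v. (g, v) \<in> set Q \<Longrightarrow> gop r ns (fst p) (\<alpha> p) z g v \<in> Pol ?G m" for Q
      using that by (induction Q) (auto intro!: Pol_add)
    moreover have "gop r ns (fst p) (\<alpha> p) z g v \<in> Pol ?G m" if gv: "(g, v) \<in> set (L k)" for g v
      using valL[OF \<open>k \<in> mons ?G m\<close> gv] Pol_mono[OF Pol_gop] by blast
    ultimately show ?thesis unfolding row_def by blast
  qed
  have cont_row: "continuous_on UNIV (\<lambda>p. lookup (row p z k) k')" for z k k'
  proof -
    have "continuous_on UNIV (\<lambda>p. \<Sum>(g, v)\<leftarrow>Q. lookup (gop r ns (fst p) (\<alpha> p) z g v) k')" for Q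
      by (induction Q) (auto intro!: continuous_intros continuous_gop cont simp del: gop.simps)
    from this[of "L k"] show ?thesis
      unfolding row_def lookup_sum_list by (simp add: o_def case_prod_unfold)
  qed
  define B where "B p z = mat ?n ?n (\<lambda>(i, j). lookup (row p z (ms ! i)) (ms ! j))" for p z
  have B: "B p z \<in> carrier_mat ?n ?n" for p z by (simp add: B_def)
  have perm: "\<pi> i < ?n" if "\<pi> permutes {0..<?n}" "i < ?n" for \<pi> i
    using permutes_in_image[OF that(1), of i] that(2) by simp
  have det_B: "det (B p z) = (\<Sum>\<pi> | \<pi> permutes {0..<?n}. signof \<pi> *
      (\<Prod>i = 0..<?n. lookup (row p z (ms ! i)) (ms ! \<pi> i)))" for p z
    unfolding det_def'[OF B]
    by (intro sum.cong refl arg_cong2[of _ _ _ _ "(*)"] prod.cong)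
       (auto simp: B_def perm)
  have "continuous_on UNIV (\<lambda>p. det (B p z1))"
    unfolding det_B by (intro continuous_intros cont_row)
  then have "open ((\<lambda>p. det (B p z1)) -` (- {0}))"
    by (intro open_vimage) auto
  moreover have "B (0, 0) z1 = 1\<^sub>m ?n"
  proof (rule eq_matI)
    fix i j assume ij: "i < dim_row (1\<^sub>m ?n)" "j < dim_col (1\<^sub>m ?n)"
    then have "row (0, 0) z1 (ms ! i) = single (ms ! i) 1" using L[OF nth_ms] by (simp add: row_def)
    then show "B (0, 0) z1 $$ (i, j) = 1\<^sub>m ?n $$ (i, j)"
      using ij ms(2) by (simp add: B_def lookup_single when_def nth_eq_iff_index_eq)
  qed (auto simp: B_def)
  ultimately obtain e where e: "e > 0" "\<And>p. dist p (0, 0) < e \<Longrightarrow> det (B p z1) \<noteq> 0"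
    by (force simp: open_dist)
  show ?thesis
  proof (rule that[of "e / 2"])
    fix s \<tau> F z0
    assume small: "norm (s::complex) < e / 2" "norm (\<tau>::complex) < e / 2"
      and F: "\<And>g v. valid r ns g \<Longrightarrow> lin F (gop r ns s (\<alpha> (s, \<tau>)) z0 g v) = 0"
    let ?p = "(s, \<tau>)"
    have "dist ?p (0, 0) \<le> norm s + norm \<tau>" using norm_Pair_le[of s \<tau>] by (simp add: dist_norm)
    then have nz: "det (B ?p z1) \<noteq> 0" using small by (intro e(2)) simp
    define Y where "Y = (\<Sum>b\<in>?G. Con (z1 b - z0 b) * Var b)"
    \<comment> \<open>Affine polynomials in the line parameter, with value \<open>B ?p z0\<close> at
      0 and \<open>B ?p z1\<close> at 1.\<close>
    define PB where "PB = mat ?n ?n (\<lambda>(i, j). [:B ?p z0 $$ (i, j), B ?p z1 $$ (i, j) - B ?p z0 $$ (i, j):])"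
    interpret ev: comm_ring_hom "\<lambda>q::complex poly. poly q 1" by unfold_locales auto
    interpret fp: comm_ring_hom "fps_of_poly :: complex poly \<Rightarrow> complex fps"
      by unfold_locales (auto simp: fps_of_poly_add fps_of_poly_mult)
    have "map_mat (\<lambda>q. poly q 1) PB = B ?p z1" by (rule eq_matI) (auto simp: PB_def B_def)
    \<comment> \<open>A polynomial that is nonzero at 1 is also nonzero as a power series at 0, even
      if its constant term vanishes, that is, if the system degenerates at
      \<open>z0\<close>.\<close>
    then have "poly (det PB) 1 \<noteq> 0" using ev.hom_det[of PB] nz by simp
    then have "det PB \<noteq> 0" by auto
    then have nz': "det (map_mat fps_of_poly PB) \<noteq> 0" using fp.hom_det[of PB] by simp
    define t where "t = vec ?n (\<lambda>j. taylor F Y (single (ms ! j) 1))"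
    have expand: "taylor F Y w = (\<Sum>j = 0..<?n. fps_const (lookup w (ms ! j)) * taylor F Y (single (ms ! j) 1))"
      if w: "w \<in> Pol ?G m" for w
    proof -
      have "w = (\<Sum>k\<in>keys w. Con (lookup w k) * single k 1)"
        using mpoly_sum_single[of w] by (simp add: Con_mult_single)
      also have "\<dots> = (\<Sum>k\<in>set ms. Con (lookup w k) * single k 1)"
        by (rule sum.mono_neutral_left) (use w ms(1) finite_mons[of ?G m] in \<open>auto simp: Pol_def in_keys_iff\<close>)
      also have "\<dots> = (\<Sum>j = 0..<?n. Con (lookup w (ms ! j)) * single (ms ! j) 1)"
        by (rule sum.reindex_bij_betw[symmetric, OF bij_betw_nth]) (use ms(2) in auto)
      finally have "taylor F Y w = taylor F Y (\<Sum>j = 0..<?n. Con (lookup w (ms ! j)) * single (ms ! j) 1)"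
        by simp
      then show ?thesis by (simp only: taylor_sum taylor_Con_mult)
    qed
    have rel: "taylor F Y (row ?p z0 k) + fps_X * taylor F Y (row ?p z1 k - row ?p z0 k) = 0"
      if k: "k \<in> mons ?G m" for k
    proof -
      have "taylor F Y (\<Sum>(g, v)\<leftarrow>Q. gop r ns s (\<alpha> ?p) z0 g v) + fps_X * taylor F Y
          ((\<Sum>(g, v)\<leftarrow>Q. gop r ns s (\<alpha> ?p) z1 g v) - (\<Sum>(g, v)\<leftarrow>Q. gop r ns s (\<alpha> ?p) z0 g v)) = 0"
        if "\<And>g v. (g, v) \<in> set Q \<Longrightarrow> valid r ns g" for Q
        using that
      proof (induction Q)
        case (Cons q Q)
        obtain g v where q: "q = (g, v)" by force
        have vQ: "valid r ns g" if "(g, v) \<in> set Q" for g v using Cons.prems[of g v] that by simp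
        have IH: "taylor F Y (\<Sum>(g, v)\<leftarrow>Q. gop r ns s (\<alpha> ?p) z0 g v) + fps_X * taylor F Y
          ((\<Sum>(g, v)\<leftarrow>Q. gop r ns s (\<alpha> ?p) z1 g v) - (\<Sum>(g, v)\<leftarrow>Q. gop r ns s (\<alpha> ?p) z0 g v)) = 0"
          by (rule Cons.IH[OF vQ])
        have g: "valid r ns g" using Cons.prems[of g v] q by simp
        note base = taylor_relation[OF F[OF g] g Y_def, of v]
        show ?case
          using arg_cong2[OF base IH, of "(+)"] unfolding q
          by (simp only: list.map sum_list.Cons prod.case taylor_add taylor_diff) (simp only: algebra_simps add_0_left add_0_right)
      qed simp
      from this[of "L k"] show ?thesis using valL[OF k] unfolding row_def by simp
    qed
    have "map_mat fps_of_poly PB *\<^sub>v t = 0\<^sub>v ?n"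
    proof (rule eq_vecI)
      fix i assume "i < dim_vec (0\<^sub>v ?n :: complex fps vec)"
      then have i: "i < ?n" by simp
      have "(map_mat fps_of_poly PB *\<^sub>v t) $ i
        = (\<Sum>j = 0..<?n. (fps_const (B ?p z0 $$ (i, j)) + fps_X * fps_const (B ?p z1 $$ (i, j) - B ?p z0 $$ (i, j)))
            * taylor F Y (single (ms ! j) 1))"
        using i by (simp add: scalar_prod_def t_def PB_def fps_of_poly_pCons mult_ac)
      also have "\<dots> = (\<Sum>j = 0..<?n. fps_const (lookup (row ?p z0 (ms ! i)) (ms ! j)) * taylor F Y (single (ms ! j) 1))
         + fps_X * (\<Sum>j = 0..<?n. fps_const (lookup (row ?p z1 (ms ! i) - row ?p z0 (ms ! i)) (ms ! j)) * taylor F Y (single (ms ! j) 1))"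
        unfolding sum_distrib_left sum.distrib[symmetric]
        by (intro sum.cong refl) (use i in \<open>simp add: B_def lookup_minus distrib_right mult.assoc\<close>)
      also have "\<dots> = taylor F Y (row ?p z0 (ms ! i)) + fps_X * taylor F Y (row ?p z1 (ms ! i) - row ?p z0 (ms ! i))"
        using expand[OF row_Pol[OF nth_ms[OF i]]] expand[OF Pol_diff[OF row_Pol[OF nth_ms[OF i]] row_Pol[OF nth_ms[OF i]]]]
        by (simp only:)
      also have "\<dots> = 0" by (rule rel[OF nth_ms[OF i]])
      finally show "(map_mat fps_of_poly PB *\<^sub>v t) $ i = 0\<^sub>v ?n $ i" using i by simp
    qed (simp add: PB_def)
    moreover have "map_mat fps_of_poly PB \<in> carrier_mat ?n ?n" "t \<in> carrier_vec ?n" by (auto simp: PB_def t_def)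
    ultimately have "t = 0\<^sub>v ?n" using det_0_iff_vec_prod_zero[of "map_mat fps_of_poly PB" ?n] nz' by blast
    \<comment> \<open>The constant monomial is among the unknowns because \<open>0 < m\<close>; its
      series starts with \<open>F 0\<close>.\<close>
    moreover obtain j where j: "j < ?n" "ms ! j = 0"
      using ms(1) m by (metis (no_types, lifting) empty_subsetI in_set_conv_nth keys_zero mdeg_0 mem_Collect_eq mons_def)
    ultimately have "taylor F Y (single 0 1) = 0" by (metis index_vec index_zero_vec(1) t_def)
    then have "fps_nth (taylor F Y (single 0 1)) 0 = 0" by simp
    then show "F 0 = 0" using lin_single[of F 0 1] by (simp add: taylor_def)
  qed (use e in simp)
qed

section \<open>Newton polynomials\<close>

text \<open>The value of the Newton polynomial of degree \<open>p\<close> at the node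
  \<open>s * i\<close>.\<close>

definition newton :: "complex \<Rightarrow> nat \<Rightarrow> nat \<Rightarrow> complex" where
  "newton s i p = (\<Prod>j<p. s * (of_nat i - of_nat j))"

lemma newton_0 [simp]: "newton s i 0 = 1" by (simp add: newton_def)

lemma newton_Suc: "newton s i (Suc p) = s * (of_nat i - of_nat p) * newton s i p"
  by (simp add: newton_def mult_ac)

lemma newton_eq_0: "i < p \<Longrightarrow> newton s i p = 0"
  unfolding newton_def by (rule prod_zero) auto

lemma newton_diag: "s \<noteq> 0 \<Longrightarrow> newton s p p \<noteq> 0"
  unfolding newton_def by (simp del: of_nat_diff)

lemma continuous_newton: "continuous_on UNIV (\<lambda>s. newton s i p)"
  unfolding newton_def by (intro continuous_intros)

text \<open>The product of \<open>x - m s\<close> with the Newton polynomial of degree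
  \<open>p\<close> is the next one plus \<open>s (p - m)\<close> times itself, which is the
  recursion of \<open>newton_mult\<close>. Truncation at \<open>n\<close> loses nothing, since
  degrees above \<open>i\<close> vanish at the node \<open>s * i\<close>; so evaluation at the nodes
  gives characters of the deformed algebra.\<close>

lemma newton_product:
  assumes i: "i < n" and q: "q < n"
  shows "(\<Sum>p<n. newton_mult s m q p * newton s i p) = newton s i m * newton s i q"
proof (induction m)
  case 0
  have "(\<Sum>p<n. newton_mult s 0 q p * newton s i p) = (\<Sum>p<n. if p = q then newton s i q else 0)"
    by (intro sum.cong) auto
  then show ?case using q by simp
next
  case (Suc m)
  obtain n' where n: "n = Suc n'" using q by (cases n) auto
  have "(\<Sum>p<n. (if p = 0 then 0 else newton_mult s m q (p - 1)) * newton s i p)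
     = (\<Sum>p<n'. newton_mult s m q p * newton s i (Suc p))"
    unfolding n by (subst sum.lessThan_Suc_shift) simp
  also have "\<dots> = (\<Sum>p<n. newton_mult s m q p * newton s i (Suc p))"
    using newton_eq_0[of i n s] i by (simp add: n)
  finally have sh: "(\<Sum>p<n. (if p = 0 then 0 else newton_mult s m q (p - 1)) * newton s i p)
     = (\<Sum>p<n. newton_mult s m q p * newton s i (Suc p))" .
  have "(\<Sum>p<n. newton_mult s (Suc m) q p * newton s i p)
     = (\<Sum>p<n. newton_mult s m q p * newton s i (Suc p))
     + (\<Sum>p<n. s * (of_nat p - of_nat m) * newton_mult s m q p * newton s i p)"
    unfolding newton_mult.simps distrib_right sum.distrib sh ..
  also have "\<dots> = (\<Sum>p<n. s * (of_nat i - of_nat m) * (newton_mult s m q p * newton s i p))"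
    unfolding sum.distrib[symmetric] newton_Suc
    by (intro sum.cong refl) (simp add: algebra_simps)
  also have "\<dots> = s * (of_nat i - of_nat m) * (newton s i m * newton s i q)"
    unfolding sum_distrib_left[symmetric] Suc ..
  finally show ?case by (simp add: newton_Suc)
qed

text \<open>Back substitution: the last unknown alone enters the last equation. It produces
  exponents with prescribed Newton moments.\<close>

lemma upper_triangular_solve:
  fixes T :: "nat \<Rightarrow> nat \<Rightarrow> complex"
  assumes "\<And>m i. i < m \<Longrightarrow> T m i = 0" "\<And>m. T m m \<noteq> 0"
  shows "\<exists>a. \<forall>m<n. (\<Sum>i<n. a i * T m i) = y m"
proof (induction n arbitrary: y)
  case (Suc n)
  define c where "c = y n / T n n"
  obtain a where a: "\<forall>m<n. (\<Sum>i<n. a i * T m i) = y m - c * T m n"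
    using Suc[of "\<lambda>m. y m - c * T m n"] by blast
  let ?a = "a(n := c)"
  have "(\<Sum>i<Suc n. ?a i * T m i) = y m" if "m < Suc n" for m
  proof -
    have eq: "(\<Sum>i<Suc n. ?a i * T m i) = (\<Sum>i<n. a i * T m i) + c * T m n"
      by simp
    show ?thesis
    proof (cases "m = n")
      case True
      then have "(\<Sum>i<n. a i * T m i) = 0" using assms(1) by (intro sum.neutral) auto
      then show ?thesis unfolding eq using True assms(2)[of n] by (simp add: c_def)
    next
      case False
      then show ?thesis unfolding eq using a that by simp
    qed
  qed
  then show ?case by blast
qed simp

text \<open>The transposed system, by forward substitution: Newton interpolation, which produces a
  point with prescribed values at the nodes.\<close>

lemma lower_triangular_solve:
  fixes T :: "nat \<Rightarrow> nat \<Rightarrow> complex"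
  assumes "\<And>m i. i < m \<Longrightarrow> T m i = 0" "\<And>m. T m m \<noteq> 0"
  shows "\<exists>x. \<forall>i<n. (\<Sum>p<n. x p * T p i) = y i"
proof (induction n)
  case (Suc n)
  then obtain x where x: "\<forall>i<n. (\<Sum>p<n. x p * T p i) = y i" by blast
  define c where "c = (y n - (\<Sum>p<n. x p * T p n)) / T n n"
  let ?x = "x(n := c)"
  have "(\<Sum>p<Suc n. ?x p * T p i) = y i" if "i < Suc n" for i
  proof -
    have eq: "(\<Sum>p<Suc n. ?x p * T p i) = (\<Sum>p<n. x p * T p i) + c * T n i"
      by simp
    show ?thesis
    proof (cases "i = n")
      case True
      then show ?thesis unfolding eq using assms(2)[of n] by (simp add: c_def)
    next
      case False
      then show ?thesis unfolding eq using x that assms(1)[of i n] by simp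
    qed
  qed
  then show ?case by blast
qed simp

text \<open>Column \<open>l\<close> is the common eigenvector of the deformed algebra that belongs
  to node \<open>l\<close>: the Newton basis evaluated there, extended by zero to the other blocks.
  The next definition is its eigenvalue.\<close>

definition nodes :: "nat list \<Rightarrow> complex \<Rightarrow> nat \<Rightarrow> nat \<Rightarrow> complex" where
  "nodes ns s p l = (if fst (loc ns p) = fst (loc ns l) then newton s (snd (loc ns l)) (snd (loc ns p)) else 0)"

definition eigen :: "nat list \<Rightarrow> complex \<Rightarrow> (nat \<Rightarrow> nat \<Rightarrow> complex) \<Rightarrow> nat \<Rightarrow> complex" where
  "eigen ns s x l = (\<Sum>m<ns ! fst (loc ns l). x (fst (loc ns l)) m * newton s (snd (loc ns l)) m)"

lemma nodes_block:
  "k < length ns \<Longrightarrow> j < ns ! k \<Longrightarrow> k' < length ns \<Longrightarrow> j' < ns ! k' \<Longrightarrow>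
    nodes ns s (block_start ns k + j) (block_start ns k' + j') = (if k = k' then newton s j' j else 0)"
  by (cases "k = k'") (simp_all add: nodes_def loc_block_start)

lemma sum_nodes:
  assumes "k < length ns" "j < ns ! k"
  shows "(\<Sum>p<sum_list ns. f p * nodes ns s p (block_start ns k + j)) = (\<Sum>p<ns ! k. f (block_start ns k + p) * newton s j p)"
proof -
  have "(\<Sum>p<sum_list ns. f p * nodes ns s p (block_start ns k + j))
     = (\<Sum>k'<length ns. if k' = k then \<Sum>p<ns ! k. f (block_start ns k + p) * newton s j p else 0)"
    unfolding sum_blocks
  proof (intro sum.cong refl)
    fix k' assume k': "k' \<in> {..<length ns}"
    show "(\<Sum>p<ns ! k'. f (block_start ns k' + p) * nodes ns s (block_start ns k' + p) (block_start ns k + j))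
      = (if k' = k then \<Sum>p<ns ! k. f (block_start ns k + p) * newton s j p else 0)"
    proof (cases "k' = k")
      case True
      then show ?thesis using assms by (simp add: nodes_block)
    next
      case False
      then have "(\<Sum>p<ns ! k'. f (block_start ns k' + p) * nodes ns s (block_start ns k' + p) (block_start ns k + j)) = 0"
        using assms k' by (intro sum.neutral) (auto simp: nodes_block)
      then show ?thesis using False by simp
    qed
  qed
  then show ?thesis using assms by simp
qed

text \<open>Evaluation at a node is multiplicative by \<open>newton_product\<close>, which
  diagonalizes the whole deformed algebra at once.\<close>

lemma hmat_nodes:
  assumes "q < sum_list ns" "l < sum_list ns"
  shows "(\<Sum>p<sum_list ns. hmat ns s x q p * nodes ns s p l) = eigen ns s x l * nodes ns s q l"
proof -
  obtain k j where l: "k < length ns" "j < ns ! k" "l = block_start ns k + j" using loc_inverse[OF assms(2)] by blast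
  obtain k' i where q: "k' < length ns" "i < ns ! k'" "q = block_start ns k' + i" using loc_inverse[OF assms(1)] by blast
  show ?thesis
  proof (cases "k = k'")
    case True
    have "(\<Sum>p<sum_list ns. hmat ns s x q p * nodes ns s p l)
       = (\<Sum>p<ns ! k. (\<Sum>m<ns ! k. x k m * newton_mult s m i p) * newton s j p)"
      unfolding l(3) sum_nodes[OF l(1,2)] using True l q
      by (intro sum.cong refl) (simp add: hmat_def loc_block_start)
    also have "\<dots> = (\<Sum>m<ns ! k. x k m * (\<Sum>p<ns ! k. newton_mult s m i p * newton s j p))"
      unfolding sum_distrib_right sum_distrib_left mult.assoc by (rule sum.swap)
    also have "\<dots> = (\<Sum>m<ns ! k. x k m * newton s j m) * newton s j i"
      using newton_product[OF l(2), of i s] q True by (simp add: sum_distrib_right mult.assoc)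
    finally show ?thesis using True l q by (simp add: eigen_def nodes_def loc_block_start)
  next
    case False
    have "(\<Sum>p<sum_list ns. hmat ns s x q p * nodes ns s p l) = 0"
      unfolding l(3) sum_nodes[OF l(1,2)] using False l q
      by (intro sum.neutral) (auto simp: hmat_def loc_block_start)
    then show ?thesis using False l q by (simp add: nodes_def loc_block_start)
  qed
qed

section \<open>The moments of a Dirichlet integral\<close>

text \<open>
  For the diagonal torus, consider the point whose column \<open>l < N - 1\<close> is the basis vector
  \<open>e\<^bsub>ind r l\<^esub>\<close> and whose last column is \<open>(1, \<dots>, 1)\<close>.  There the derivatives of
  \<open>\<integral> \<Prod>\<^sub>l (t z\<^sub>l)^(a\<^sub>l) dt\<close> are values of a Dirichlet integral; \<open>moment\<close> is its analytic
  continuation, with \<open>Inl i\<close> counting factors \<open>t\<^sub>i\<close> and \<open>Inr l\<close> derivatives of the \<open>l\<close>-th factor.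
\<close>

definition ind :: "nat \<Rightarrow> nat \<Rightarrow> nat" where "ind r l = (if l \<le> r then l else 0)"

definition fall :: "complex \<Rightarrow> nat \<Rightarrow> complex" where "fall a n = (\<Prod>j<n. a - of_nat j)"

text \<open>Each derivative of a factor \<open>(t z_l)^(a_l)\<close> with respect to an entry of
  \<open>z\<close> brings along one factor \<open>t_i\<close>, so derivatives of the integral only
  produce monomials with equal counts; the others get the value zero.\<close>

definition balanced :: "nat \<Rightarrow> nat \<Rightarrow> (nat + nat \<Rightarrow>\<^sub>0 nat) \<Rightarrow> bool" where
  "balanced r N m \<longleftrightarrow> (\<Sum>i<r + 1. lookup m (Inl i)) = (\<Sum>l<N. lookup m (Inr l))"

definition expo :: "nat \<Rightarrow> nat \<Rightarrow> (nat \<Rightarrow> complex) \<Rightarrow> (nat + nat \<Rightarrow>\<^sub>0 nat) \<Rightarrow> nat \<Rightarrow> complex" where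
  "expo r N a m i = (\<Sum>l | l < N - 1 \<and> ind r l = i. a l - of_nat (lookup m (Inr l))) + 1 + of_nat (lookup m (Inl i))"

text \<open>On the simplex the integral is the product of the Gamma values divided by
  \<open>Gamma\<close> of the sum of their arguments, and differentiating the last factor
  contributes \<open>fall\<close> of \<open>a (N - 1)\<close>. By \<open>sum_expo\<close> this
  quotient is a sign times a constant independent of \<open>m\<close>, which is dropped: hence the
  power of -1 and the product over \<open>l < N - 1\<close> only.\<close>

definition moment :: "nat \<Rightarrow> nat \<Rightarrow> (nat \<Rightarrow> complex) \<Rightarrow> (nat + nat \<Rightarrow>\<^sub>0 nat) \<Rightarrow> complex" where
  "moment r N a m = (if balanced r N m then (-1) ^ lookup m (Inr (N - 1)) *
     (\<Prod>l<N - 1. fall (a l) (lookup m (Inr l))) * (\<Prod>i<r + 1. Gamma (expo r N a m i)) else 0)"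

definition base_pt :: "nat \<Rightarrow> nat \<Rightarrow> nat \<Rightarrow> nat \<Rightarrow> complex" where
  "base_pt r N j l = (if l = N - 1 \<or> ind r l = j then 1 else 0)"

text \<open>The Gamma arguments \<open>X\<close> are decoupled from \<open>m\<close>, so that
  changes of the exponents and of the falling factorials can be followed separately.\<close>

definition core :: "nat \<Rightarrow> nat \<Rightarrow> (nat \<Rightarrow> complex) \<Rightarrow> (nat + nat \<Rightarrow>\<^sub>0 nat) \<Rightarrow> (nat \<Rightarrow> complex) \<Rightarrow> complex" where
  "core r N a m X = (-1) ^ lookup m (Inr (N - 1)) *
     (\<Prod>l<N - 1. fall (a l) (lookup m (Inr l))) * (\<Prod>i<r + 1. Gamma (X i))"

lemma moment_core: "moment r N a m = (if balanced r N m then core r N a m (expo r N a m) else 0)"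
  by (simp add: moment_def core_def)

lemma balanced_shift:
  assumes "i < r + 1" "l < N"
  shows "balanced r N (single (Inl i) 1 + (single (Inr l) 1 + m)) \<longleftrightarrow> balanced r N m"
  using assms by (simp add: balanced_def lookup_add lookup_single when_def sum.distrib del: sum.lessThan_Suc)

lemma balanced_swap:
  assumes "i < r + 1" "j < r + 1" "lookup m (Inl j) \<noteq> 0"
  shows "balanced r N (single (Inl i) 1 + (m - single (Inl j) 1)) \<longleftrightarrow> balanced r N m"
proof -
  have "m = (m - single (Inl j) 1) + single (Inl j) 1"
    using assms(3) by (intro poly_mapping_eqI) (auto simp: lookup_add lookup_minus lookup_single when_def)
  then obtain m' where m: "m = m' + single (Inl j) 1" "m - single (Inl j) 1 = m'" by blast
  show ?thesis unfolding m(2) unfolding m(1) using assms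
    by (simp add: balanced_def lookup_add lookup_single when_def sum.distrib del: sum.lessThan_Suc)
qed

lemma expo_shift:
  "expo r N a (single (Inl i) 1 + (single (Inr l) 1 + m)) i'
    = expo r N a m i' + (if i' = i then 1 else 0) - (if l < N - 1 \<and> ind r l = i' then 1 else 0)"
proof -
  let ?S = "{l'. l' < N - 1 \<and> ind r l' = i'}"
  have "(\<Sum>l'\<in>?S. a l' - of_nat (lookup (single (Inl i) 1 + (single (Inr l) 1 + m)) (Inr l')))
    = (\<Sum>l'\<in>?S. (a l' - of_nat (lookup m (Inr l'))) - (if l' = l then 1 else 0))"
    by (intro sum.cong refl) (auto simp: lookup_add lookup_single when_def)
  also have "\<dots> = (\<Sum>l'\<in>?S. a l' - of_nat (lookup m (Inr l'))) - (if l < N - 1 \<and> ind r l = i' then 1 else 0)"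
    by (subst sum_subtractf) (simp add: sum.delta)
  finally show ?thesis by (simp add: expo_def lookup_add lookup_single when_def)
qed

lemma expo_swap:
  assumes "lookup m (Inl j) \<noteq> 0"
  shows "expo r N a (single (Inl i) 1 + (m - single (Inl j) 1)) i'
    = expo r N a m i' + (if i' = i then 1 else 0) - (if i' = j then 1 else 0)"
  using assms by (auto simp: expo_def lookup_add lookup_minus lookup_single when_def of_nat_diff)

lemma fall_Suc: "fall a (Suc n) = fall a n * (a - of_nat n)"
  by (simp add: fall_def)

lemma core_shift:
  assumes "l < N - 1"
  shows "core r N a (single (Inl i) 1 + (single (Inr l) 1 + m)) X = (a l - of_nat (lookup m (Inr l))) * core r N a m X"
proof -
  let ?m = "single (Inl i) 1 + (single (Inr l) 1 + m)"
  have "(\<Prod>l'<N - 1. fall (a l') (lookup ?m (Inr l'))) = fall (a l) (Suc (lookup m (Inr l))) * (\<Prod>l'\<in>{..<N - 1} - {l}. fall (a l') (lookup m (Inr l')))"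
    using assms by (subst prod.remove[of _ l]) (auto simp: lookup_add lookup_single when_def intro!: prod.cong)
  also have "\<dots> = (a l - of_nat (lookup m (Inr l))) * (\<Prod>l'<N - 1. fall (a l') (lookup m (Inr l')))"
    using assms by (subst (2) prod.remove[of _ l]) (auto simp: fall_Suc)
  finally have "(\<Prod>l'<N - 1. fall (a l') (lookup ?m (Inr l'))) = \<dots>" .
  moreover have "lookup ?m (Inr (N - 1)) = lookup m (Inr (N - 1))"
    using assms by (auto simp: lookup_add lookup_single when_def)
  ultimately show ?thesis by (simp only: core_def mult_ac)
qed

lemma core_shift_last:
  "core r N a (single (Inl i) 1 + (single (Inr (N - 1)) 1 + m)) X = - core r N a m X"
proof -
  let ?m = "single (Inl i) 1 + (single (Inr (N - 1)) 1 + m)"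
  have "(\<Prod>l'<N - 1. fall (a l') (lookup ?m (Inr l'))) = (\<Prod>l'<N - 1. fall (a l') (lookup m (Inr l')))"
    by (intro prod.cong refl) (auto simp: lookup_add lookup_single when_def)
  moreover have "lookup ?m (Inr (N - 1)) = Suc (lookup m (Inr (N - 1)))"
    by (auto simp: lookup_add lookup_single when_def)
  ultimately show ?thesis by (simp add: core_def)
qed

lemma core_swap: "core r N a (single (Inl i) 1 + (m - single (Inl j) 1)) X = core r N a m X"
  by (simp add: core_def lookup_add lookup_minus lookup_single when_def)

lemma core_Gamma:
  assumes "j < r + 1" "X j \<notin> \<int>"
  shows "core r N a m (\<lambda>i. X i + (if i = j then 1 else 0)) = X j * core r N a m X"
proof -
  have "X j \<notin> \<int>\<^sub>\<le>\<^sub>0" using assms(2) nonpos_Ints_Int by blast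
  then have g: "Gamma (X j + 1) = X j * Gamma (X j)" by (rule Gamma_plus1)
  have "(\<Prod>i<r + 1. Gamma (X i + (if i = j then 1 else 0))) = Gamma (X j + 1) * (\<Prod>i\<in>{..<r + 1} - {j}. Gamma (X i))"
    using assms(1) by (subst prod.remove[of _ j]) (auto intro!: prod.cong)
  also have "\<dots> = X j * (\<Prod>i<r + 1. Gamma (X i))"
    unfolding g using assms(1) by (subst (2) prod.remove[of _ j]) auto
  finally show ?thesis by (simp only: core_def mult_ac)
qed

text \<open>All exponents of a class differ from the sum of its \<open>a l\<close> by an integer, so
  one condition per class keeps every Gamma argument off the poles.\<close>

lemma expo_notin_Ints:
  assumes "(\<Sum>l | l < N - 1 \<and> ind r l = i. a l) \<notin> \<int>" "c \<in> \<int>"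
  shows "expo r N a m i + c \<notin> \<int>"
proof
  let ?S = "{l. l < N - 1 \<and> ind r l = i}"
  assume *: "expo r N a m i + c \<in> \<int>"
  have "(\<Sum>l\<in>?S. a l) = (expo r N a m i + c) - c - 1 - of_nat (lookup m (Inl i)) + (\<Sum>l\<in>?S. of_nat (lookup m (Inr l)))"
    by (simp add: expo_def sum_subtractf)
  also have "\<dots> \<in> \<int>" using * assms(2) by (intro Ints_add Ints_diff Ints_sum) auto
  finally show False using assms(1) by simp
qed

lemma sum_expo:
  assumes a: "(\<Sum>l<N. a l) = - of_nat (r + 1)" and N: "0 < N" and b: "balanced r N m"
  shows "(\<Sum>i<r + 1. expo r N a m i) = of_nat (lookup m (Inr (N - 1))) - a (N - 1)"
proof -
  obtain N' where N': "N = Suc N'" using N by (cases N) auto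
  let ?f = "\<lambda>l. a l - of_nat (lookup m (Inr l))"
  have img: "ind r ` {..<N'} \<subseteq> {..<r + 1}" by (auto simp: ind_def)
  have "(\<Sum>i<r + 1. \<Sum>l | l < N' \<and> ind r l = i. ?f l) = (\<Sum>l<N'. ?f l)"
    using sum.group[OF _ _ img, of ?f] by (simp del: sum.lessThan_Suc)
  moreover have "(\<Sum>i<r + 1. of_nat (lookup m (Inl i))) = (\<Sum>l<N. of_nat (lookup m (Inr l)) :: complex)"
    using b unfolding balanced_def by (metis of_nat_sum)
  moreover have "(\<Sum>l<N'. a l) = - of_nat (r + 1) - a N'" using a by (simp add: N' algebra_simps)
  ultimately show ?thesis
    unfolding expo_def sum.distrib by (simp add: N' sum_subtractf del: sum.lessThan_Suc) (simp add: algebra_simps)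
qed

context
  fixes r N :: nat and a :: "nat \<Rightarrow> complex"
  assumes N: "r + 1 < N" and a: "(\<Sum>l<N. a l) = - of_nat (r + 1)"
    and nonint: "\<And>i. i < r + 1 \<Longrightarrow> (\<Sum>l | l < N - 1 \<and> ind r l = i. a l) \<notin> \<int>"
begin

text \<open>Euler's relation for one factor. For \<open>l < N - 1\<close> the new factor
  \<open>t_i\<close> cancels the lowered power and only the falling factorial changes. For the last
  column each Gamma argument rises by one in turn, and the sum of the resulting factors is known
  from \<open>sum_expo\<close>.\<close>

lemma moment_torus:
  assumes l: "l < N"
  shows "(\<Sum>j<r + 1. base_pt r N j l * moment r N a (single (Inl j) 1 + (single (Inr l) 1 + m)))
    + of_nat (lookup m (Inr l)) * moment r N a m = a l * moment r N a m"
proof (cases "balanced r N m")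
  case False
  then show ?thesis using l by (simp add: moment_core balanced_shift[unfolded One_nat_def])
next
  case True
  have mo: "moment r N a (single (Inl j) 1 + (single (Inr l) 1 + m))
      = core r N a (single (Inl j) 1 + (single (Inr l) 1 + m)) (expo r N a (single (Inl j) 1 + (single (Inr l) 1 + m)))"
    if "j < r + 1" for j
    unfolding moment_core balanced_shift[OF that l] using True by (simp only: if_True)
  show ?thesis
  proof (cases "l = N - 1")
    case last: True
    have "base_pt r N j l * moment r N a (single (Inl j) 1 + (single (Inr l) 1 + m)) = - expo r N a m j * core r N a m (expo r N a m)"
      if j: "j < r + 1" for j
    proof -
      have "expo r N a (single (Inl j) 1 + (single (Inr l) 1 + m)) = (\<lambda>i. expo r N a m i + (if i = j then 1 else 0))"
        unfolding expo_shift last by (rule ext) simp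
      moreover have "expo r N a m j \<notin> \<int>" using expo_notin_Ints[OF nonint[OF j], of 0] by simp
      ultimately show ?thesis
        unfolding mo[OF j] using core_shift_last[of r N a j m] core_Gamma[OF j]
        by (simp add: last base_pt_def)
    qed
    then have "(\<Sum>j<r + 1. base_pt r N j l * moment r N a (single (Inl j) 1 + (single (Inr l) 1 + m)))
      = (\<Sum>j<r + 1. - expo r N a m j * core r N a m (expo r N a m))" by (intro sum.cong refl) simp
    also have "\<dots> = - (\<Sum>j<r + 1. expo r N a m j) * core r N a m (expo r N a m)"
      unfolding sum_distrib_right[symmetric] sum_negf ..
    also have "\<dots> = (a l - of_nat (lookup m (Inr l))) * moment r N a m"
      using N by (subst sum_expo[OF a _ True]) (simp_all add: last moment_core True)
    finally show ?thesis by (simp add: algebra_simps)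
  next
    case False
    then have l': "l < N - 1" using l by simp
    define j where "j = ind r l"
    have j: "j < r + 1" by (simp add: j_def ind_def)
    have "(\<Sum>j<r + 1. base_pt r N j l * moment r N a (single (Inl j) 1 + (single (Inr l) 1 + m)))
      = (\<Sum>j'<r + 1. if j' = j then moment r N a (single (Inl j) 1 + (single (Inr l) 1 + m)) else 0)"
      using False by (intro sum.cong refl) (auto simp: base_pt_def j_def)
    also have "\<dots> = moment r N a (single (Inl j) 1 + (single (Inr l) 1 + m))" using j by simp
    also have "\<dots> = (a l - of_nat (lookup m (Inr l))) * moment r N a m"
    proof -
      have "expo r N a (single (Inl j) 1 + (single (Inr l) 1 + m)) = expo r N a m"
        unfolding expo_shift using l' by (auto simp: j_def)
      then show ?thesis unfolding mo[OF j] using core_shift[OF l', of r a j m] True by (simp add: moment_core)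
    qed
    finally show ?thesis by (simp add: algebra_simps)
  qed
qed

text \<open>Integration by parts in \<open>t_j\<close>. All terms are multiples of one value of
  \<open>core\<close>, and their factors add up to \<open>X j - X j\<close>.\<close>

lemma moment_row:
  assumes i: "i < r + 1" and j: "j < r + 1"
  shows "(\<Sum>l<N. base_pt r N j l * moment r N a (single (Inl i) 1 + (single (Inr l) 1 + m)))
    + of_nat (lookup m (Inl j)) * moment r N a (single (Inl i) 1 + (m - single (Inl j) 1))
    + (if i = j then moment r N a m else 0) = 0"
proof (cases "balanced r N m")
  case False
  then show ?thesis using balanced_shift[OF i] balanced_swap[OF i j]
    by (cases "lookup m (Inl j) = 0") (auto simp: moment_core simp del: One_nat_def intro!: sum.neutral)
next
  case True
  obtain N' where N': "N = Suc N'" using N by (cases N) auto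
  \<comment> \<open>The Gamma arguments after a factor \<open>t_j\<close> has been exchanged for
    \<open>t_i\<close>. Every contributing term has exactly these, except that the last column has
    one more \<open>t_j\<close>.\<close>
  define X where "X i' = expo r N a m i' + (if i' = i then 1 else 0) - (if i' = j then 1 else 0)" for i'
  define C where "C = core r N a m X"
  define S where "S = {l. l < N' \<and> ind r l = j}"
  have mo: "moment r N a (single (Inl i) 1 + (single (Inr l) 1 + m))
      = core r N a (single (Inl i) 1 + (single (Inr l) 1 + m)) (expo r N a (single (Inl i) 1 + (single (Inr l) 1 + m)))"
    if "l < N" for l
    unfolding moment_core balanced_shift[OF i that] using True by (simp only: if_True)
  have T: "moment r N a (single (Inl i) 1 + (single (Inr l) 1 + m)) = (a l - of_nat (lookup m (Inr l))) * C"
    if "l \<in> S" for l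
  proof -
    have "l < N - 1" "ind r l = j" using that by (auto simp: S_def N')
    then have "expo r N a (single (Inl i) 1 + (single (Inr l) 1 + m)) = X"
      unfolding expo_shift X_def by auto
    then show ?thesis using mo[of l] core_shift[OF \<open>l < N - 1\<close>, of r a i m X] \<open>l < N - 1\<close> by (simp add: C_def)
  qed
  have last: "moment r N a (single (Inl i) 1 + (single (Inr (N - 1)) 1 + m)) = - (X j * C)"
  proof -
    have "expo r N a (single (Inl i) 1 + (single (Inr (N - 1)) 1 + m)) = (\<lambda>i'. X i' + (if i' = j then 1 else 0))"
      unfolding expo_shift X_def by auto
    moreover have "X j \<notin> \<int>"
      using expo_notin_Ints[OF nonint[OF j], of "(if j = i then 1 else 0) - 1" m] by (simp add: X_def add_diff_eq)
    ultimately show ?thesis using mo[of "N - 1"] core_shift_last[of r N a i m] core_Gamma[OF j, of X N a m] N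
      by (simp add: C_def)
  qed
  have sw: "of_nat (lookup m (Inl j)) * moment r N a (single (Inl i) 1 + (m - single (Inl j) 1)) = of_nat (lookup m (Inl j)) * C"
  proof (cases "lookup m (Inl j) = 0")
    case False
    have "expo r N a (single (Inl i) 1 + (m - single (Inl j) 1)) = X"
      unfolding expo_swap[OF False] X_def ..
    then show ?thesis using balanced_swap[OF i j False, of N] True core_swap[of r N a i m j X]
      by (simp add: moment_core C_def)
  qed simp
  have dg: "(if i = j then moment r N a m else 0) = (if i = j then C else 0)"
  proof (cases "i = j")
    case eq: True
    then have "X = expo r N a m" by (auto simp: X_def)
    then show ?thesis using True eq by (simp add: moment_core C_def)
  qed simp
  have "(\<Sum>l<N. base_pt r N j l * moment r N a (single (Inl i) 1 + (single (Inr l) 1 + m)))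
    = (\<Sum>l<N'. base_pt r N j l * moment r N a (single (Inl i) 1 + (single (Inr l) 1 + m)))
      + moment r N a (single (Inl i) 1 + (single (Inr (N - 1)) 1 + m))"
    by (simp add: N' base_pt_def)
  also have "(\<Sum>l<N'. base_pt r N j l * moment r N a (single (Inl i) 1 + (single (Inr l) 1 + m)))
    = (\<Sum>l<N'. if ind r l = j then moment r N a (single (Inl i) 1 + (single (Inr l) 1 + m)) else 0)"
    by (intro sum.cong refl) (auto simp: base_pt_def N')
  also have "\<dots> = (\<Sum>l\<in>S. moment r N a (single (Inl i) 1 + (single (Inr l) 1 + m)))"
    unfolding S_def by (subst sum.inter_filter[symmetric]) auto
  also have "\<dots> = (\<Sum>l\<in>S. a l - of_nat (lookup m (Inr l))) * C"
    unfolding sum_distrib_right by (intro sum.cong refl T)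
  finally have "(\<Sum>l<N. base_pt r N j l * moment r N a (single (Inl i) 1 + (single (Inr l) 1 + m)))
    = (\<Sum>l\<in>S. a l - of_nat (lookup m (Inr l))) * C - X j * C" unfolding last by simp
  moreover have "X j = (\<Sum>l\<in>S. a l - of_nat (lookup m (Inr l))) + of_nat (lookup m (Inl j)) + (if i = j then 1 else 0)"
    by (auto simp: X_def expo_def S_def N')
  ultimately show ?thesis unfolding sw dg by (simp only:) (auto simp: algebra_simps)
qed

end

section \<open>A formal solution of the deformed system\<close>

context
  fixes r N :: nat and a :: "nat \<Rightarrow> complex"
  assumes N: "r + 1 < N" and a: "(\<Sum>l<N. a l) = - of_nat (r + 1)"
    and nonint: "\<And>i. i < r + 1 \<Longrightarrow> (\<Sum>l | l < N - 1 \<and> ind r l = i. a l) \<notin> \<int>"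
begin

lemma lin_moment_torus:
  assumes l: "l < N"
  shows "lin (moment r N a) (Var (Inr l) * ((\<Sum>j<r + 1. Con (base_pt r N j l) * Var (Inl j)) * w + D (Inr l) w))
    = a l * lin (moment r N a) w"
proof (induction w rule: mpoly_single_induct)
  case (single m)
  define c where "c = lookup w m"
  have "Var (Inr l) * ((\<Sum>j<r + 1. Con (base_pt r N j l) * Var (Inl j)) * single m c)
     = (\<Sum>j<r + 1. Con (base_pt r N j l) * single (single (Inl j) 1 + (single (Inr l) 1 + m)) c)"
    unfolding sum_distrib_left sum_distrib_right Var_mult_single[symmetric] by (simp only: mult_ac)
  then have 1: "lin (moment r N a) (Var (Inr l) * ((\<Sum>j<r + 1. Con (base_pt r N j l) * Var (Inl j)) * single m c))
     = c * (\<Sum>j<r + 1. base_pt r N j l * moment r N a (single (Inl j) 1 + (single (Inr l) 1 + m)))"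
    by (simp only: lin_sum lin_Con_mult lin_single sum_distrib_left mult_ac)
  have 2: "lin (moment r N a) (Var (Inr l) * D (Inr l) (single m c)) = c * (of_nat (lookup m (Inr l)) * moment r N a m)"
  proof (cases "lookup m (Inr l) = 0")
    case True
    then show ?thesis by (simp add: D_single)
  next
    case False
    then have "single (Inr l) 1 + (m - single (Inr l) 1) = m"
      by (intro poly_mapping_eqI) (auto simp: lookup_add lookup_minus lookup_single when_def)
    then show ?thesis unfolding D_single Var_mult_single lin_single by simp
  qed
  show ?case unfolding c_def[symmetric] distrib_left lin_add 1 2 lin_single
    using moment_torus[OF N a nonint l, of m] by (simp only: distrib_left[symmetric] mult.left_commute)
next
  case (add u v)
  let ?s = "\<Sum>j<r + 1. Con (base_pt r N j l) * Var (Inl j) :: (nat + nat) mpoly"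
  have "Var (Inr l) * (?s * (u + v) + D (Inr l) (u + v))
    = Var (Inr l) * (?s * u + D (Inr l) u) + Var (Inr l) * (?s * v + D (Inr l) v)"
    by (simp only: D_add distrib_left add_ac)
  then show ?case using add by (simp only: lin_add distrib_left)
qed simp

lemma lin_moment_row:
  assumes i: "i < r + 1" and j: "j < r + 1"
  shows "lin (moment r N a) (Var (Inl i) * ((\<Sum>l<N. Con (base_pt r N j l) * Var (Inr l)) * w + D (Inl j) w)
    + (if i = j then w else 0)) = 0"
proof (induction w rule: mpoly_single_induct)
  case (single m)
  define c where "c = lookup w m"
  have "Var (Inl i) * ((\<Sum>l<N. Con (base_pt r N j l) * Var (Inr l)) * single m c)
     = (\<Sum>l<N. Con (base_pt r N j l) * single (single (Inl i) 1 + (single (Inr l) 1 + m)) c)"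
    unfolding sum_distrib_left sum_distrib_right Var_mult_single[symmetric] by (simp only: mult_ac)
  then have 1: "lin (moment r N a) (Var (Inl i) * ((\<Sum>l<N. Con (base_pt r N j l) * Var (Inr l)) * single m c))
     = c * (\<Sum>l<N. base_pt r N j l * moment r N a (single (Inl i) 1 + (single (Inr l) 1 + m)))"
    by (simp only: lin_sum lin_Con_mult lin_single sum_distrib_left mult_ac)
  have 2: "lin (moment r N a) (Var (Inl i) * D (Inl j) (single m c))
     = c * (of_nat (lookup m (Inl j)) * moment r N a (single (Inl i) 1 + (m - single (Inl j) 1)))"
    unfolding D_single Var_mult_single lin_single by (simp only: mult_ac)
  have 3: "lin (moment r N a) (if i = j then single m c else 0) = c * (if i = j then moment r N a m else 0)"
    by simp
  show ?case unfolding c_def[symmetric] distrib_left lin_add 1 2 3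
    using moment_row[OF N a nonint i j, of m] by (simp only: distrib_left[symmetric] mult_zero_right)
next
  case (add u v)
  have "Var (Inl i) * ((\<Sum>l<N. Con (base_pt r N j l) * Var (Inr l)) * (u + v) + D (Inl j) (u + v)) + (if i = j then u + v else 0)
    = (Var (Inl i) * ((\<Sum>l<N. Con (base_pt r N j l) * Var (Inr l)) * u + D (Inl j) u) + (if i = j then u else 0))
    + (Var (Inl i) * ((\<Sum>l<N. Con (base_pt r N j l) * Var (Inr l)) * v + D (Inl j) v) + (if i = j then v else 0))"
    by (simp only: D_add distrib_left) (auto simp: add_ac)
  then show ?case using add by (simp only: lin_add add_0_left)
qed simp

text \<open>Away from its poles the Gamma function has no zeros, and all other factors are
  1.\<close>

lemma moment_0: "moment r N a 0 \<noteq> 0"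
proof -
  have "Gamma (expo r N a 0 i) \<noteq> 0" if "i < r + 1" for i
  proof -
    have "expo r N a 0 i \<notin> \<int>" using expo_notin_Ints[OF nonint[OF that], of 0] by simp
    then show ?thesis using Gamma_eq_zero_iff nonpos_Ints_Int by blast
  qed
  then show ?thesis by (simp add: moment_def balanced_def fall_def)
qed

end

text \<open>The derivative at \<open>(i, p)\<close> acts on the integrand as \<open>t_i\<close>
  times a combination of the derivatives of the single factors, weighted by the eigenvectors. The
  value zero outside the cells lets the chain rule sum over cells.\<close>

definition veronese :: "nat \<Rightarrow> nat list \<Rightarrow> complex \<Rightarrow> nat \<times> nat \<Rightarrow> (nat + nat) mpoly" where
  "veronese r ns s x = (if x \<in> cells r ns
     then Var (Inl (fst x)) * (\<Sum>l<sum_list ns. Con (nodes ns s (snd x) l) * Var (Inr l)) else 0)"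

abbreviation pullback :: "nat \<Rightarrow> nat list \<Rightarrow> complex \<Rightarrow> (nat \<times> nat) mpoly \<Rightarrow> (nat + nat) mpoly" where
  "pullback r ns s \<equiv> peval Con (veronese r ns s)"

lemmas pullback_simps = peval_add[OF Con_hom] peval_mult[OF Con_hom] peval_Var[OF Con_hom]
  peval_Con[OF Con_hom] peval_sum[OF Con_hom] peval_diff[OF Con_hom]

lemma veronese_cell:
  "i < r + 1 \<Longrightarrow> p < sum_list ns \<Longrightarrow>
    veronese r ns s (i, p) = Var (Inl i) * (\<Sum>l<sum_list ns. Con (nodes ns s p l) * Var (Inr l))"
  by (simp add: veronese_def cells_def)

lemma D_veronese_Inr:
  assumes "l < sum_list ns"
  shows "D (Inr l) (veronese r ns s x) = (if x \<in> cells r ns then Con (nodes ns s (snd x) l) * Var (Inl (fst x)) else 0)"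
proof -
  have "D (Inr l) (\<Sum>l'<sum_list ns. Con (nodes ns s p l') * Var (Inr l') :: (nat + nat) mpoly) = Con (nodes ns s p l)" for p
  proof -
    have "D (Inr l) (\<Sum>l'<sum_list ns. Con (nodes ns s p l') * Var (Inr l') :: (nat + nat) mpoly)
      = (\<Sum>l'<sum_list ns. if l' = l then Con (nodes ns s p l) else 0)"
      unfolding D_sum D_Con_mult D_Var by (intro sum.cong refl) auto
    then show ?thesis using assms by simp
  qed
  then show ?thesis by (simp add: veronese_def D_mult D_Var mult.commute)
qed

lemma D_veronese_Inl:
  "D (Inl j) (veronese r ns s x)
    = (if x \<in> cells r ns \<and> fst x = j then \<Sum>l<sum_list ns. Con (nodes ns s (snd x) l) * Var (Inr l) else 0)"
  by (auto simp: veronese_def D_mult D_Var D_sum D_Con_mult)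

lemma chain_rule:
  assumes "\<And>x. D y (\<phi> x) = (if x \<in> G then d x else 0)" "finite G"
  shows "D y (peval Con \<phi> w) = (\<Sum>x\<in>G. d x * peval Con \<phi> (D x w))"
proof (induction w rule: mpoly_induct)
  case (Con c)
  then show ?case by (simp add: pullback_simps peval_0[OF Con_hom])
next
  case (Var x w)
  have "(\<Sum>x'\<in>G. d x' * peval Con \<phi> (D x' (Var x * w)))
      = (\<Sum>x'\<in>G. (if x' = x then d x * peval Con \<phi> w else 0) + \<phi> x * (d x' * peval Con \<phi> (D x' w)))"
    by (intro sum.cong refl)
       (auto simp: D_Var_mult pullback_simps peval_0[OF Con_hom] distrib_left mult.left_commute)
  also have "\<dots> = (if x \<in> G then d x else 0) * peval Con \<phi> w + \<phi> x * (\<Sum>x'\<in>G. d x' * peval Con \<phi> (D x' w))"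
    using assms(2) by (simp add: sum.distrib sum_distrib_left)
  finally show ?case using Var by (simp add: pullback_simps D_mult assms(1))
qed (simp add: pullback_simps D_add distrib_left sum.distrib)

context
  fixes r :: nat and ns :: "nat list" and s :: complex and a :: "nat \<Rightarrow> complex" and z :: "nat \<times> nat \<Rightarrow> complex"
  assumes N: "r + 1 < sum_list ns" and a: "(\<Sum>l<sum_list ns. a l) = - of_nat (r + 1)"
    and nonint: "\<And>i. i < r + 1 \<Longrightarrow> (\<Sum>l | l < sum_list ns - 1 \<and> ind r l = i. a l) \<notin> \<int>"
    and z: "\<And>i l. i < r + 1 \<Longrightarrow> l < sum_list ns \<Longrightarrow>
      (\<Sum>p<sum_list ns. z (i, p) * nodes ns s p l) = base_pt r (sum_list ns) i l"
begin

abbreviation (input) "solution \<equiv> \<lambda>m. lin (moment r (sum_list ns) a) (pullback r ns s (single m 1))"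

lemma lin_solution: "lin solution w = lin (moment r (sum_list ns) a) (pullback r ns s w)"
proof (induction w rule: mpoly_single_induct)
  case (single m)
  have e: "single m (lookup w m) = Con (lookup w m) * single m 1" by (simp add: Con_mult_single)
  show ?case unfolding lin_single by (subst e) (simp only: pullback_simps lin_Con_mult)
qed (simp_all add: lin_add pullback_simps peval_0[OF Con_hom])

text \<open>The eigenvectors \<open>nodes\<close> make the deformed algebra diagonal, so its
  operator becomes the sum of the Euler operators of the single factors with weights
  \<open>eigen\<close>; contraction with \<open>nodes\<close> moves \<open>z\<close> to
  \<open>base_pt\<close>.\<close>

lemma pullback_Tor:
  "pullback r ns s (gop r ns s \<alpha> z (Tor x) w) = (\<Sum>l<sum_list ns. Con (eigen ns s x l) *
     (Var (Inr l) * ((\<Sum>j<r + 1. Con (base_pt r (sum_list ns) j l) * Var (Inl j)) * pullback r ns s w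
        + D (Inr l) (pullback r ns s w)))) - Con (h_char ns \<alpha> x) * pullback r ns s w"
proof -
  let ?N = "sum_list ns" and ?P = "pullback r ns s"
  let ?h = "hmat ns s x" and ?v = "veronese r ns s"
  let ?E = "\<lambda>i q. Con (z (i, q)) * ?P w + ?P (D (i, q) w)"
  have hv: "(\<Sum>p<?N. Con (?h q p) * ?v (i, p)) = Var (Inl i) * (\<Sum>l<?N. Con (eigen ns s x l * nodes ns s q l) * Var (Inr l))"
    if "i < r + 1" "q < ?N" for i q
  proof -
    have "(\<Sum>p<?N. Con (?h q p) * ?v (i, p)) = (\<Sum>p<?N. \<Sum>l<?N. Con (?h q p * nodes ns s p l) * (Var (Inl i) * Var (Inr l)))"
      using that by (intro sum.cong refl) (simp add: veronese_cell sum_distrib_left Con_mult mult_ac)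
    also have "\<dots> = (\<Sum>l<?N. Con (\<Sum>p<?N. ?h q p * nodes ns s p l) * (Var (Inl i) * Var (Inr l)))"
      by (subst sum.swap) (simp only: Con_sum sum_distrib_right)
    also have "\<dots> = (\<Sum>l<?N. Con (eigen ns s x l * nodes ns s q l) * (Var (Inl i) * Var (Inr l)))"
      using hmat_nodes[OF that(2)] by (intro sum.cong refl) simp
    finally show ?thesis unfolding sum_distrib_left by (simp only: mult_ac)
  qed
  have "?P (\<Sum>a\<in>cells r ns. \<Sum>b\<in>cells r ns. Con (tens ns s (Tor x) a b) * (Con (z b) * (Var a * w) + Var a * D b w))
     = (\<Sum>a\<in>cells r ns. \<Sum>b\<in>cells r ns. Con (tens ns s (Tor x) a b) * (?v a * (Con (z b) * ?P w + ?P (D b w))))"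
    by (simp only: pullback_simps distrib_left mult_ac)
  also have "\<dots> = (\<Sum>i<r + 1. \<Sum>p<?N. \<Sum>i'<r + 1. if i' = i then \<Sum>q<?N. Con (?h q p) * (?v (i, p) * ?E i q) else 0)"
    unfolding sum_cells by (intro sum.cong refl) auto
  also have "\<dots> = (\<Sum>i<r + 1. \<Sum>p<?N. \<Sum>q<?N. Con (?h q p) * (?v (i, p) * ?E i q))"
    by (rule sum.cong[OF refl], rule sum.cong[OF refl]) (simp add: sum.delta del: sum.lessThan_Suc)
  also have "\<dots> = (\<Sum>i<r + 1. \<Sum>q<?N. (\<Sum>p<?N. Con (?h q p) * ?v (i, p)) * ?E i q)"
    by (rule sum.cong[OF refl], subst sum.swap) (simp only: sum_distrib_right mult.assoc)
  also have "\<dots> = (\<Sum>i<r + 1. \<Sum>q<?N. \<Sum>l<?N. Con (eigen ns s x l) * (Var (Inr l) * (Var (Inl i) * (Con (nodes ns s q l) * ?E i q))))"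
    by (rule sum.cong[OF refl], rule sum.cong[OF refl])
       (simp only: lessThan_iff hv sum_distrib_left sum_distrib_right Con_mult mult_ac)
  also have "\<dots> = (\<Sum>i<r + 1. \<Sum>l<?N. \<Sum>q<?N. Con (eigen ns s x l) * (Var (Inr l) * (Var (Inl i) * (Con (nodes ns s q l) * ?E i q))))"
    by (rule sum.cong[OF refl], rule sum.swap)
  also have "\<dots> = (\<Sum>l<?N. \<Sum>i<r + 1. \<Sum>q<?N. Con (eigen ns s x l) * (Var (Inr l) * (Var (Inl i) * (Con (nodes ns s q l) * ?E i q))))"
    by (rule sum.swap)
  also have "\<dots> = (\<Sum>l<?N. Con (eigen ns s x l) * (Var (Inr l) * (\<Sum>i<r + 1. Var (Inl i) * (\<Sum>q<?N. Con (nodes ns s q l) * ?E i q))))"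
    by (simp only: sum_distrib_left)
  also have "\<dots> = (\<Sum>l<?N. Con (eigen ns s x l) *
     (Var (Inr l) * ((\<Sum>j<r + 1. Con (base_pt r ?N j l) * Var (Inl j)) * ?P w + D (Inr l) (?P w))))"
  proof (intro sum.cong refl arg_cong2[of _ _ _ _ "(*)"])
    fix l assume "l \<in> {..<?N}"
    then have l: "l < ?N" by simp
    have ch: "D (Inr l) (?P w) = (\<Sum>i<r + 1. \<Sum>q<?N. Con (nodes ns s q l) * Var (Inl i) * ?P (D (i, q) w))"
      unfolding chain_rule[OF D_veronese_Inr[OF l] finite_cells] sum_cells by simp
    have zz: "Var (Inl i) * (\<Sum>q<?N. Con (nodes ns s q l) * (Con (z (i, q)) * ?P w))
        = Con (base_pt r ?N i l) * Var (Inl i) * ?P w" if "i < r + 1" for i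
      unfolding z[OF that l, symmetric] Con_sum Con_mult sum_distrib_left sum_distrib_right by (simp only: mult_ac)
    have "(\<Sum>i<r + 1. Var (Inl i) * (\<Sum>q<?N. Con (nodes ns s q l) * ?E i q))
       = (\<Sum>i<r + 1. Var (Inl i) * (\<Sum>q<?N. Con (nodes ns s q l) * (Con (z (i, q)) * ?P w)))
       + (\<Sum>i<r + 1. Var (Inl i) * (\<Sum>q<?N. Con (nodes ns s q l) * ?P (D (i, q) w)))"
      by (simp only: distrib_left sum.distrib)
    also have "(\<Sum>i<r + 1. Var (Inl i) * (\<Sum>q<?N. Con (nodes ns s q l) * (Con (z (i, q)) * ?P w)))
       = (\<Sum>j<r + 1. Con (base_pt r ?N j l) * Var (Inl j)) * ?P w"
      unfolding sum_distrib_right by (intro sum.cong refl zz) simp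
    also have "(\<Sum>i<r + 1. Var (Inl i) * (\<Sum>q<?N. Con (nodes ns s q l) * ?P (D (i, q) w))) = D (Inr l) (?P w)"
      unfolding ch sum_distrib_left by (simp only: mult_ac)
    finally show "(\<Sum>i<r + 1. Var (Inl i) * (\<Sum>q<?N. Con (nodes ns s q l) * ?E i q))
      = (\<Sum>j<r + 1. Con (base_pt r ?N j l) * Var (Inl j)) * ?P w + D (Inr l) (?P w)" .
  qed
  finally show ?thesis by (simp add: first_order_def pullback_simps Con_uminus)
qed

text \<open>The row action commutes with the change of column basis. At \<open>base_pt\<close> it
  becomes the combination of the operators treated by integration by parts, the trace supplying the
  diagonal terms.\<close>

lemma pullback_Row:
  "pullback r ns s (gop r ns s \<alpha> z (Row Y) w) = (\<Sum>i<r + 1. \<Sum>j<r + 1. Con (Y $$ (i, j)) *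
     (Var (Inl i) * ((\<Sum>l<sum_list ns. Con (base_pt r (sum_list ns) j l) * Var (Inr l)) * pullback r ns s w
        + D (Inl j) (pullback r ns s w)) + (if i = j then pullback r ns s w else 0)))"
proof -
  let ?N = "sum_list ns" and ?P = "pullback r ns s" and ?v = "veronese r ns s"
  let ?E = "\<lambda>j p. Con (z (j, p)) * ?P w + ?P (D (j, p) w)"
  have "?P (\<Sum>a\<in>cells r ns. \<Sum>b\<in>cells r ns. Con (tens ns s (Row Y) a b) * (Con (z b) * (Var a * w) + Var a * D b w))
     = (\<Sum>a\<in>cells r ns. \<Sum>b\<in>cells r ns. Con (tens ns s (Row Y) a b) * (?v a * (Con (z b) * ?P w + ?P (D b w))))"
    by (simp only: pullback_simps distrib_left mult_ac)
  also have "\<dots> = (\<Sum>i<r + 1. \<Sum>p<?N. \<Sum>j<r + 1. \<Sum>p'<?N. if p' = p then Con (Y $$ (i, j)) * (?v (i, p) * ?E j p) else 0)"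
    unfolding sum_cells by (intro sum.cong refl) auto
  also have "\<dots> = (\<Sum>i<r + 1. \<Sum>p<?N. \<Sum>j<r + 1. Con (Y $$ (i, j)) * (?v (i, p) * ?E j p))"
    by (rule sum.cong[OF refl], rule sum.cong[OF refl], rule sum.cong[OF refl])
       (simp add: sum.delta del: sum.lessThan_Suc)
  also have "\<dots> = (\<Sum>i<r + 1. \<Sum>j<r + 1. Con (Y $$ (i, j)) * (\<Sum>p<?N. ?v (i, p) * ?E j p))"
    by (rule sum.cong[OF refl], subst sum.swap) (simp only: sum_distrib_left)
  also have "\<dots> = (\<Sum>i<r + 1. \<Sum>j<r + 1. Con (Y $$ (i, j)) *
     (Var (Inl i) * ((\<Sum>l<?N. Con (base_pt r ?N j l) * Var (Inr l)) * ?P w + D (Inl j) (?P w))))"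
  proof (intro sum.cong refl arg_cong2[of _ _ _ _ "(*)"])
    fix i j assume "i \<in> {..<r + 1}" "j \<in> {..<r + 1}"
    then have ij: "i < r + 1" "j < r + 1" by simp_all
    let ?u = "\<lambda>p. \<Sum>l<?N. Con (nodes ns s p l) * Var (Inr l) :: (nat + nat) mpoly"
    have dV: "D (Inl j) (?v x) = (if x \<in> {j} \<times> {..<?N} then ?u (snd x) else 0)" for x
      unfolding D_veronese_Inl using ij by (cases x) (auto simp: cells_def)
    have ch: "D (Inl j) (?P w) = (\<Sum>p<?N. ?u p * ?P (D (j, p) w))"
    proof -
      have "D (Inl j) (?P w) = (\<Sum>x\<in>{j} \<times> {..<?N}. ?u (snd x) * ?P (D x w))"
        by (rule chain_rule[OF dV]) simp
      also have "\<dots> = (\<Sum>i\<in>{j}. \<Sum>p<?N. ?u p * ?P (D (i, p) w))"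
        by (simp add: sum.cartesian_product case_prod_unfold)
      finally show ?thesis by simp
    qed
    have zz: "(\<Sum>p<?N. ?u p * (Con (z (j, p)) * ?P w)) = (\<Sum>l<?N. Con (base_pt r ?N j l) * Var (Inr l)) * ?P w"
    proof -
      have "(\<Sum>p<?N. ?u p * (Con (z (j, p)) * ?P w))
         = (\<Sum>p<?N. \<Sum>l<?N. Con (z (j, p) * nodes ns s p l) * (Var (Inr l) * ?P w))"
        unfolding sum_distrib_right sum_distrib_left Con_mult by (simp only: mult_ac)
      also have "\<dots> = (\<Sum>l<?N. Con (\<Sum>p<?N. z (j, p) * nodes ns s p l) * (Var (Inr l) * ?P w))"
        by (subst sum.swap) (simp only: Con_sum sum_distrib_right)
      also have "\<dots> = (\<Sum>l<?N. Con (base_pt r ?N j l) * (Var (Inr l) * ?P w))"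
        using z[OF ij(2)] by (intro sum.cong refl) simp
      finally show ?thesis by (simp only: sum_distrib_right mult.assoc)
    qed
    have "(\<Sum>p<?N. ?v (i, p) * ?E j p) = (\<Sum>p<?N. Var (Inl i) * (?u p * ?E j p))"
      using ij by (intro sum.cong refl) (simp only: lessThan_iff veronese_cell mult.assoc)
    also have "\<dots> = Var (Inl i) * ((\<Sum>p<?N. ?u p * (Con (z (j, p)) * ?P w)) + (\<Sum>p<?N. ?u p * ?P (D (j, p) w)))"
      by (simp only: sum_distrib_left[symmetric] distrib_left sum.distrib)
    finally show "(\<Sum>p<?N. ?v (i, p) * ?E j p)
      = Var (Inl i) * ((\<Sum>l<?N. Con (base_pt r ?N j l) * Var (Inr l)) * ?P w + D (Inl j) (?P w))"
      unfolding zz ch .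
  qed
  finally have 1: "?P (\<Sum>a\<in>cells r ns. \<Sum>b\<in>cells r ns. Con (tens ns s (Row Y) a b) * (Con (z b) * (Var a * w) + Var a * D b w))
    = (\<Sum>i<r + 1. \<Sum>j<r + 1. Con (Y $$ (i, j)) *
     (Var (Inl i) * ((\<Sum>l<?N. Con (base_pt r ?N j l) * Var (Inr l)) * ?P w + D (Inl j) (?P w))))" .
  have 2: "Con (\<Sum>i<r + 1. Y $$ (i, i)) * ?P w = (\<Sum>i<r + 1. \<Sum>j<r + 1. Con (Y $$ (i, j)) * (if i = j then ?P w else 0))"
    unfolding Con_sum sum_distrib_right
  proof (intro sum.cong refl)
    fix i assume i: "i \<in> {..<r + 1}"
    have "(\<Sum>j<r + 1. Con (Y $$ (i, j)) * (if i = j then ?P w else 0)) = (\<Sum>j<r + 1. if j = i then Con (Y $$ (i, i)) * ?P w else 0)"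
      by (intro sum.cong refl) auto
    then show "Con (Y $$ (i, i)) * ?P w = (\<Sum>j<r + 1. Con (Y $$ (i, j)) * (if i = j then ?P w else 0))"
      using i by (simp add: sum.delta del: sum.lessThan_Suc)
  qed
  have "?P (gop r ns s \<alpha> z (Row Y) w) = ?P (\<Sum>a\<in>cells r ns. \<Sum>b\<in>cells r ns. Con (tens ns s (Row Y) a b) * (Con (z b) * (Var a * w) + Var a * D b w))
     + Con (\<Sum>i<r + 1. Y $$ (i, i)) * ?P w"
    unfolding gop.simps first_order_def cst.simps by (simp only: pullback_simps)
  then show ?thesis unfolding 1 2 by (simp only: distrib_left sum.distrib)
qed

text \<open>The minors vanish because \<open>veronese\<close> has rank one; the other families
  reduce to \<open>lin_moment_torus\<close> and \<open>lin_moment_row\<close>. The assumption on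
  \<open>h_char\<close> expresses that the character has weight \<open>a l\<close> at node
  \<open>l\<close>.\<close>

lemma solution_gop:
  assumes \<alpha>: "\<And>x. h_char ns \<alpha> x = (\<Sum>l<sum_list ns. eigen ns s x l * a l)" and g: "valid r ns g"
  shows "lin solution (gop r ns s \<alpha> z g w) = 0"
proof (cases g)
  case (Minor i j p q)
  then have "pullback r ns s (gop r ns s \<alpha> z g w) = 0"
    using g by (simp add: pullback_simps veronese_cell mult_ac)
  then show ?thesis unfolding lin_solution by simp
next
  case (Tor x)
  show ?thesis unfolding lin_solution Tor pullback_Tor lin_diff lin_sum lin_Con_mult
    using lin_moment_torus[OF N a nonint, of _ "pullback r ns s w"]
    by (simp add: \<alpha> sum_distrib_right mult.assoc del: sum.lessThan_Suc)
next
  case (Row Y)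
  show ?thesis unfolding lin_solution Row pullback_Row lin_sum lin_Con_mult
  proof (intro sum.neutral ballI, goal_cases)
    case (1 i j)
    then show ?case using lin_moment_row[OF N a nonint, of i j "pullback r ns s w"] by simp
  qed
qed

lemma solution_0: "solution 0 \<noteq> 0"
proof -
  have "pullback r ns s (single 0 1) = 1" using peval_1[OF Con_hom] by simp
  moreover have "lin (moment r (sum_list ns) a) 1 = moment r (sum_list ns) a 0"
    using lin_single[of "moment r (sum_list ns) a" 0 1] by simp
  ultimately show ?thesis using moment_0[OF N a nonint] by simp
qed

end

text \<open>For \<open>r + 1 < N\<close>, each class of \<open>ind r\<close> among the columns
  before the last contains exactly one \<open>l \<le> r\<close>, so all class sums move by the same
  amount; the last column lies outside these classes and compensates.\<close>

definition tilt :: "nat \<Rightarrow> nat \<Rightarrow> nat \<Rightarrow> complex" where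
  "tilt r N l = (if l \<le> r then 1 else if l = N - 1 then - of_nat (r + 1) else 0)"

text \<open>
  The parameter \<open>\<tau>\<close> moves the exponents of the deformed system away from the integers.  As
  \<open>tilt\<close> has sum zero, the sum of the exponents stays fixed.
\<close>

definition deform :: "nat \<Rightarrow> nat list \<Rightarrow> (nat \<Rightarrow> nat \<Rightarrow> complex) \<Rightarrow> complex \<times> complex \<Rightarrow> nat \<Rightarrow> nat \<Rightarrow> complex" where
  "deform r ns \<alpha> p k m =
     \<alpha> k m + snd p * (\<Sum>j<ns ! k. tilt r (sum_list ns) (block_start ns k + j) * newton (fst p) j m)"

lemma continuous_deform: "continuous_on UNIV (\<lambda>p. deform r ns \<alpha> p k m)"
  unfolding deform_def
  by (intro continuous_intros continuous_on_compose2[OF continuous_newton]) auto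

lemma deform_0: "deform r ns \<alpha> (0, 0) = \<alpha>"
  by (intro ext) (simp add: deform_def)

text \<open>For a small \<open>s \<noteq> 0\<close> the exponents at the nodes and the base point
  come from triangular systems. Both may blow up as \<open>s\<close> tends to 0, but the system sees
  only the Newton moments of the exponents, which agree with \<open>\<alpha>\<close> up to the term
  in \<open>\<tau>\<close>.\<close>

lemma exists_nearby_solution:
  assumes \<epsilon>: "\<epsilon> > 0" and rN: "r + 1 < sum_list ns" and pos: "\<forall>n\<in>set ns. n \<ge> 1"
    and weight: "(\<Sum>k<length ns. \<alpha> k 0) = - of_nat r - 1"
  obtains s \<tau> F z0 where "norm s < \<epsilon>" "norm \<tau> < \<epsilon>"
    "\<And>g v. valid r ns g \<Longrightarrow> lin F (gop r ns s (deform r ns \<alpha> (s, \<tau>)) z0 g v) = 0" "F 0 \<noteq> 0"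
proof -
  let ?N = "sum_list ns"
  define s :: complex where "s = of_real (\<epsilon> / 2)"
  have s: "s \<noteq> 0" "norm s < \<epsilon>" using \<epsilon> by (auto simp: s_def)
  have "\<exists>b. \<forall>m<ns ! k. (\<Sum>i<ns ! k. b i * newton s i m) = \<alpha> k m" for k
    by (rule upper_triangular_solve) (use newton_eq_0 newton_diag[OF s(1)] in auto)
  then have "\<forall>k. \<exists>b. \<forall>m<ns ! k. (\<Sum>i<ns ! k. b i * newton s i m) = \<alpha> k m" by blast
  from choice[OF this] obtain b where
    b: "\<And>k m. m < ns ! k \<Longrightarrow> (\<Sum>i<ns ! k. b k i * newton s i m) = \<alpha> k m" by blast
  define a0 where "a0 l = b (fst (loc ns l)) (snd (loc ns l))" for l
  have a0: "a0 (block_start ns k + j) = b k j" if "k < length ns" "j < ns ! k" for k j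
    using that by (simp add: a0_def loc_block_start)
  have "\<exists>x. \<forall>j<ns ! snd ik. (\<Sum>p<ns ! snd ik. x p * newton s j p)
      = base_pt r ?N (fst ik) (block_start ns (snd ik) + j)" for ik
    by (rule lower_triangular_solve) (use newton_eq_0 newton_diag[OF s(1)] in auto)
  then have "\<forall>ik. \<exists>x. \<forall>j<ns ! snd ik. (\<Sum>p<ns ! snd ik. x p * newton s j p)
      = base_pt r ?N (fst ik) (block_start ns (snd ik) + j)" by blast
  from choice[OF this] obtain x where
    x': "\<forall>ik. \<forall>j<ns ! snd ik. (\<Sum>p<ns ! snd ik. x ik p * newton s j p)
      = base_pt r ?N (fst ik) (block_start ns (snd ik) + j)" by blast
  have x: "(\<Sum>p<ns ! k. x (i, k) p * newton s j p) = base_pt r ?N i (block_start ns k + j)"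
    if "j < ns ! k" for i k j
    using x'[rule_format, of j "(i, k)"] that by simp
  define z0 where "z0 ip = x (fst ip, fst (loc ns (snd ip))) (snd (loc ns (snd ip)))" for ip
  have z0: "(\<Sum>p<?N. z0 (i, p) * nodes ns s p l) = base_pt r ?N i l" if l: "l < ?N" for i l
  proof -
    obtain k j where kj: "k < length ns" "j < ns ! k" "l = block_start ns k + j"
      using loc_inverse[OF l] by blast
    show ?thesis
      unfolding kj(3) sum_nodes[OF kj(1,2)] x[OF kj(2), symmetric]
      using kj(1) by (intro sum.cong refl) (simp add: z0_def loc_block_start)
  qed
  let ?S = "\<lambda>i. {l. l < ?N - 1 \<and> ind r l = i}"
  \<comment> \<open>It contains every real \<open>\<tau>\<close> that makes some class sum integral.
    Being countable, it cannot fill an interval.\<close>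
  let ?bad = "\<Union>i<r + 1. (\<lambda>n. Re (of_int n - sum a0 (?S i))) ` UNIV"
  have "countable ?bad" by auto
  then have "\<not> {0<..<\<epsilon>} \<subseteq> ?bad"
    using uncountable_open_interval[of 0 \<epsilon>] \<epsilon> countable_subset by blast
  then obtain t where t: "t \<in> {0<..<\<epsilon>}" "t \<notin> ?bad" by blast
  define \<tau> :: complex where "\<tau> = of_real t"
  define a where "a l = a0 l + \<tau> * tilt r ?N l" for l
  have nonint: "sum a (?S i) \<notin> \<int>" if i: "i < r + 1" for i
  proof
    assume "sum a (?S i) \<in> \<int>"
    moreover have "sum a (?S i) = sum a0 (?S i) + \<tau>"
    proof -
      have "sum (tilt r ?N) (?S i) = (\<Sum>l\<in>?S i. if l = i then 1 else 0)"
        by (intro sum.cong refl) (auto simp: tilt_def ind_def split: if_splits)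
      also have "\<dots> = 1" using i rN by (simp add: ind_def)
      finally show ?thesis by (simp add: a_def sum.distrib sum_distrib_left[symmetric])
    qed
    ultimately obtain n where "sum a0 (?S i) + \<tau> = of_int n" by (auto elim: Ints_cases)
    then have "\<tau> = of_int n - sum a0 (?S i)" by (simp add: algebra_simps)
    then have "Re \<tau> = Re (of_int n - sum a0 (?S i))" by (rule arg_cong)
    then have "t = Re (of_int n - sum a0 (?S i))" by (simp only: \<tau>_def Re_complex_of_real)
    then show False using t(2) i by blast
  qed
  have tilt0: "(\<Sum>l<?N. tilt r ?N l) = 0"
  proof -
    obtain N' where N': "?N = Suc N'" using rN by (cases ?N) auto
    have "(\<Sum>l<N'. tilt r ?N l) = (\<Sum>l<N'. if l \<in> {..r} then 1 else 0)"
      using rN by (intro sum.cong refl) (auto simp: tilt_def N')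
    also have "\<dots> = of_nat (card ({..<N'} \<inter> {..r}))" by (simp add: sum.If_cases atMost_def)
    also have "{..<N'} \<inter> {..r} = {..r}" using rN by (auto simp: N')
    finally show ?thesis using rN by (simp add: N' tilt_def)
  qed
  \<comment> \<open>The Newton polynomial of degree 0 is 1, so the zeroth moment of a block is the
    sum of its exponents.\<close>
  have "(\<Sum>l<?N. a0 l) = (\<Sum>k<length ns. \<alpha> k 0)"
    unfolding sum_blocks
  proof (intro sum.cong refl)
    fix k assume k: "k \<in> {..<length ns}"
    then have "0 < ns ! k" using pos by (metis One_nat_def Suc_le_eq lessThan_iff nth_mem)
    then show "(\<Sum>j<ns ! k. a0 (block_start ns k + j)) = \<alpha> k 0"
      using b[of 0 k] a0[of k] k by simp
  qed
  then have a: "(\<Sum>l<?N. a l) = - of_nat (r + 1)"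
    using weight tilt0 by (simp add: a_def sum.distrib sum_distrib_left[symmetric])
  have de: "deform r ns \<alpha> (s, \<tau>) k m = (\<Sum>j<ns ! k. a (block_start ns k + j) * newton s j m)"
    if "k < length ns" "m < ns ! k" for k m
    using that
    by (simp add: deform_def a_def a0 distrib_right sum.distrib b sum_distrib_left mult.assoc)
  have \<alpha>: "h_char ns (deform r ns \<alpha> (s, \<tau>)) y = (\<Sum>l<?N. eigen ns s y l * a l)" for y
    unfolding h_char_def sum_blocks
  proof (rule sum.cong[OF refl])
    fix k assume "k \<in> {..<length ns}"
    then have k: "k < length ns" by simp
    have "(\<Sum>m<ns ! k. deform r ns \<alpha> (s, \<tau>) k m * y k m)
      = (\<Sum>m<ns ! k. \<Sum>j<ns ! k. a (block_start ns k + j) * newton s j m * y k m)"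
      using de[OF k] by (intro sum.cong refl) (simp add: sum_distrib_right)
    also have "\<dots> = (\<Sum>j<ns ! k. \<Sum>m<ns ! k. a (block_start ns k + j) * newton s j m * y k m)"
      by (rule sum.swap)
    also have "\<dots> = (\<Sum>j<ns ! k. eigen ns s y (block_start ns k + j) * a (block_start ns k + j))"
      using k by (intro sum.cong refl) (simp add: eigen_def loc_block_start sum_distrib_right sum_distrib_left mult_ac)
    finally show "(\<Sum>m<ns ! k. deform r ns \<alpha> (s, \<tau>) k m * y k m)
      = (\<Sum>j<ns ! k. eigen ns s y (block_start ns k + j) * a (block_start ns k + j))" .
  qed
  show ?thesis
  proof (rule that[OF s(2)])
    show "norm \<tau> < \<epsilon>" using t by (simp add: \<tau>_def)
    show "lin (\<lambda>m. lin (moment r ?N a) (pullback r ns s (single m 1))) (gop r ns s (deform r ns \<alpha> (s, \<tau>)) z0 g v) = 0"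
      if "valid r ns g" for g v
      by (rule solution_gop[OF rN a nonint z0 \<alpha> that])
    show "lin (moment r ?N a) (pullback r ns s (single 0 1)) \<noteq> 0"
      by (rule solution_0[OF rN a nonint z0])
  qed
qed

text \<open>A vanishing fibre involves finitely many relations only, hence excludes formal solutions
  with nonzero constant term for all nearby parameters, whereas such solutions exist arbitrarily
  close.\<close>

lemma fibre_nonzero:
  assumes z: "z \<in> generic_stratum r ns" and rN: "r + 1 < sum_list ns" and pos: "\<forall>n\<in>set ns. n \<ge> 1"
    and weight: "(\<Sum>k<length ns. \<alpha> k 0) = - of_nat r - 1"
  shows "\<exists>v\<in>gpol (cells r ns). \<forall>m. v \<notin> fibre_rel r ns \<alpha> (\<lambda>ip. z $$ ip) m"
proof (rule ccontr)
  assume "\<not> ?thesis"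
  then have "\<exists>m. v \<in> fibre_rel r ns \<alpha> (\<lambda>ip. z $$ ip) m" if "v \<in> gpol (cells r ns)" for v using that by blast
  from fibre_finite[OF z less_imp_le[OF rN] this] obtain m where
    m: "0 < m" "Pol (cells r ns) m \<subseteq> fibre_rel r ns \<alpha> (\<lambda>ip. z $$ ip) m" by blast
  have "Pol (cells r ns) m \<subseteq> fibre_rel r ns (deform r ns \<alpha> (0, 0)) (\<lambda>ip. z $$ ip) m"
    using m(2) by (simp add: deform_0)
  from no_nearby_solution[OF m(1) this continuous_deform] obtain \<epsilon> where
    \<epsilon>: "\<epsilon> > 0" "\<And>s \<tau> F z0. norm s < \<epsilon> \<Longrightarrow> norm \<tau> < \<epsilon> \<Longrightarrow>
       (\<And>g v. valid r ns g \<Longrightarrow> lin F (gop r ns s (deform r ns \<alpha> (s, \<tau>)) z0 g v) = 0) \<Longrightarrow> F 0 = 0" by blast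
  from exists_nearby_solution[where \<alpha>=\<alpha>, OF \<epsilon>(1) rN pos weight] obtain s \<tau> F z0 where "norm s < \<epsilon>" "norm \<tau> < \<epsilon>"
    "\<And>g v. valid r ns g \<Longrightarrow> lin F (gop r ns s (deform r ns \<alpha> (s, \<tau>)) z0 g v) = 0" "F 0 \<noteq> 0" by blast
  then show False using \<epsilon>(2)[of s \<tau> F z0] by blast
qed

section \<open>Polynomial functions of matrices\<close>

text \<open>Coordinates are centred at \<open>z1\<close>, so that evaluation at \<open>z1\<close>
  reads off the constant coefficient; variables outside the matrix are sent to zero.\<close>

definition evm :: "nat \<Rightarrow> nat \<Rightarrow> complex mat \<Rightarrow> (nat \<times> nat) mpoly \<Rightarrow> complex mat \<Rightarrow> complex" where
  "evm nr nc z1 w z = peval (\<lambda>x. x) (\<lambda>x. if x \<in> {..<nr} \<times> {..<nc} then z $$ x - z1 $$ x else 0) w"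

lemma evm_simps:
  "evm nr nc z1 (u + v) z = evm nr nc z1 u z + evm nr nc z1 v z"
  "evm nr nc z1 (u * v) z = evm nr nc z1 u z * evm nr nc z1 v z"
  "evm nr nc z1 (u - v) z = evm nr nc z1 u z - evm nr nc z1 v z"
  "evm nr nc z1 (Con c) z = c"
  "evm nr nc z1 0 z = 0"
  "evm nr nc z1 (sum f A) z = (\<Sum>x\<in>A. evm nr nc z1 (f x) z)"
  by (simp_all add: evm_def peval_add[OF id_hom] peval_mult[OF id_hom] peval_diff[OF id_hom]
      peval_Con[OF id_hom] peval_0[OF id_hom] peval_sum[OF id_hom])

lemma evm_Var: "x \<in> {..<nr} \<times> {..<nc} \<Longrightarrow> evm nr nc z1 (Var x) z = z $$ x - z1 $$ x"
  by (simp add: evm_def peval_Var[OF id_hom])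

lemma evm_centre: "w \<in> gpol ({..<nr} \<times> {..<nc}) \<Longrightarrow> evm nr nc z1 w z1 = lookup w 0"
proof (induction w rule: mpoly_ginduct)
  case (Con c)
  show ?case by (simp add: evm_simps) (simp add: Con_def)
next
  case (Var x w)
  have nz: "single x 1 + m \<noteq> (0 :: nat \<times> nat \<Rightarrow>\<^sub>0 nat)" for m
    using mdeg_add[of "single x 1" m] by (metis add_is_0 mdeg_0 mdeg_single one_neq_zero)
  have "0 \<notin> keys (Var x * w)"
  proof
    assume "0 \<in> keys (Var x * w)"
    then have "0 \<in> {a + b |a b. a \<in> keys (Var x) \<and> b \<in> keys w}" using keys_mult by blast
    then show False using nz by (auto simp: Var_def)
  qed
  then have "lookup (Var x * w) 0 = 0" by (simp add: in_keys_iff)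
  then show ?case using Var(1) by (simp add: evm_simps evm_Var)
qed (simp_all add: evm_simps lookup_add)

lemma evm_poly_funs:
  "w \<in> gpol ({..<nr} \<times> {..<nc}) \<Longrightarrow> evm nr nc z1 w \<in> poly_funs (mat_coords nr nc)"
proof (induction w rule: mpoly_ginduct)
  case (Con c)
  have "evm nr nc z1 (Con c) = (\<lambda>_. c)" by (rule ext) (simp add: evm_simps)
  then show ?case using poly_funs.const by metis
next
  case (Var x w)
  have "(\<lambda>z. z $$ x) \<in> poly_funs (mat_coords nr nc)"
    using Var(1) by (intro poly_funs.coord) (cases x, auto simp: mat_coords_def)
  then have "(\<lambda>z. (z $$ x + - z1 $$ x) * evm nr nc z1 w z) \<in> poly_funs (mat_coords nr nc)"
    using Var(3) by (intro poly_funs.mult poly_funs.add poly_funs.const)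
  moreover have "evm nr nc z1 (Var x * w) = (\<lambda>z. (z $$ x + - z1 $$ x) * evm nr nc z1 w z)"
    using Var(1) by (intro ext) (simp add: evm_simps evm_Var)
  ultimately show ?case by simp
next
  case (add u v)
  have "evm nr nc z1 (u + v) = (\<lambda>z. evm nr nc z1 u z + evm nr nc z1 v z)" by (rule ext) (simp add: evm_simps)
  then show ?case using add poly_funs.add by metis
qed

lemma poly_funs_evm:
  assumes "p \<in> poly_funs (mat_coords nr nc)"
  shows "\<exists>w\<in>gpol ({..<nr} \<times> {..<nc}). \<forall>z. p z = evm nr nc z1 w z"
  using assms
proof (induction p rule: poly_funs.induct)
  case (const c)
  show ?case by (intro bexI[of _ "Con c"]) (auto simp: evm_simps)
next
  case (coord x)
  then obtain i p where x: "x = (\<lambda>z. z $$ (i, p))" "(i, p) \<in> {..<nr} \<times> {..<nc}" by (auto simp: mat_coords_def)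
  then show ?case
    by (intro bexI[of _ "Con (z1 $$ (i, p)) + Var (i, p)"]) (auto simp: evm_simps evm_Var intro!: gpol_add)
next
  case (add p q)
  then obtain u v where "u \<in> gpol ({..<nr} \<times> {..<nc})" "\<forall>z. p z = evm nr nc z1 u z"
    "v \<in> gpol ({..<nr} \<times> {..<nc})" "\<forall>z. q z = evm nr nc z1 v z" by blast
  then show ?case by (intro bexI[of _ "u + v"]) (auto simp: evm_simps gpol_add)
next
  case (mult p q)
  then obtain u v where "u \<in> gpol ({..<nr} \<times> {..<nc})" "\<forall>z. p z = evm nr nc z1 u z"
    "v \<in> gpol ({..<nr} \<times> {..<nc})" "\<forall>z. q z = evm nr nc z1 v z" by blast
  then show ?case by (intro bexI[of _ "u * v"]) (auto simp: evm_simps gpol_mult)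
qed

lemma upd_mat_carrier: "z \<in> carrier_mat nr nc \<Longrightarrow> upd_mat z i p t \<in> carrier_mat nr nc"
  by (auto simp: upd_mat_def)

lemma upd_mat_same: "upd_mat z i p (z $$ (i, p)) = z"
  by (rule eq_matI) (auto simp: upd_mat_def)

lemma upd_mat_index:
  "z \<in> carrier_mat nr nc \<Longrightarrow> x \<in> {..<nr} \<times> {..<nc} \<Longrightarrow> upd_mat z i p t $$ x = (if x = (i, p) then t else z $$ x)"
  by (cases x) (auto simp: upd_mat_def)

lemma evm_has_derivative:
  assumes z: "z \<in> carrier_mat nr nc" and ip: "(i, p) \<in> {..<nr} \<times> {..<nc}"
  shows "((\<lambda>t. evm nr nc z1 w (upd_mat z i p t)) has_field_derivative evm nr nc z1 (D (i, p) w) (upd_mat z i p t)) (at t)"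
proof (induction w rule: mpoly_induct)
  case (Con c)
  show ?case by (simp add: evm_simps)
next
  case (Var x w)
  let ?\<phi> = "\<lambda>t. evm nr nc z1 (Var x) (upd_mat z i p t)"
  have "(?\<phi> has_field_derivative (if x = (i, p) then 1 else 0)) (at t)"
  proof (cases "x \<in> {..<nr} \<times> {..<nc}")
    case True
    then have "?\<phi> = (\<lambda>t. (if x = (i, p) then t else z $$ x) - z1 $$ x)"
      using upd_mat_index[OF z True] by (simp add: evm_Var)
    then show ?thesis by (auto intro!: derivative_eq_intros)
  next
    case False
    then have "?\<phi> = (\<lambda>t. 0)" by (simp add: evm_def peval_Var[OF id_hom])
    then show ?thesis using False ip by auto
  qed
  moreover have "evm nr nc z1 (D (i, p) (Var x * w)) u
      = (if x = (i, p) then 1 else 0) * evm nr nc z1 w u + evm nr nc z1 (D (i, p) w) u * evm nr nc z1 (Var x) u" for u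
    by (auto simp: D_Var_mult evm_simps)
  ultimately show ?case unfolding evm_simps(2) using DERIV_mult[OF _ Var] by (simp only:)
next
  case (add u v)
  from DERIV_add[OF this] show ?case by (simp add: evm_simps D_add)
qed

lemma pdiff_evm:
  assumes "z \<in> carrier_mat nr nc" "(i, p) \<in> {..<nr} \<times> {..<nc}"
  shows "pdiff i p (evm nr nc z1 w) z = evm nr nc z1 (D (i, p) w) z"
  unfolding pdiff_def
  using DERIV_imp_deriv[OF evm_has_derivative[OF assms, of z1 w "z $$ (i, p)"]] by (simp add: upd_mat_same)

lemma pdiff_cong:
  assumes "z \<in> carrier_mat nr nc" "\<And>z. z \<in> carrier_mat nr nc \<Longrightarrow> f z = g z"
  shows "pdiff i p f z = pdiff i p g z"
  unfolding pdiff_def using assms upd_mat_carrier[OF assms(1)] by simp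

text \<open>Partial derivatives of the zero function vanish, so induction on the degree kills every
  derivative of \<open>u\<close>; the constant left over is the value at the centre.\<close>

lemma evm_inject:
  assumes "u \<in> gpol ({..<nr} \<times> {..<nc})" "\<And>z :: complex mat. z \<in> carrier_mat nr nc \<Longrightarrow> evm nr nc z1 u z = 0"
    and z1: "z1 \<in> carrier_mat nr nc"
  shows "u = 0"
proof -
  let ?G = "{..<nr} \<times> {..<nc}"
  obtain n where "u \<in> Pol ?G n" by (rule gpol_imp_Pol[OF assms(1)])
  then show ?thesis using assms(2)
  proof (induction n arbitrary: u)
    case 0
    then show ?case by (simp add: Pol_Zero_iff)
  next
    case (Suc n)
    have "D x u = 0" if x: "x \<in> ?G" for x
    proof (rule Suc.IH)
      show "D x u \<in> Pol ?G n" by (rule Pol_D[OF Suc.prems(1)])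
      fix z :: "complex mat" assume z: "z \<in> carrier_mat nr nc"
      obtain i p where ip: "x = (i, p)" by force
      have "pdiff i p (evm nr nc z1 u) z = pdiff i p (\<lambda>_. 0) z"
        by (rule pdiff_cong[OF z]) (rule Suc.prems(2))
      then show "evm nr nc z1 (D x u) z = 0" using pdiff_evm[OF z, of i p z1 u] x ip by (simp add: pdiff_def)
    qed
    then have "lookup u (m + single x 1) = 0" if "x \<in> ?G" for m x
      using that lookup_D[of x u m] by (metis lookup_zero mult_eq_0_iff of_nat_eq_0_iff add_is_0 one_neq_zero)
    moreover have "lookup u 0 = 0"
      using evm_centre[OF Pol_gpol[OF Suc.prems(1)], of z1] Suc.prems(2)[OF z1] by simp
    ultimately have "lookup u m = 0" for m
    proof (cases "m = 0")
      case False
      then obtain x m' where m: "m = single x 1 + m'" "x \<in> keys m" by (rule monom_split)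
      show ?thesis
      proof (cases "x \<in> ?G")
        case True
        then show ?thesis using \<open>\<And>x m. x \<in> ?G \<Longrightarrow> lookup u (m + single x 1) = 0\<close> m(1) by (metis add.commute)
      next
        case False
        then have "m \<notin> keys u" using Suc.prems(1) m(2) by (auto simp: Pol_def mons_def)
        then show ?thesis by (simp add: in_keys_iff)
      qed
    qed simp
    then show ?case by (intro poly_mapping_eqI) simp
  qed
qed

definition Dmulti :: "nat \<Rightarrow> nat \<Rightarrow> multi_index \<Rightarrow> (nat \<times> nat) mpoly \<Rightarrow> (nat \<times> nat) mpoly" where
  "Dmulti nr nc \<beta> w = foldr (\<lambda>x. D x ^^ \<beta> x) (List.product [0..<nr] [0..<nc]) w"

lemma mi_diff_evm:
  assumes f: "\<And>z. z \<in> carrier_mat nr nc \<Longrightarrow> f z = evm nr nc z1 w z" and z: "z \<in> carrier_mat nr nc"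
  shows "mi_diff nr nc \<beta> f z = evm nr nc z1 (Dmulti nr nc \<beta> w) z"
proof -
  have pow: "(pdiff i p ^^ n) f z = evm nr nc z1 ((D (i, p) ^^ n) w) z"
    if "(i, p) \<in> {..<nr} \<times> {..<nc}" "\<And>z. z \<in> carrier_mat nr nc \<Longrightarrow> f z = evm nr nc z1 w z" "z \<in> carrier_mat nr nc"
    for i p n f w z
    using that(3)
  proof (induction n arbitrary: z)
    case (Suc n)
    have "pdiff i p ((pdiff i p ^^ n) f) z = pdiff i p (evm nr nc z1 ((D (i, p) ^^ n) w)) z"
      by (rule pdiff_cong[OF Suc.prems]) (rule Suc.IH)
    then show ?case using pdiff_evm[OF Suc.prems that(1)] by simp
  qed (use that(2) in auto)
  have "foldr (\<lambda>(i, p). pdiff i p ^^ \<beta> (i, p)) xs f z = evm nr nc z1 (foldr (\<lambda>x. D x ^^ \<beta> x) xs w) z"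
    if "set xs \<subseteq> {..<nr} \<times> {..<nc}" "z \<in> carrier_mat nr nc" for xs z
    using that
  proof (induction xs arbitrary: z)
    case (Cons x xs)
    obtain i p where x: "x = (i, p)" by force
    have "(pdiff i p ^^ \<beta> (i, p)) (foldr (\<lambda>(i, p). pdiff i p ^^ \<beta> (i, p)) xs f) z
       = evm nr nc z1 ((D (i, p) ^^ \<beta> (i, p)) (foldr (\<lambda>x. D x ^^ \<beta> x) xs w)) z"
      by (rule pow) (use Cons x in auto)
    then show ?case by (simp add: x)
  qed (use f in auto)
  from this[of "List.product [0..<nr] [0..<nc]"] z show ?thesis
    unfolding mi_diff_def Dmulti_def by (simp add: lessThan_atLeast0)
qed

definition adjointable :: "'v set \<Rightarrow> ('v mpoly \<Rightarrow> 'v mpoly) \<Rightarrow> bool" where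
  "adjointable G T \<longleftrightarrow> (\<exists>A. (\<forall>v w. pr v (T w) = pr (A v) w) \<and> (\<forall>v\<in>gpol G. A v \<in> gpol G))"

lemma adjointable_D: "x \<in> G \<Longrightarrow> adjointable G (D x)"
  unfolding adjointable_def
  by (intro exI[of _ "\<lambda>v. Var x * v"]) (simp add: pr_Var_left gpol_mult)

lemma adjointable_id: "adjointable G (\<lambda>w. w)"
  unfolding adjointable_def by (intro exI[of _ "\<lambda>v. v"]) simp

lemma adjointable_comp: assumes "adjointable G S" "adjointable G T" shows "adjointable G (\<lambda>w. S (T w))"
proof -
  obtain A B where "\<And>v w. pr v (S w) = pr (A v) w" "\<And>v. v \<in> gpol G \<Longrightarrow> A v \<in> gpol G"
    "\<And>v w. pr v (T w) = pr (B v) w" "\<And>v. v \<in> gpol G \<Longrightarrow> B v \<in> gpol G"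
    using assms unfolding adjointable_def by blast
  then show ?thesis unfolding adjointable_def by (intro exI[of _ "\<lambda>v. B (A v)"]) simp
qed

lemma adjointable_funpow: "adjointable G T \<Longrightarrow> adjointable G (T ^^ n)"
proof (induction n)
  case 0
  then show ?case using adjointable_id[of G] by (simp add: id_def)
next
  case (Suc n)
  then show ?case using adjointable_comp[of G T "T ^^ n"] by (simp add: o_def)
qed

lemma adjointable_Dmulti: "adjointable ({..<nr} \<times> {..<nc}) (Dmulti nr nc \<beta>)"
proof -
  have "adjointable G (foldr (\<lambda>x. D x ^^ \<beta> x) xs)" if "set xs \<subseteq> G" for xs :: "(nat \<times> nat) list" and G
    using that
  proof (induction xs)
    case Nil
    then show ?case using adjointable_id[of G] by (simp add: id_def)
  next
    case (Cons x xs)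
    have "adjointable G (D x ^^ \<beta> x)" using Cons.prems by (intro adjointable_funpow adjointable_D) simp
    from adjointable_comp[OF this, of "foldr (\<lambda>x. D x ^^ \<beta> x) xs"] Cons
    show ?case by (simp add: case_prod_unfold o_def)
  qed
  from this[of "List.product [0..<nr] [0..<nc]" "{..<nr} \<times> {..<nc}"] show ?thesis
    by (simp add: Dmulti_def[abs_def] lessThan_atLeast0)
qed

lemma gpol_funpow_D: "w \<in> gpol G \<Longrightarrow> (D x ^^ n) w \<in> gpol G"
  by (induction n) (auto intro: gpol_D)

lemma gpol_Dmulti: "w \<in> gpol G \<Longrightarrow> Dmulti nr nc \<beta> w \<in> gpol G"
proof -
  assume w: "w \<in> gpol G"
  have "foldr (\<lambda>x. D x ^^ \<beta> x) xs w \<in> gpol G" for xs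
    using w by (induction xs) (auto intro: gpol_funpow_D)
  then show ?thesis by (simp add: Dmulti_def)
qed

text \<open>The generator itself, before transposition, in coordinates centred at \<open>z\<close>:
  the coordinate of cell \<open>b\<close> is \<open>Con (z b) + Var b\<close>.\<close>

fun weyl :: "nat \<Rightarrow> nat list \<Rightarrow> (nat \<Rightarrow> nat \<Rightarrow> complex) \<Rightarrow> (nat \<times> nat \<Rightarrow> complex) \<Rightarrow> gen \<Rightarrow>
    (nat \<times> nat) mpoly \<Rightarrow> (nat \<times> nat) mpoly" where
  "weyl r ns \<alpha> z (Minor i j p q) w = D (i, p) (D (j, q) w) - D (i, q) (D (j, p) w)"
| "weyl r ns \<alpha> z g w = (\<Sum>a\<in>cells r ns. \<Sum>b\<in>cells r ns. Con (tens ns 0 g a b) * ((Con (z b) + Var b) * D a w))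
     + Con (cst r ns \<alpha> g) * w"

text \<open>Transposition exchanges variables and derivations and reverses products, which is why
  \<open>first_order\<close> has \<open>Var a\<close> outside \<open>D b\<close>.\<close>

lemma weyl_adjoint: "pr v (weyl r ns \<alpha> z g w) = pr (gop r ns 0 \<alpha> z g v) w"
proof -
  have fo: "pr v ((\<Sum>a\<in>G. \<Sum>b\<in>G. Con (L a b) * ((Con (z b) + Var b) * D a w)) + Con c * w)
    = pr (first_order G z L c v) w" for G :: "(nat \<times> nat) set" and L c
    unfolding first_order_def
    by (simp add: pr_add_right pr_add_left pr_sum_right pr_sum_left pr_Con_right pr_Con_left distrib_right
        pr_Var_right pr_Var_left)
  show ?thesis
  proof (cases g)
    case (Minor i j p q)
    then show ?thesis
      by (simp add: pr_diff_right pr_diff_left left_diff_distrib mult.assoc pr_Var_left D_comm)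
  qed (simp_all only: weyl.simps gop.simps fo)
qed

lemma gpol_weyl: "w \<in> gpol (cells r ns) \<Longrightarrow> weyl r ns \<alpha> z g w \<in> gpol (cells r ns)"
  by (cases g) (auto intro!: gpol_add gpol_sum gpol_mult gpol_D gpol_diff)

section \<open>Matrix entries of the block algebra and the generators as operators on
  functions\<close>

lemma dim_jordan_elem [simp]: "dim_row (jordan_elem n y) = n" "dim_col (jordan_elem n y) = n"
  by (simp_all add: jordan_elem_def)

lemma shift_mat_power:
  "shift_mat n ^\<^sub>m j \<in> carrier_mat n n \<and> (\<forall>a<n. \<forall>b<n. (shift_mat n ^\<^sub>m j) $$ (a, b) = (if b = a + j then 1 else 0))"
proof (induction j)
  case (Suc j)
  have c: "shift_mat n \<in> carrier_mat n n" by (simp add: shift_mat_def)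
  have "(shift_mat n ^\<^sub>m j * shift_mat n) $$ (a, b) = (if b = a + Suc j then 1 else 0)" if ab: "a < n" "b < n" for a b
  proof -
    have "(shift_mat n ^\<^sub>m j * shift_mat n) $$ (a, b) = (\<Sum>c = 0..<n. (shift_mat n ^\<^sub>m j) $$ (a, c) * shift_mat n $$ (c, b))"
      using ab Suc c by (simp add: scalar_prod_def)
    also have "\<dots> = (\<Sum>c = 0..<n. if c = a + j then (if b = a + Suc j then 1 else 0) else 0)"
      using ab Suc by (intro sum.cong refl) (auto simp: shift_mat_def)
    finally show ?thesis using ab by auto
  qed
  moreover have "shift_mat n ^\<^sub>m j * shift_mat n \<in> carrier_mat n n"
    using Suc c by (intro mult_carrier_mat[of _ n n]) auto
  ultimately show ?case unfolding pow_mat.simps by blast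
qed (simp add: shift_mat_def)

lemma jordan_elem_index:
  "a < n \<Longrightarrow> b < n \<Longrightarrow> jordan_elem n y $$ (a, b) = (\<Sum>j<n. y j * newton_mult 0 j a b)"
  using shift_mat_power[of n] by (simp add: jordan_elem_def newton_mult_0)

lemma diag_block_index:
  assumes "q < sum_list ns" "p < sum_list ns"
  shows "diag_block_mat (map (\<lambda>k. jordan_elem (ns ! k) (x k)) [0..<length ns]) $$ (q, p) =
    (if fst (loc ns q) = fst (loc ns p)
     then jordan_elem (ns ! fst (loc ns q)) (x (fst (loc ns q))) $$ (snd (loc ns q), snd (loc ns p)) else 0)"
  using assms
proof (induction ns arbitrary: x q p)
  case (Cons n ns)
  let ?B = "diag_block_mat (map (\<lambda>k. jordan_elem (ns ! k) (x (Suc k))) [0..<length ns])"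
  have "map (\<lambda>k. jordan_elem ((n # ns) ! k) (x k)) [0..<length (n # ns)]
     = jordan_elem n (x 0) # map (\<lambda>k. jordan_elem (ns ! k) (x (Suc k))) [0..<length ns]"
    by (simp add: upt_conv_Cons map_Suc_upt[symmetric] del: upt_Suc)
  moreover have "dim_row ?B = sum_list ns" "dim_col ?B = sum_list ns"
  proof -
    have "map (\<lambda>k. ns ! k) [0..<length ns] = ns" by (rule map_nth)
    then show "dim_row ?B = sum_list ns" "dim_col ?B = sum_list ns"
      by (simp_all add: dim_diag_block_mat o_def)
  qed
  ultimately have "diag_block_mat (map (\<lambda>k. jordan_elem ((n # ns) ! k) (x k)) [0..<length (n # ns)]) $$ (q, p)
    = (if q < n then (if p < n then jordan_elem n (x 0) $$ (q, p) else 0) else if p < n then 0 else ?B $$ (q - n, p - n))"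
    using Cons.prems by (auto simp: Let_def index_mat_four_block)
  then show ?case using Cons.prems Cons.IH[of "q - n" "p - n" "\<lambda>k. x (Suc k)"] by auto
qed simp

lemma h_elem_index:
  assumes "q < sum_list ns" "p < sum_list ns"
  shows "h_elem ns x $$ (q, p) = hmat ns 0 x q p"
  using loc_inverse[OF assms(1)] loc_inverse[OF assms(2)]
  by (auto simp: h_elem_def diag_block_index[OF assms] hmat_def jordan_elem_index)

lemma h_elem_carrier: "h_elem ns x \<in> carrier_mat (sum_list ns) (sum_list ns)"
proof -
  have "map (\<lambda>k. ns ! k) [0..<length ns] = ns" by (rule map_nth)
  then show ?thesis by (intro carrier_matI) (simp_all add: h_elem_def dim_diag_block_mat o_def)
qed

lemma trace_coeff_Tor:
  assumes z: "z \<in> carrier_mat (r + 1) (sum_list ns)" and ip: "i < r + 1" "p < sum_list ns"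
  shows "(z * h_elem ns x) $$ (i, p) = (\<Sum>b\<in>cells r ns. tens ns 0 (Tor x) (i, p) b * z $$ b)"
proof -
  have "(\<Sum>b\<in>cells r ns. tens ns 0 (Tor x) (i, p) b * z $$ b)
      = (\<Sum>i'<r + 1. if i' = i then \<Sum>q<sum_list ns. hmat ns 0 x q p * z $$ (i, q) else 0)"
    unfolding sum_cells by (intro sum.cong refl) auto
  also have "\<dots> = (\<Sum>q<sum_list ns. h_elem ns x $$ (q, p) * z $$ (i, q))"
    using ip by (simp add: h_elem_index)
  finally show ?thesis
    using z ip h_elem_carrier[of ns x] by (simp add: scalar_prod_def lessThan_atLeast0 mult.commute)
qed

lemma trace_coeff_Row:
  assumes z: "z \<in> carrier_mat (r + 1) (sum_list ns)" and Y: "Y \<in> carrier_mat (r + 1) (r + 1)"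
    and ip: "i < r + 1" "p < sum_list ns"
  shows "(Y * z) $$ (i, p) = (\<Sum>b\<in>cells r ns. tens ns 0 (Row Y) (i, p) b * z $$ b)"
proof -
  have "(\<Sum>b\<in>cells r ns. tens ns 0 (Row Y) (i, p) b * z $$ b)
      = (\<Sum>j<r + 1. \<Sum>q<sum_list ns. if q = p then Y $$ (i, j) * z $$ (j, p) else 0)"
    unfolding sum_cells by (intro sum.cong refl) auto
  then show ?thesis
    using z Y ip by (simp add: scalar_prod_def lessThan_atLeast0 del: sum.lessThan_Suc)
qed

definition fun_first_order :: "nat \<Rightarrow> nat list \<Rightarrow> (nat \<Rightarrow> nat \<Rightarrow> complex) \<Rightarrow> gen \<Rightarrow> fun_op" where
  "fun_first_order r ns \<alpha> g f z =
     (\<Sum>a\<in>cells r ns. (\<Sum>b\<in>cells r ns. tens ns 0 g a b * z $$ b) * pdiff (fst a) (snd a) f z) + cst r ns \<alpha> g * f z"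

lemma hg_operator_Tor:
  assumes z: "z \<in> carrier_mat (r + 1) (sum_list ns)"
  shows "trace_diff (r + 1) (sum_list ns) (\<lambda>z. z * h_elem ns x) f z - h_char ns \<alpha> x * f z
    = fun_first_order r ns \<alpha> (Tor x) f z"
  unfolding fun_first_order_def trace_diff_def
  by (subst sum_cells, simp del: sum.lessThan_Suc tens.simps)
     (intro sum.cong refl, simp add: trace_coeff_Tor[OF z] del: tens.simps)

lemma hg_operator_Row:
  assumes z: "z \<in> carrier_mat (r + 1) (sum_list ns)" and Y: "Y \<in> carrier_mat (r + 1) (r + 1)"
  shows "trace_diff (r + 1) (sum_list ns) (\<lambda>z. Y * z) f z + (\<Sum>i<r + 1. Y $$ (i, i)) * f z
    = fun_first_order r ns \<alpha> (Row Y) f z"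
  unfolding fun_first_order_def trace_diff_def
  by (subst sum_cells, simp del: sum.lessThan_Suc tens.simps)
     (intro sum.cong refl, simp add: trace_coeff_Row[OF z Y] del: tens.simps)

lemma hg_operator_cases:
  assumes "P \<in> hg_operators r ns \<alpha>"
  obtains (minor) i j p q where "valid r ns (Minor i j p q)"
      "\<And>f z. P f z = pdiff i p (pdiff j q f) z - pdiff i q (pdiff j p f) z"
  | (tor) x where "\<And>f z. z \<in> carrier_mat (r + 1) (sum_list ns) \<Longrightarrow> P f z = fun_first_order r ns \<alpha> (Tor x) f z"
  | (row) Y where "Y \<in> carrier_mat (r + 1) (r + 1)"
      "\<And>f z. z \<in> carrier_mat (r + 1) (sum_list ns) \<Longrightarrow> P f z = fun_first_order r ns \<alpha> (Row Y) f z"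
proof -
  consider i j p q where "P = (\<lambda>f z. pdiff i p (pdiff j q f) z - pdiff i q (pdiff j p f) z)"
      "i \<le> r" "j \<le> r" "p < sum_list ns" "q < sum_list ns"
    | x where "P = (\<lambda>f z. trace_diff (r + 1) (sum_list ns) (\<lambda>z. z * h_elem ns x) f z - h_char ns \<alpha> x * f z)"
    | Y where "P = (\<lambda>f z. trace_diff (r + 1) (sum_list ns) (\<lambda>z. Y * z) f z + (\<Sum>i<r + 1. Y $$ (i, i)) * f z)"
      "Y \<in> carrier_mat (r + 1) (r + 1)"
    using assms unfolding hg_operators_def by blast
  then show ?thesis
  proof cases
    case (1 i j p q)
    then show ?thesis by (intro minor[of i j p q]) auto
  next
    case (2 x)
    then have "P f z = fun_first_order r ns \<alpha> (Tor x) f z" if "z \<in> carrier_mat (r + 1) (sum_list ns)" for f z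
      using hg_operator_Tor[OF that] by simp
    then show ?thesis by (rule tor)
  next
    case (3 Y)
    then have "P f z = fun_first_order r ns \<alpha> (Row Y) f z" if "z \<in> carrier_mat (r + 1) (sum_list ns)" for f z
      using hg_operator_Row[OF that 3(2)] by simp
    then show ?thesis by (rule row[OF 3(2)])
  qed
qed

lemma fun_first_order_evm:
  assumes z: "z \<in> carrier_mat (r + 1) (sum_list ns)" and g: "\<And>i j p q. g \<noteq> Minor i j p q"
  shows "fun_first_order r ns \<alpha> g (evm (r + 1) (sum_list ns) z1 w) z
    = evm (r + 1) (sum_list ns) z1 (weyl r ns \<alpha> (\<lambda>ip. z1 $$ ip) g w) z"
proof -
  let ?e = "evm (r + 1) (sum_list ns) z1"
  have pd: "pdiff (fst a) (snd a) (?e w) z = ?e (D a w) z" if "a \<in> cells r ns" for a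
    using pdiff_evm[OF z, of "fst a" "snd a" z1 w] that by (cases a) (simp add: cells_def)
  have "fun_first_order r ns \<alpha> g (?e w) z =
     (\<Sum>a\<in>cells r ns. \<Sum>b\<in>cells r ns. tens ns 0 g a b * (z $$ b * ?e (D a w) z)) + cst r ns \<alpha> g * ?e w z"
    unfolding fun_first_order_def
    by (rule arg_cong2[of _ _ _ _ "(+)"], rule sum.cong[OF refl])
       (simp_all only: pd sum_distrib_right mult.assoc)
  also have "\<dots> = ?e ((\<Sum>a\<in>cells r ns. \<Sum>b\<in>cells r ns. Con (tens ns 0 g a b) * ((Con (z1 $$ b) + Var b) * D a w))
     + Con (cst r ns \<alpha> g) * w) z"
    unfolding evm_simps
    by (intro arg_cong2[of _ _ _ _ "(+)"] sum.cong refl) (simp add: evm_Var cells_def)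
  also have "\<dots> = ?e (weyl r ns \<alpha> (\<lambda>ip. z1 $$ ip) g w) z"
    using g by (cases g) auto
  finally show ?thesis .
qed

lemma hg_operator_evm:
  assumes "P \<in> hg_operators r ns \<alpha>"
  shows "\<exists>g. valid r ns g \<and> (\<forall>w. \<forall>z\<in>carrier_mat (r + 1) (sum_list ns).
    P (evm (r + 1) (sum_list ns) z1 w) z = evm (r + 1) (sum_list ns) z1 (weyl r ns \<alpha> (\<lambda>ip. z1 $$ ip) g w) z)"
  using assms
proof (cases rule: hg_operator_cases)
  case (minor i j p q)
  let ?e = "evm (r + 1) (sum_list ns) z1"
  have in_G: "(i, p) \<in> {..<r + 1} \<times> {..<sum_list ns}" "(j, q) \<in> {..<r + 1} \<times> {..<sum_list ns}"
     "(i, q) \<in> {..<r + 1} \<times> {..<sum_list ns}" "(j, p) \<in> {..<r + 1} \<times> {..<sum_list ns}" using minor(1) by auto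
  have "pdiff a b (pdiff c d (?e w)) z = ?e (D (a, b) (D (c, d) w)) z"
    if "z \<in> carrier_mat (r + 1) (sum_list ns)" "(a, b) \<in> {..<r + 1} \<times> {..<sum_list ns}"
      "(c, d) \<in> {..<r + 1} \<times> {..<sum_list ns}" for a b c d w z
    using pdiff_cong[OF that(1), of "pdiff c d (?e w)" "?e (D (c, d) w)"] pdiff_evm[OF _ that(3)] pdiff_evm[OF that(1,2)]
    by simp
  then show ?thesis using minor in_G by (intro exI[of _ "Minor i j p q"]) (auto simp: evm_simps)
next
  case (tor x)
  then show ?thesis using fun_first_order_evm[of _ r ns "Tor x" \<alpha> z1]
    by (intro exI[of _ "Tor x"]) auto
next
  case (row Y)
  then show ?thesis using fun_first_order_evm[of _ r ns "Row Y" \<alpha> z1]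
    by (intro exI[of _ "Row Y"]) auto
qed

section \<open>Multiplication operators in the ideal\<close>

lemma clear_denominators:
  assumes "finite C" "\<And>c. c \<in> C \<Longrightarrow> regular_on nr nc V c" "z1 \<in> V"
  shows "\<exists>Q\<in>poly_funs (mat_coords nr nc). Q z1 \<noteq> 0 \<and>
    (\<forall>c\<in>C. \<exists>p\<in>poly_funs (mat_coords nr nc). \<forall>z\<in>V. Q z * c z = p z)"
  using assms(1,2)
proof (induction C rule: finite_induct)
  case empty
  show ?case by (intro bexI[of _ "\<lambda>_. 1"]) (auto intro: poly_funs.const)
next
  case (insert c C)
  then obtain Q where Q: "Q \<in> poly_funs (mat_coords nr nc)" "Q z1 \<noteq> 0"
    "\<And>c. c \<in> C \<Longrightarrow> \<exists>p\<in>poly_funs (mat_coords nr nc). \<forall>z\<in>V. Q z * c z = p z" by auto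
  obtain p q where pq: "p \<in> poly_funs (mat_coords nr nc)" "q \<in> poly_funs (mat_coords nr nc)" "q z1 \<noteq> 0"
    "\<forall>w\<in>V. q w \<noteq> 0 \<longrightarrow> c w = p w / q w"
    using insert.prems[of c] assms(3) unfolding regular_on_def by blast
  \<comment> \<open>The square of \<open>q\<close> makes the identity hold also where
    \<open>q\<close> vanishes and the quotient says nothing about \<open>c\<close>.\<close>
  let ?Q = "\<lambda>z. Q z * (q z * q z)"
  have "\<exists>p'\<in>poly_funs (mat_coords nr nc). \<forall>z\<in>V. ?Q z * c' z = p' z" if c': "c' \<in> insert c C" for c'
  proof (cases "c' = c")
    case True
    have "?Q z * c z = Q z * (q z * p z)" if "z \<in> V" for z
      using pq(4) that by (cases "q z = 0") auto
    then show ?thesis unfolding True using Q(1) pq(1,2)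
      by (intro bexI[of _ "\<lambda>z. Q z * (q z * p z)"]) (auto intro!: poly_funs.mult)
  next
    case False
    then obtain p' where "p' \<in> poly_funs (mat_coords nr nc)" "\<forall>z\<in>V. Q z * c' z = p' z" using Q(3) c' by blast
    then show ?thesis using pq(2)
      by (intro bexI[of _ "\<lambda>z. (q z * q z) * p' z"]) (auto intro!: poly_funs.mult simp: mult_ac)
  qed
  then show ?case using Q(1,2) pq(2,3) by (intro bexI[of _ ?Q]) (auto intro!: poly_funs.mult)
qed

lemma mi_diff_0: "mi_diff nr nc (\<lambda>_. 0) f = f"
proof -
  have "foldr (\<lambda>(i, p). pdiff i p ^^ 0) xs f = f" for xs :: "(nat \<times> nat) list"
    by (induction xs) auto
  then show ?thesis by (simp add: mi_diff_def)
qed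

lemma regular_on_poly: "p \<in> poly_funs (mat_coords nr nc) \<Longrightarrow> regular_on nr nc V p"
  unfolding regular_on_def by (intro ballI bexI[of _ p] bexI[of _ "\<lambda>_. 1"]) (auto intro: poly_funs.const)

lemma pr_sum_list_right: "pr v (\<Sum>x\<leftarrow>L. f x) = (\<Sum>x\<leftarrow>L. pr v (f x))"
  by (induction L) (simp_all add: pr_add_right, simp add: pr_comm[of v 0])

lemma pr_sum_list_left: "pr (\<Sum>x\<leftarrow>L. f x) w = (\<Sum>x\<leftarrow>L. pr (f x) w)"
  by (induction L) (simp_all add: pr_add_left)

lemma evm_sum_list: "evm nr nc z1 (\<Sum>x\<leftarrow>L. f x) z = (\<Sum>x\<leftarrow>L. evm nr nc z1 (f x) z)"
  by (induction L) (simp_all add: evm_simps)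

lemma gpol_sum_list: "(\<And>x. x \<in> set L \<Longrightarrow> f x \<in> gpol G) \<Longrightarrow> (\<Sum>x\<leftarrow>L. f x) \<in> gpol G"
  by (induction L) (auto intro: gpol_add)

lemma sum_list_cong: "(\<And>x. x \<in> set L \<Longrightarrow> f x = g x) \<Longrightarrow> (\<Sum>x\<leftarrow>L. f x) = (\<Sum>x\<leftarrow>L. g x)"
  by (induction L) auto

lemma gpol_gop: "valid r ns g \<Longrightarrow> v \<in> gpol (cells r ns) \<Longrightarrow> gop r ns s \<alpha> z g v \<in> gpol (cells r ns)"
  using Pol_gpol[OF Pol_gop] gpol_imp_Pol by metis

text \<open>With denominators cleared, an operator of order zero in the ideal becomes multiplication
  by a polynomial \<open>h\<close>. Its transpose sends every polynomial into the relations of the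
  fibre at \<open>z1\<close>, and it is \<open>h(z1)\<close> plus a map that lowers degrees. If
  \<open>h(z1)\<close> were nonzero, every polynomial would be a relation, against
  \<open>fibre_nonzero\<close>.\<close>

lemma multiplication_operator_vanishes:
  assumes V: "openin (zar_mat (r + 1) (sum_list ns)) V" "z1 \<in> V"
    and a: "a \<in> left_span (r + 1) (sum_list ns) (hg_operators r ns \<alpha>) V" "coeff_supp V a \<subseteq> {\<lambda>_. 0}"
    and z1: "z1 \<in> generic_stratum r ns" and rN: "r + 1 < sum_list ns" and pos: "\<forall>n\<in>set ns. n \<ge> 1"
    and weight: "(\<Sum>k<length ns. \<alpha> k 0) = - of_nat r - 1"
  shows "a (\<lambda>_. 0) z1 = 0"
proof (rule ccontr)
  assume nz: "a (\<lambda>_. 0) z1 \<noteq> 0"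
  let ?nr = "r + 1" and ?nc = "sum_list ns" and ?G = "cells r ns"
  let ?PF = "poly_funs (mat_coords ?nr ?nc)" and ?e = "evm ?nr ?nc z1" and ?z = "\<lambda>ip. z1 $$ ip"
  have G: "?G = {..<?nr} \<times> {..<?nc}" by (simp add: cells_def)
  have z1c: "z1 \<in> carrier_mat ?nr ?nc" using z1 by (simp add: generic_stratum_def)
  obtain S where S: "S \<subseteq> ?PF" "V = {x \<in> carrier_mat ?nr ?nc. \<exists>p\<in>S. p x \<noteq> 0}"
    using V(1) unfolding openin_zariski by blast
  \<comment> \<open>Multiplication by \<open>s\<close> extends identities from \<open>V\<close> to
    all matrices, since \<open>s\<close> vanishes off \<open>V\<close>.\<close>
  obtain s where s: "s \<in> ?PF" "s z1 \<noteq> 0" "\<And>z. z \<in> carrier_mat ?nr ?nc \<Longrightarrow> s z \<noteq> 0 \<Longrightarrow> z \<in> V"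
    using V(2) S by blast
  have supp: "coeff_supp V a = {\<lambda>_. 0}" using a(2) nz V(2) by (auto simp: coeff_supp_def)
  obtain L where L: "set L \<subseteq> diff_ops ?nr ?nc V \<times> hg_operators r ns \<alpha>"
    "\<And>f z. regular_on ?nr ?nc V f \<Longrightarrow> z \<in> V \<Longrightarrow>
       act ?nr ?nc V a f z = (\<Sum>(b, P)\<leftarrow>L. act ?nr ?nc V b (P f) z)"
    using a(1) unfolding left_span_def by blast
  define C where "C = insert (a (\<lambda>_. 0)) (\<Union>(b, P)\<in>set L. b ` coeff_supp V b)"
  have "a \<in> diff_ops ?nr ?nc V" using a(1) by (simp add: left_span_def)
  then have regC: "regular_on ?nr ?nc V c" if "c \<in> C" for c
    using that L(1) by (auto simp: C_def diff_ops_def)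
  have finC: "finite C" using L(1) by (auto simp: C_def diff_ops_def)
  obtain Q where Q: "Q \<in> ?PF" "Q z1 \<noteq> 0" "\<And>c. c \<in> C \<Longrightarrow> \<exists>p\<in>?PF. \<forall>z\<in>V. Q z * c z = p z"
    using clear_denominators[OF finC regC V(2)] by auto
  have "\<exists>w. w \<in> gpol ?G \<and> (\<forall>z\<in>V. s z * (Q z * c z) = ?e w z) \<and> (\<forall>z. s z = 0 \<longrightarrow> ?e w z = 0)" if c: "c \<in> C" for c
  proof -
    obtain p where p: "p \<in> ?PF" "\<forall>z\<in>V. Q z * c z = p z" using Q(3)[OF c] by blast
    obtain w where "w \<in> gpol ?G" "\<forall>z. s z * p z = ?e w z"
      using poly_funs_evm[OF poly_funs.mult[OF s(1) p(1)], of z1] unfolding G by blast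
    then show ?thesis using p(2) by (metis mult_zero_left)
  qed
  then have "\<forall>c\<in>C. \<exists>w. w \<in> gpol ?G \<and> (\<forall>z\<in>V. s z * (Q z * c z) = ?e w z) \<and> (\<forall>z. s z = 0 \<longrightarrow> ?e w z = 0)" by blast
  from bchoice[OF this] obtain W where
    W: "\<forall>c\<in>C. W c \<in> gpol ?G \<and> (\<forall>z\<in>V. s z * (Q z * c z) = ?e (W c) z) \<and> (\<forall>z. s z = 0 \<longrightarrow> ?e (W c) z = 0)" by blast
  have "\<forall>P\<in>hg_operators r ns \<alpha>. \<exists>g. valid r ns g \<and> (\<forall>w. \<forall>z\<in>carrier_mat ?nr ?nc. P (?e w) z = ?e (weyl r ns \<alpha> ?z g w) z)"
    using hg_operator_evm by blast
  from bchoice[OF this] obtain \<gamma> where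
    \<gamma>: "\<forall>P\<in>hg_operators r ns \<alpha>. valid r ns (\<gamma> P) \<and> (\<forall>w. \<forall>z\<in>carrier_mat ?nr ?nc. P (?e w) z = ?e (weyl r ns \<alpha> ?z (\<gamma> P) w) z)" by blast
  define h where "h = W (a (\<lambda>_. 0))"
  have hC: "a (\<lambda>_. 0) \<in> C" by (simp add: C_def)
  have h: "h \<in> gpol ?G" "lookup h 0 \<noteq> 0"
  proof -
    show "h \<in> gpol ?G" using W hC by (simp add: h_def)
    then have "lookup h 0 = s z1 * (Q z1 * a (\<lambda>_. 0) z1)"
      using evm_centre[of h ?nr ?nc z1] W hC V(2) unfolding G h_def by simp
    then show "lookup h 0 \<noteq> 0" using s(2) Q(2) nz by simp
  qed
  have LC: "b \<beta> \<in> C" if "(b, P) \<in> set L" "\<beta> \<in> coeff_supp V b" for b P \<beta>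
    using that by (force simp: C_def)
  define T where "T x w = (\<Sum>\<beta>\<in>coeff_supp V (fst x). W (fst x \<beta>) * Dmulti ?nr ?nc \<beta> (weyl r ns \<alpha> ?z (\<gamma> (snd x)) w))"
    for x :: "coeffs \<times> fun_op" and w
  have T_gpol: "T x w \<in> gpol ?G" if "x \<in> set L" "w \<in> gpol ?G" for x w
    unfolding T_def using that W LC[of "fst x" "snd x"]
    by (intro gpol_sum gpol_mult gpol_Dmulti gpol_weyl) auto
  \<comment> \<open>Checked as functions: trivially where \<open>s\<close> vanishes, elsewhere by
    membership in the left span. \<open>evm_inject\<close> then gives an identity of
    polynomials.\<close>
  have identity: "h * w = (\<Sum>x\<leftarrow>L. T x w)" if w: "w \<in> gpol ?G" for w
  proof -
    have "?e (h * w - (\<Sum>x\<leftarrow>L. T x w)) z = 0" if z: "z \<in> carrier_mat ?nr ?nc" for z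
    proof (cases "s z = 0")
      case True
      have "?e (T x w) z = 0" if "x \<in> set L" for x
        unfolding T_def evm_simps using True W LC[of "fst x" "snd x"] that
        by (intro sum.neutral) auto
      then have "(\<Sum>x\<leftarrow>L. ?e (T x w) z) = (\<Sum>x\<leftarrow>L. 0)" by (intro sum_list_cong)
      moreover have "?e h z = 0" using True W hC by (simp add: h_def)
      ultimately show ?thesis by (simp add: evm_simps evm_sum_list)
    next
      case False
      then have zV: "z \<in> V" using s(3) z by blast
      have reg: "regular_on ?nr ?nc V (?e w)"
        using w unfolding G by (intro regular_on_poly evm_poly_funs)
      have "?e h z = s z * (Q z * a (\<lambda>_. 0) z)" using W hC zV unfolding h_def by metis
      then have "?e h z * ?e w z = s z * Q z * act ?nr ?nc V a (?e w) z"
        by (simp add: act_def supp mi_diff_0 mult_ac)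
      also have "\<dots> = s z * Q z * (\<Sum>x\<leftarrow>L. act ?nr ?nc V (fst x) ((snd x) (?e w)) z)"
        unfolding L(2)[OF reg zV] by (simp add: case_prod_unfold)
      also have "\<dots> = (\<Sum>x\<leftarrow>L. s z * Q z * act ?nr ?nc V (fst x) ((snd x) (?e w)) z)"
        by (rule sum_list_const_mult[symmetric])
      also have "\<dots> = (\<Sum>x\<leftarrow>L. ?e (T x w) z)"
      proof (rule sum_list_cong)
        fix x assume x: "x \<in> set L"
        then have P: "snd x \<in> hg_operators r ns \<alpha>" using L(1) by auto
        have "mi_diff ?nr ?nc \<beta> ((snd x) (?e w)) z = ?e (Dmulti ?nr ?nc \<beta> (weyl r ns \<alpha> ?z (\<gamma> (snd x)) w)) z" for \<beta>
          by (rule mi_diff_evm[OF _ z]) (use \<gamma> P in auto)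
        moreover have "s z * Q z * fst x \<beta> z = ?e (W (fst x \<beta>)) z" if "\<beta> \<in> coeff_supp V (fst x)" for \<beta>
          using W LC[of "fst x" "snd x"] x that zV by (simp add: mult.assoc)
        ultimately show "s z * Q z * act ?nr ?nc V (fst x) ((snd x) (?e w)) z = ?e (T x w) z"
          unfolding act_def T_def evm_simps sum_distrib_left
          by (intro sum.cong refl) (simp add: mult.assoc[symmetric])
      qed
      finally show ?thesis by (simp add: evm_simps evm_sum_list)
    qed
    moreover have "h * w - (\<Sum>x\<leftarrow>L. T x w) \<in> gpol ?G"
      using w h(1) T_gpol by (intro gpol_diff gpol_mult gpol_sum_list)
    ultimately have "h * w - (\<Sum>x\<leftarrow>L. T x w) = 0"
      using z1c unfolding G by (intro evm_inject)
    then show ?thesis by simp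
  qed
  define I where "I = (\<Union>m. fibre_rel r ns \<alpha> ?z m)"
  have I_add: "u + v \<in> I" if uv: "u \<in> I" "v \<in> I" for u v
  proof -
    obtain m n where "u \<in> fibre_rel r ns \<alpha> ?z m" "v \<in> fibre_rel r ns \<alpha> ?z n" using uv by (auto simp: I_def)
    then have "u \<in> fibre_rel r ns \<alpha> ?z (max m n)" "v \<in> fibre_rel r ns \<alpha> ?z (max m n)"
      by - (rule subsetD[OF fibre_rel_mono, rotated], assumption, simp)+
    from fibre_rel_add[OF this] show ?thesis unfolding I_def by (rule UN_I[OF UNIV_I])
  qed
  have I_0: "0 \<in> I" using fibre_rel_0 by (auto simp: I_def)
  have I_Con: "Con c * u \<in> I" if "u \<in> I" for c u
    using that by (auto simp: I_def intro: fibre_rel_Con_mult)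
  have I_sum: "sum f A \<in> I" if "\<And>x. x \<in> A \<Longrightarrow> f x \<in> I" for f and A :: "multi_index set"
    using that by (induction A rule: infinite_finite_induct) (auto intro: I_add I_0)
  have I_sum_list: "(\<Sum>x\<leftarrow>K. f x) \<in> I" if "\<And>x. x \<in> set K \<Longrightarrow> f x \<in> I" for f and K :: "(coeffs \<times> fun_op) list"
    using that by (induction K) (auto intro: I_add I_0)
  have I_gop: "gop r ns 0 \<alpha> ?z g v \<in> I" if g: "valid r ns g" and v: "v \<in> gpol ?G" for g v
  proof -
    from gpol_imp_Pol[OF v] obtain k where "v \<in> Pol ?G k" by blast
    then show ?thesis unfolding I_def using fibre_rel_gop[OF g, of v k "k + gord g"] by blast
  qed
  obtain A where A: "\<And>v w. pr v (h * w) = pr (A v) w" "\<And>n v. v \<in> Pol ?G n \<Longrightarrow> A v \<in> Pol ?G n"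
    "\<And>n v. v \<in> Pol ?G (Suc n) \<Longrightarrow> A v - Con (lookup h 0) * v \<in> Pol ?G n"
    using mult_adjoint[OF h(1)] by blast
  \<comment> \<open>In each summand the generator acts first, so its transpose \<open>gop\<close>
    acts last and the values are relations.\<close>
  have "\<exists>T'. (\<forall>v w. pr v (T x w) = pr (T' v) w) \<and> (\<forall>v\<in>gpol ?G. T' v \<in> gpol ?G \<and> T' v \<in> I)" if x: "x \<in> set L" for x
  proof -
    have val: "valid r ns (\<gamma> (snd x))" using \<gamma> L(1) x by auto
    have "\<exists>T'. (\<forall>v w. pr v (W (fst x \<beta>) * Dmulti ?nr ?nc \<beta> (weyl r ns \<alpha> ?z (\<gamma> (snd x)) w)) = pr (T' v) w)
        \<and> (\<forall>v\<in>gpol ?G. T' v \<in> gpol ?G \<and> T' v \<in> I)" if \<beta>: "\<beta> \<in> coeff_supp V (fst x)" for \<beta>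
    proof -
      have "W (fst x \<beta>) \<in> gpol ?G" using W LC[of "fst x" "snd x"] x \<beta> by simp
      from mult_adjoint[OF this] obtain B where
        B: "\<And>v w. pr v (W (fst x \<beta>) * w) = pr (B v) w" "\<And>n v. v \<in> Pol ?G n \<Longrightarrow> B v \<in> Pol ?G n" by blast
      obtain E where E: "\<And>v w. pr v (Dmulti ?nr ?nc \<beta> w) = pr (E v) w" "\<And>v. v \<in> gpol ?G \<Longrightarrow> E v \<in> gpol ?G"
        using adjointable_Dmulti[of ?nr ?nc \<beta>] unfolding adjointable_def G by blast
      have B': "B v \<in> gpol ?G" if "v \<in> gpol ?G" for v
        using B(2) Pol_gpol gpol_imp_Pol[OF that] by metis
      show ?thesis
      proof (intro exI[of _ "\<lambda>v. gop r ns 0 \<alpha> ?z (\<gamma> (snd x)) (E (B v))"] conjI allI ballI)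
        show "pr v (W (fst x \<beta>) * Dmulti ?nr ?nc \<beta> (weyl r ns \<alpha> ?z (\<gamma> (snd x)) w))
          = pr (gop r ns 0 \<alpha> ?z (\<gamma> (snd x)) (E (B v))) w" for v w
          unfolding B(1) E(1) weyl_adjoint ..
      qed (auto intro!: gpol_gop I_gop val E(2) B')
    qed
    then have "\<forall>\<beta>\<in>coeff_supp V (fst x). \<exists>T'. (\<forall>v w. pr v (W (fst x \<beta>) * Dmulti ?nr ?nc \<beta> (weyl r ns \<alpha> ?z (\<gamma> (snd x)) w)) = pr (T' v) w)
        \<and> (\<forall>v\<in>gpol ?G. T' v \<in> gpol ?G \<and> T' v \<in> I)" by blast
    from bchoice[OF this] obtain T' where T': "\<forall>\<beta>\<in>coeff_supp V (fst x).
        (\<forall>v w. pr v (W (fst x \<beta>) * Dmulti ?nr ?nc \<beta> (weyl r ns \<alpha> ?z (\<gamma> (snd x)) w)) = pr (T' \<beta> v) w)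
        \<and> (\<forall>v\<in>gpol ?G. T' \<beta> v \<in> gpol ?G \<and> T' \<beta> v \<in> I)" by blast
    show ?thesis
    proof (intro exI[of _ "\<lambda>v. \<Sum>\<beta>\<in>coeff_supp V (fst x). T' \<beta> v"] conjI allI ballI)
      show "pr v (T x w) = pr (\<Sum>\<beta>\<in>coeff_supp V (fst x). T' \<beta> v) w" for v w
        unfolding T_def pr_sum_right pr_sum_left using T' by (intro sum.cong refl) blast
    qed (use T' in \<open>auto intro!: gpol_sum I_sum\<close>)
  qed
  then have "\<forall>x\<in>set L. \<exists>T'. (\<forall>v w. pr v (T x w) = pr (T' v) w) \<and> (\<forall>v\<in>gpol ?G. T' v \<in> gpol ?G \<and> T' v \<in> I)" by blast
  from bchoice[OF this] obtain T' where
    T': "\<forall>x\<in>set L. (\<forall>v w. pr v (T x w) = pr (T' x v) w) \<and> (\<forall>v\<in>gpol ?G. T' x v \<in> gpol ?G \<and> T' x v \<in> I)" by blast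
  have A_I: "A v \<in> I" if v: "v \<in> gpol ?G" for v
  proof -
    have "A v = (\<Sum>x\<leftarrow>L. T' x v)"
    proof (rule pr_eqI)
      show "A v \<in> gpol ?G" using A(2) Pol_gpol gpol_imp_Pol[OF v] by metis
      show "(\<Sum>x\<leftarrow>L. T' x v) \<in> gpol ?G" using T' v by (intro gpol_sum_list) blast
      fix w assume w: "w \<in> gpol ?G"
      have "pr (A v) w = pr v (\<Sum>x\<leftarrow>L. T x w)" unfolding A(1)[symmetric] identity[OF w] ..
      also have "\<dots> = (\<Sum>x\<leftarrow>L. pr (T' x v) w)"
        unfolding pr_sum_list_right using T' by (intro sum_list_cong) blast
      finally show "pr (A v) w = pr (\<Sum>x\<leftarrow>L. T' x v) w" unfolding pr_sum_list_left .
    qed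
    then show ?thesis using T' v I_sum_list[of L "\<lambda>x. T' x v"] by simp
  qed
  \<comment> \<open>Triangularity: \<open>A v\<close> lies in \<open>I\<close> and differs from
    \<open>Con (lookup h 0) * v\<close> by a polynomial of lower degree.\<close>
  have "Pol ?G n \<subseteq> I" for n
  proof (induction n)
    case 0
    then show ?case using I_0 by (auto simp: Pol_Zero_iff)
  next
    case (Suc n)
    show ?case
    proof
      fix v assume v: "v \<in> Pol ?G (Suc n)"
      have "A v + Con (- 1) * (A v - Con (lookup h 0) * v) \<in> I"
        using A_I[OF Pol_gpol[OF v]] A(3)[OF v] Suc by (intro I_add I_Con) auto
      then have "Con (lookup h 0) * v \<in> I" by (simp add: Con_uminus)
      then have "Con (inverse (lookup h 0)) * (Con (lookup h 0) * v) \<in> I" by (rule I_Con)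
      then show "v \<in> I" using h(2) by (simp add: mult.assoc[symmetric] Con_mult[symmetric])
    qed
  qed
  then have "v \<in> I" if "v \<in> gpol ?G" for v using gpol_imp_Pol[OF that] by blast
  then show False using fibre_nonzero[where \<alpha>=\<alpha>, OF z1 rN pos weight] by (auto simp: I_def)
qed

section \<open>The characteristic variety\<close>

text \<open>Numerator and denominator are multiplied by a polynomial vanishing off \<open>V\<close>,
  so that a nonzero denominator already places the point in \<open>V\<close>.\<close>

lemma regular_quotient:
  assumes V: "openin (zar_mat nr nc) V" "z \<in> V" and f: "regular_on nr nc V f"
  shows "\<exists>u v. evm nr nc z1 v z \<noteq> 0 \<and>
    (\<forall>w\<in>carrier_mat nr nc. evm nr nc z1 v w \<noteq> 0 \<longrightarrow> w \<in> V \<and> f w = evm nr nc z1 u w / evm nr nc z1 v w)"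
proof -
  let ?PF = "poly_funs (mat_coords nr nc)"
  obtain S where S: "S \<subseteq> ?PF" "V = {x \<in> carrier_mat nr nc. \<exists>p\<in>S. p x \<noteq> 0}"
    using V(1) unfolding openin_zariski by blast
  obtain s where s: "s \<in> ?PF" "s z \<noteq> 0" "\<And>w. w \<in> carrier_mat nr nc \<Longrightarrow> s w \<noteq> 0 \<Longrightarrow> w \<in> V"
    using V(2) S by blast
  obtain p q where pq: "p \<in> ?PF" "q \<in> ?PF" "q z \<noteq> 0" "\<And>w. w \<in> V \<Longrightarrow> q w \<noteq> 0 \<Longrightarrow> f w = p w / q w"
    using f V(2) unfolding regular_on_def by blast
  obtain u where u: "\<And>w. s w * p w = evm nr nc z1 u w"
    using poly_funs_evm[OF poly_funs.mult[OF s(1) pq(1)], of z1] by blast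
  obtain v where v: "\<And>w. s w * q w = evm nr nc z1 v w"
    using poly_funs_evm[OF poly_funs.mult[OF s(1) pq(2)], of z1] by blast
  show ?thesis
    unfolding u[symmetric] v[symmetric] using s pq by (intro exI[of _ u] exI[of _ v]) (auto simp: u[symmetric] v[symmetric])
qed

lemma pdiff_quotient:
  assumes f: "\<And>w. w \<in> carrier_mat nr nc \<Longrightarrow> evm nr nc z1 v w \<noteq> 0 \<Longrightarrow> f w = evm nr nc z1 u w / evm nr nc z1 v w"
    and w: "w \<in> carrier_mat nr nc" "evm nr nc z1 v w \<noteq> 0" and ip: "(i, p) \<in> {..<nr} \<times> {..<nc}"
  shows "pdiff i p f w = evm nr nc z1 (v * D (i, p) u - u * D (i, p) v) w / evm nr nc z1 (v * v) w"
proof -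
  let ?e = "evm nr nc z1" and ?t = "w $$ (i, p)"
  let ?g = "\<lambda>t. ?e u (upd_mat w i p t) / ?e v (upd_mat w i p t)"
  note d = evm_has_derivative[OF w(1) ip, of z1 _ ?t]
  have nz: "?e v (upd_mat w i p ?t) \<noteq> 0" using w(2) by (simp add: upd_mat_same)
  have "((\<lambda>t. ?e v (upd_mat w i p t)) \<longlongrightarrow> ?e v (upd_mat w i p ?t)) (nhds ?t)"
    using DERIV_isCont[OF d[of v]] tendsto_at_iff_tendsto_nhds[of "\<lambda>t. ?e v (upd_mat w i p t)" ?t]
    unfolding isCont_def by blast
  then have "eventually (\<lambda>t. ?e v (upd_mat w i p t) \<noteq> 0) (nhds ?t)"
    using nz by (rule tendsto_imp_eventually_ne)
  then have "eventually (\<lambda>t. f (upd_mat w i p t) = ?g t) (nhds ?t)"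
    by (rule eventually_mono) (use f upd_mat_carrier[OF w(1)] in blast)
  then have "pdiff i p f w = deriv ?g ?t"
    unfolding pdiff_def by (intro deriv_cong_ev) auto
  also have "\<dots> = (?e (D (i, p) u) w * ?e v w - ?e u w * ?e (D (i, p) v) w) / (?e v w * ?e v w)"
    using DERIV_imp_deriv[OF DERIV_divide[OF d[of u] d[of v] nz]] by (simp add: upd_mat_same)
  finally show ?thesis by (simp add: evm_simps mult.commute)
qed

text \<open>Near the point the function is a quotient of polynomials, and both mixed derivatives are
  the same rational expression. This matters because \<open>mi_diff\<close> fixes one order of the
  cells, while the second-order generators occur in either order.\<close>

lemma pdiff_commute:
  assumes V: "openin (zar_mat nr nc) V" "z \<in> V" and f: "regular_on nr nc V f"
    and ip: "(i, p) \<in> {..<nr} \<times> {..<nc}" and jq: "(j, q) \<in> {..<nr} \<times> {..<nc}"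
  shows "pdiff i p (pdiff j q f) z = pdiff j q (pdiff i p f) z"
proof -
  let ?e = "evm nr nc z"
  have z: "z \<in> carrier_mat nr nc" using V openin_subset[OF V(1)] by (auto simp: openin_zariski)
  obtain u v where v: "?e v z \<noteq> 0"
    and uv: "\<And>w. w \<in> carrier_mat nr nc \<Longrightarrow> ?e v w \<noteq> 0 \<Longrightarrow> f w = ?e u w / ?e v w"
    using regular_quotient[OF V f, of z] by blast
  have v2: "?e (v * v) w \<noteq> 0 \<longleftrightarrow> ?e v w \<noteq> 0" for w by (simp add: evm_simps)
  have second: "pdiff a b (pdiff c d f) z
      = ?e (v * v * D (a, b) (v * D (c, d) u - u * D (c, d) v) - (v * D (c, d) u - u * D (c, d) v) * D (a, b) (v * v)) z
        / ?e (v * v * (v * v)) z"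
    if "(a, b) \<in> {..<nr} \<times> {..<nc}" "(c, d) \<in> {..<nr} \<times> {..<nc}" for a b c d
    using v that by (intro pdiff_quotient[OF _ z]) (simp_all only: v2 not_False_eq_True pdiff_quotient[OF uv])
  have "v * v * D (i, p) (v * D (j, q) u - u * D (j, q) v) - (v * D (j, q) u - u * D (j, q) v) * D (i, p) (v * v)
      = v * v * D (j, q) (v * D (i, p) u - u * D (i, p) v) - (v * D (i, p) u - u * D (i, p) v) * D (j, q) (v * v)"
    by (simp add: D_mult D_diff D_comm[of "(i, p)" "(j, q)"] algebra_simps)
  then show ?thesis unfolding second[OF ip jq] second[OF jq ip] by simp
qed

definition unit_index :: "nat \<times> nat \<Rightarrow> multi_index" where
  "unit_index x = (\<lambda>y. if y = x then 1 else 0)"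

lemma mi_deg_unit: "x \<in> {..<nr} \<times> {..<nc} \<Longrightarrow> mi_deg nr nc (unit_index x) = 1"
  by (simp add: mi_deg_def unit_index_def)

lemma mi_deg_add: "mi_deg nr nc (\<lambda>v. \<beta> v + \<gamma> v) = mi_deg nr nc \<beta> + mi_deg nr nc \<gamma>"
  by (simp add: mi_deg_def sum.distrib)

lemma mi_monom_unit: "x \<in> {..<nr} \<times> {..<nc} \<Longrightarrow> mi_monom nr nc (unit_index x) \<xi> = \<xi> $$ x"
proof -
  assume x: "x \<in> {..<nr} \<times> {..<nc}"
  have "mi_monom nr nc (unit_index x) \<xi> = (\<Prod>y\<in>{..<nr} \<times> {..<nc}. if y = x then \<xi> $$ x else 1)"
    unfolding mi_monom_def unit_index_def by (intro prod.cong refl) auto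
  also have "\<dots> = \<xi> $$ x" using x by (subst prod.delta) auto
  finally show ?thesis .
qed

lemma mi_monom_add: "mi_monom nr nc (\<lambda>v. \<beta> v + \<gamma> v) \<xi> = mi_monom nr nc \<beta> \<xi> * mi_monom nr nc \<gamma> \<xi>"
  by (simp add: mi_monom_def power_add prod.distrib)

lemma foldr_funpow_0: "(\<And>v. v \<in> set xs \<Longrightarrow> \<beta> v = 0) \<Longrightarrow> foldr (\<lambda>v. T v ^^ \<beta> v) xs f = f"
  by (induction xs) auto

lemma foldr_funpow_1:
  assumes "distinct xs" "x \<in> set xs" "\<And>v. v \<in> set xs \<Longrightarrow> \<beta> v = (if v = x then 1 else 0)"
  shows "foldr (\<lambda>v. T v ^^ \<beta> v) xs f = T x f"
  using assms
proof (induction xs)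
  case (Cons y ys)
  show ?case
  proof (cases "y = x")
    case True
    then have "foldr (\<lambda>v. T v ^^ \<beta> v) ys f = f" using Cons.prems by (intro foldr_funpow_0) auto
    then show ?thesis using True Cons.prems by simp
  next
    case False
    then have "foldr (\<lambda>v. T v ^^ \<beta> v) ys f = T x f" using Cons.prems by (intro Cons.IH) auto
    then show ?thesis using False Cons.prems by simp
  qed
qed simp

text \<open>Which order occurs depends on which of the two entries comes first in the list;
  \<open>pdiff_commute\<close> later makes the choice immaterial.\<close>

lemma foldr_funpow_2:
  assumes "distinct xs" "x \<in> set xs" "y \<in> set xs" "x \<noteq> y"
    "\<And>v. v \<in> set xs \<Longrightarrow> \<beta> v = (if v = x \<or> v = y then 1 else 0)"
  shows "foldr (\<lambda>v. T v ^^ \<beta> v) xs f \<in> {T x (T y f), T y (T x f)}"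
  using assms
proof (induction xs)
  case (Cons v vs)
  consider "v = x" | "v = y" | "v \<noteq> x" "v \<noteq> y" by blast
  then show ?case
  proof cases
    case 1
    then have "foldr (\<lambda>v. T v ^^ \<beta> v) vs f = T y f" using Cons.prems by (intro foldr_funpow_1) auto
    then show ?thesis using 1 Cons.prems by simp
  next
    case 2
    then have "foldr (\<lambda>v. T v ^^ \<beta> v) vs f = T x f" using Cons.prems by (intro foldr_funpow_1) auto
    then show ?thesis using 2 Cons.prems by simp
  next
    case 3
    then have "foldr (\<lambda>v. T v ^^ \<beta> v) vs f \<in> {T x (T y f), T y (T x f)}" using Cons.prems by (intro Cons.IH) auto
    then show ?thesis using 3 Cons.prems by simp
  qed
qed simp

lemma mi_diff_unit:
  assumes "x \<in> {..<nr} \<times> {..<nc}"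
  shows "mi_diff nr nc (unit_index x) f = pdiff (fst x) (snd x) f"
proof -
  have "foldr (\<lambda>v. pdiff (fst v) (snd v) ^^ unit_index x v) (List.product [0..<nr] [0..<nc]) f = pdiff (fst x) (snd x) f"
    by (rule foldr_funpow_1) (use assms in \<open>auto simp: distinct_product unit_index_def\<close>)
  then show ?thesis by (simp add: mi_diff_def case_prod_unfold)
qed

lemma mi_diff_two:
  assumes "x \<in> {..<nr} \<times> {..<nc}" "y \<in> {..<nr} \<times> {..<nc}" "x \<noteq> y"
    and "openin (zar_mat nr nc) V" "z \<in> V" "regular_on nr nc V f"
  shows "mi_diff nr nc (\<lambda>v. unit_index x v + unit_index y v) f z = pdiff (fst x) (snd x) (pdiff (fst y) (snd y) f) z"
proof -
  have "foldr (\<lambda>v. pdiff (fst v) (snd v) ^^ (unit_index x v + unit_index y v)) (List.product [0..<nr] [0..<nc]) f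
     \<in> {pdiff (fst x) (snd x) (pdiff (fst y) (snd y) f), pdiff (fst y) (snd y) (pdiff (fst x) (snd x) f)}"
    by (rule foldr_funpow_2[where T="\<lambda>v. pdiff (fst v) (snd v)"])
       (use assms(1-3) in \<open>auto simp: distinct_product unit_index_def\<close>)
  then have "mi_diff nr nc (\<lambda>v. unit_index x v + unit_index y v) f
     \<in> {pdiff (fst x) (snd x) (pdiff (fst y) (snd y) f), pdiff (fst y) (snd y) (pdiff (fst x) (snd x) f)}"
    by (simp add: mi_diff_def case_prod_unfold)
  then show ?thesis
    using pdiff_commute[OF assms(4-6), of "fst x" "snd x" "fst y" "snd y"] assms(1,2) by auto
qed

lemma act_family:
  assumes "finite B" "z \<in> U"
  shows "act nr nc U (\<lambda>\<beta>. if \<beta> \<in> B then l \<beta> else (\<lambda>_. 0)) f z = (\<Sum>\<beta>\<in>B. l \<beta> z * mi_diff nr nc \<beta> f z)"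
  unfolding act_def using assms
  by (intro sum.mono_neutral_cong_left) (auto simp: coeff_supp_def split: if_splits)

lemma family_in_diff_ops:
  assumes "finite B" "B \<subseteq> multi_indices nr nc" "\<And>\<beta>. \<beta> \<in> B \<Longrightarrow> l \<beta> \<in> poly_funs (mat_coords nr nc)"
  shows "(\<lambda>\<beta>. if \<beta> \<in> B then l \<beta> else (\<lambda>_. 0)) \<in> diff_ops nr nc U"
proof -
  have "coeff_supp U (\<lambda>\<beta>. if \<beta> \<in> B then l \<beta> else (\<lambda>_. 0)) \<subseteq> B"
    by (auto simp: coeff_supp_def split: if_splits)
  then show ?thesis
    using assms by (auto simp: diff_ops_def intro: finite_subset regular_on_poly poly_funs.const)
qed

lemma generator_in_ideal:
  assumes U: "openin (zar_mat nr nc) U" and P: "P \<in> G" and a: "a \<in> diff_ops nr nc U"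
    and act: "\<And>f z. regular_on nr nc U f \<Longrightarrow> z \<in> U \<Longrightarrow> act nr nc U a f z = P f z"
  shows "a \<in> generated_ideal nr nc G U"
proof -
  let ?d = "\<lambda>\<beta>. if \<beta> \<in> {\<lambda>_. 0} then (\<lambda>_. 1) else (\<lambda>_. 0)"
  have d: "?d \<in> diff_ops nr nc U"
    by (rule family_in_diff_ops) (auto simp: multi_indices_def intro: poly_funs.const)
  have "a \<in> left_span nr nc G U"
    unfolding left_span_def
  proof (intro CollectI conjI a exI[of _ "[(?d, P)]"] allI impI ballI)
    show "act nr nc U a f z = (\<Sum>(b, P)\<leftarrow>[(?d, P)]. act nr nc U b (P f) z)"
      if "regular_on nr nc U f" "z \<in> U" for f z
      using act[OF that] act_family[of "{\<lambda>_. 0}" z U nr nc "\<lambda>_ _. 1" "P f"] that by (simp add: mi_diff_0)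
  qed (use d P in auto)
  then show ?thesis using a U by (auto simp: generated_ideal_def)
qed

text \<open>\<open>d\<close> is only an upper bound for the order: if a coefficient of degree
  \<open>d\<close> survives on \<open>X\<close>, the sum is the principal symbol, and otherwise all
  its coefficients vanish.\<close>

lemma symbol_vanishes_on_char_variety:
  assumes X: "openin (zar_mat nr nc) X" and ch: "(z, \<xi>) \<in> char_variety nr nc X (generated_ideal nr nc G)"
    and P: "P \<in> G" and B: "finite B" "B \<subseteq> multi_indices nr nc"
    and l: "\<And>\<beta>. \<beta> \<in> B \<Longrightarrow> l \<beta> \<in> poly_funs (mat_coords nr nc)"
    and act: "\<And>f w. regular_on nr nc X f \<Longrightarrow> w \<in> X \<Longrightarrow> P f w = (\<Sum>\<beta>\<in>B. l \<beta> w * mi_diff nr nc \<beta> f w)"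
    and d: "\<And>\<beta>. \<beta> \<in> B \<Longrightarrow> mi_deg nr nc \<beta> \<le> d"
  shows "(\<Sum>\<beta> | \<beta> \<in> B \<and> mi_deg nr nc \<beta> = d. l \<beta> z * mi_monom nr nc \<beta> \<xi>) = 0"
proof -
  let ?a = "\<lambda>\<beta>. if \<beta> \<in> B then l \<beta> else (\<lambda>_. 0)"
  let ?supp = "coeff_supp X ?a"
  have z: "z \<in> X" using ch by (simp add: char_variety_def)
  have "?a \<in> generated_ideal nr nc G X"
    using family_in_diff_ops[OF B l] act_family[OF B(1)] act by (intro generator_in_ideal[OF X P]) simp_all
  then have 0: "principal_symbol nr nc X ?a z \<xi> = 0" using ch X z unfolding char_variety_def by blast
  have supp: "?supp \<subseteq> B" by (auto simp: coeff_supp_def split: if_splits)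
  have vanish: "l \<beta> z = 0" if "\<beta> \<in> B" "\<beta> \<notin> ?supp" for \<beta>
    using that z by (auto simp: coeff_supp_def)
  show ?thesis
  proof (cases "\<exists>\<beta>\<in>?supp. mi_deg nr nc \<beta> = d")
    case True
    then have "op_order nr nc X ?a = d"
      unfolding op_order_def using supp B(1) d by (intro Max_eqI) (auto intro: finite_subset)
    then have "principal_symbol nr nc X ?a z \<xi> = (\<Sum>\<beta> | \<beta> \<in> B \<and> mi_deg nr nc \<beta> = d. l \<beta> z * mi_monom nr nc \<beta> \<xi>)"
      unfolding principal_symbol_def using supp B(1) vanish
      by (intro sum.mono_neutral_cong_left) auto
    then show ?thesis using 0 by simp
  next
    case False
    then show ?thesis using vanish by (intro sum.neutral) auto
  qed
qed

section \<open>Openness of the generic stratum\<close>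

lemma poly_funs_sum: "(\<And>x. x \<in> A \<Longrightarrow> f x \<in> poly_funs crd) \<Longrightarrow> (\<lambda>z. \<Sum>x\<in>A. f x z) \<in> poly_funs crd"
  by (induction A rule: infinite_finite_induct) (auto intro: poly_funs.const poly_funs.add)

lemma poly_funs_prod: "(\<And>x. x \<in> A \<Longrightarrow> f x \<in> poly_funs crd) \<Longrightarrow> (\<lambda>z. \<Prod>x\<in>A. f x z) \<in> poly_funs crd"
  by (induction A rule: infinite_finite_induct) (auto intro: poly_funs.const poly_funs.mult)

lemma poly_funs_entry: "x \<in> {..<nr} \<times> {..<nc} \<Longrightarrow> (\<lambda>z. z $$ x) \<in> poly_funs (mat_coords nr nc)"
  by (rule poly_funs.coord) (auto simp: mat_coords_def)

lemma finite_sub_weights: "finite (sub_weights r ns)"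
proof (rule finite_subset)
  show "sub_weights r ns \<subseteq> {\<mu>. set \<mu> \<subseteq> {..r + 1} \<and> length \<mu> = length ns}"
    using member_le_sum_list[where 'a=nat] by (fastforce simp: sub_weights_def)
qed (simp add: finite_lists_length_eq)

text \<open>The product of the finitely many determinants is a polynomial by the Leibniz formula,
  and the stratum is the set where it is nonzero.\<close>

lemma open_generic_stratum: "openin (zar_mat (r + 1) (sum_list ns)) (generic_stratum r ns)"
proof -
  let ?C = "carrier_mat (r + 1) (sum_list ns)"
  define p where "p \<mu> = (\<lambda>z :: complex mat. \<Sum>\<pi> | \<pi> permutes {0..<r + 1}.
    signof \<pi> * (\<Prod>i = 0..<r + 1. z $$ (i, sub_cols ns \<mu> ! \<pi> i)))" for \<mu>
  have p: "p \<mu> z = det (z_sub r ns \<mu> z)" if "\<mu> \<in> sub_weights r ns" "z \<in> ?C" for \<mu> z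
  proof -
    note c = z_sub_cols[OF that(2,1)]
    show ?thesis unfolding det_def'[OF c(1)] p_def
    proof (intro sum.cong refl arg_cong2[of _ _ _ _ "(*)"] prod.cong)
      fix \<pi> i assume "\<pi> \<in> {\<pi>. \<pi> permutes {0..<r + 1}}" "i \<in> {0..<r + 1}"
      moreover from this have "\<pi> i \<in> {0..<r + 1}" by (simp only: mem_Collect_eq permutes_in_image)
      ultimately show "z $$ (i, sub_cols ns \<mu> ! \<pi> i) = z_sub r ns \<mu> z $$ (i, \<pi> i)"
        using c(2)[of i "\<pi> i"] by simp
    qed
  qed
  have poly: "p \<mu> \<in> poly_funs (mat_coords (r + 1) (sum_list ns))" if \<mu>: "\<mu> \<in> sub_weights r ns" for \<mu>
    unfolding p_def
  proof (intro poly_funs_sum poly_funs.mult[OF poly_funs.const] poly_funs_prod poly_funs_entry)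
    fix \<pi> i assume "\<pi> \<in> {\<pi>. \<pi> permutes {0..<r + 1}}" and i: "i \<in> {0..<r + 1}"
    then have "\<pi> i \<in> {0..<r + 1}" by (simp only: mem_Collect_eq permutes_in_image)
    then have "sub_cols ns \<mu> ! \<pi> i \<in> set (sub_cols ns \<mu>)"
      using z_sub_cols(4)[OF zero_carrier_mat \<mu>] by simp
    then show "(i, sub_cols ns \<mu> ! \<pi> i) \<in> {..<r + 1} \<times> {..<sum_list ns}"
      using i z_sub_cols(3)[OF zero_carrier_mat \<mu>] by auto
  qed
  have "generic_stratum r ns = {z \<in> ?C. \<exists>q\<in>{\<lambda>z. \<Prod>\<mu>\<in>sub_weights r ns. p \<mu> z}. q z \<noteq> 0}"
    using p finite_sub_weights by (auto simp: generic_stratum_def)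
  then show ?thesis
    unfolding openin_zariski using poly_funs_prod[of "sub_weights r ns" p] poly by blast
qed

section \<open>The two inclusions for the characteristic variety\<close>

lemma first_order_symbol_vanishes:
  assumes X: "openin (zar_mat (r + 1) (sum_list ns)) X"
    and ch: "(z, \<xi>) \<in> char_variety (r + 1) (sum_list ns) X (generated_ideal (r + 1) (sum_list ns) G)"
    and P: "P \<in> G" "\<And>f w. w \<in> carrier_mat (r + 1) (sum_list ns) \<Longrightarrow> P f w = fun_first_order r ns \<alpha> g f w"
  shows "(\<Sum>a\<in>cells r ns. (\<Sum>b\<in>cells r ns. tens ns 0 g a b * z $$ b) * \<xi> $$ a) = 0"
proof -
  let ?nr = "r + 1" and ?nc = "sum_list ns" and ?G = "cells r ns" and ?o = "(\<lambda>_. 0) :: multi_index"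
  have G: "?G = {..<?nr} \<times> {..<?nc}" by (simp add: cells_def)
  define B where "B = insert ?o (unit_index ` ?G)"
  define L where "L a w = (\<Sum>b\<in>?G. tens ns 0 g a b * w $$ b)" for a and w :: "complex mat"
  \<comment> \<open>One formula for all coefficients: at a unit index the sum picks out
    \<open>L\<close> of that cell, and at the zero index only the constant remains.\<close>
  define l where "l \<beta> = (\<lambda>w. (\<Sum>a\<in>?G. of_nat (\<beta> a) * L a w) + (if \<beta> = ?o then cst r ns \<alpha> g else 0))" for \<beta>
  have inj: "inj_on unit_index A" for A
    by (rule inj_onI) (metis unit_index_def zero_neq_one)
  have ne: "unit_index x \<noteq> ?o" for x
  proof
    assume "unit_index x = ?o"
    then have "unit_index x x = 0" by (simp only:)
    then show False by (simp add: unit_index_def)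
  qed
  have l_unit: "l (unit_index x) w = L x w" if "x \<in> ?G" for x w
  proof -
    have "(\<Sum>a\<in>?G. of_nat (unit_index x a) * L a w) = (\<Sum>a\<in>?G. if a = x then L x w else 0)"
      by (intro sum.cong refl) (simp add: unit_index_def)
    then show ?thesis using that ne by (simp add: l_def)
  qed
  have "(\<Sum>\<beta> | \<beta> \<in> B \<and> mi_deg ?nr ?nc \<beta> = 1. l \<beta> z * mi_monom ?nr ?nc \<beta> \<xi>) = 0"
  proof (rule symbol_vanishes_on_char_variety[OF X ch P(1)])
    show "finite B" "B \<subseteq> multi_indices ?nr ?nc"
      by (auto simp: B_def G multi_indices_def unit_index_def)
    show "l \<beta> \<in> poly_funs (mat_coords ?nr ?nc)" for \<beta>
      unfolding l_def L_def G
      by (intro poly_funs.add poly_funs_sum poly_funs.mult poly_funs.const poly_funs_entry)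
    show "P f w = (\<Sum>\<beta>\<in>B. l \<beta> w * mi_diff ?nr ?nc \<beta> f w)" if "w \<in> X" for f w
    proof -
      have w: "w \<in> carrier_mat ?nr ?nc" using X that by (auto simp: openin_zariski)
      have "(\<Sum>\<beta>\<in>B. l \<beta> w * mi_diff ?nr ?nc \<beta> f w)
          = l ?o w * mi_diff ?nr ?nc ?o f w + (\<Sum>x\<in>?G. l (unit_index x) w * mi_diff ?nr ?nc (unit_index x) f w)"
        unfolding B_def using ne by (subst sum.insert) (auto simp: sum.reindex[OF inj] ne[symmetric])
      also have "(\<Sum>x\<in>?G. l (unit_index x) w * mi_diff ?nr ?nc (unit_index x) f w)
          = (\<Sum>x\<in>?G. L x w * pdiff (fst x) (snd x) f w)"
        by (intro sum.cong refl) (simp add: l_unit mi_diff_unit G)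
      finally show ?thesis unfolding P(2)[OF w] fun_first_order_def by (simp add: l_def L_def mi_diff_0)
    qed
    show "mi_deg ?nr ?nc \<beta> \<le> 1" if "\<beta> \<in> B" for \<beta>
      using that mi_deg_unit by (auto simp: B_def G) (simp add: mi_deg_def)
  qed
  also have "{\<beta> \<in> B. mi_deg ?nr ?nc \<beta> = 1} = unit_index ` ?G"
    using mi_deg_unit by (auto simp: B_def G mi_deg_def)
  also have "(\<Sum>\<beta>\<in>unit_index ` ?G. l \<beta> z * mi_monom ?nr ?nc \<beta> \<xi>) = (\<Sum>x\<in>?G. L x z * \<xi> $$ x)"
    unfolding sum.reindex[OF inj] by (intro sum.cong refl) (simp add: l_unit mi_monom_unit G)
  finally show ?thesis by (simp add: L_def)
qed

text \<open>For \<open>i = j\<close> or \<open>p = q\<close> the equation is trivial. Otherwise the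
  two second-order monomials have different multi-indices, so their coefficients 1 and -1 do not
  cancel.\<close>

lemma minor_symbol_vanishes:
  assumes X: "openin (zar_mat nr nc) X" and ch: "(z, \<xi>) \<in> char_variety nr nc X (generated_ideal nr nc G)"
    and P: "(\<lambda>f z. pdiff i p (pdiff j q f) z - pdiff i q (pdiff j p f) z) \<in> G"
    and ij: "i < nr" "j < nr" "p < nc" "q < nc"
  shows "\<xi> $$ (i, p) * \<xi> $$ (j, q) = \<xi> $$ (i, q) * \<xi> $$ (j, p)"
proof (cases "i = j \<or> p = q")
  case False
  define u where "u x y = (\<lambda>v. unit_index x v + unit_index y v)" for x y
  let ?u = "u (i, p) (j, q)" and ?v = "u (i, q) (j, p)"
  let ?l = "\<lambda>\<beta> (_ :: complex mat). if \<beta> = ?u then 1 else - 1 :: complex"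
  have ne: "?u \<noteq> ?v"
  proof
    assume "?u = ?v"
    then have "?u (i, p) = ?v (i, p)" by simp
    then show False using False by (simp add: u_def unit_index_def)
  qed
  have deg: "mi_deg nr nc (u x y) = 2" if "x \<in> {..<nr} \<times> {..<nc}" "y \<in> {..<nr} \<times> {..<nc}" for x y
    using that by (simp add: u_def mi_deg_add mi_deg_unit)
  have "(\<Sum>\<beta> | \<beta> \<in> {?u, ?v} \<and> mi_deg nr nc \<beta> = 2. ?l \<beta> z * mi_monom nr nc \<beta> \<xi>) = 0"
  proof (rule symbol_vanishes_on_char_variety[OF X ch P])
    show "{?u, ?v} \<subseteq> multi_indices nr nc" using ij by (auto simp: u_def multi_indices_def unit_index_def)
    show "pdiff i p (pdiff j q f) w - pdiff i q (pdiff j p f) w = (\<Sum>\<beta>\<in>{?u, ?v}. ?l \<beta> w * mi_diff nr nc \<beta> f w)"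
      if "regular_on nr nc X f" "w \<in> X" for f w
      using mi_diff_two[OF _ _ _ X that(2,1), of "(i, p)" "(j, q)"] mi_diff_two[OF _ _ _ X that(2,1), of "(i, q)" "(j, p)"]
        ij ne False by (simp add: u_def)
    show "mi_deg nr nc \<beta> \<le> 2" if "\<beta> \<in> {?u, ?v}" for \<beta> using that deg ij by auto
  qed (auto intro: poly_funs.const)
  also have "{\<beta> \<in> {?u, ?v}. mi_deg nr nc \<beta> = 2} = {?u, ?v}" using deg ij by auto
  finally show ?thesis using ne ij by (simp add: u_def mi_monom_add mi_monom_unit)
qed (auto simp: mult.commute)

lemma peval_symb:
  assumes ch: "(z, \<xi>) \<in> char_variety (r + 1) (sum_list ns) (generic_stratum r ns) (hg_ideal r ns \<alpha>)"
    and g: "valid r ns g"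
  shows "peval (\<lambda>x. x) (\<lambda>x. \<xi> $$ x) (symb r ns (\<lambda>ip. z $$ ip) g) = 0"
proof -
  note ch' = ch[unfolded hg_ideal_def]
  note X = open_generic_stratum[of r ns]
  note ev = peval_sum[OF id_hom] peval_mult[OF id_hom] peval_diff[OF id_hom] peval_Con[OF id_hom] peval_Var[OF id_hom]
  show ?thesis
  proof (cases g)
    case (Minor i j p q)
    have "(\<lambda>f z. pdiff i p (pdiff j q f) z - pdiff i q (pdiff j p f) z) \<in> hg_operators r ns \<alpha>"
      using g unfolding Minor valid.simps hg_operators_def less_Suc_eq_le Suc_eq_plus1[symmetric] by blast
    from minor_symbol_vanishes[OF X ch' this] show ?thesis using g Minor by (simp add: ev)
  next
    case (Tor x)
    have "(\<lambda>f z. trace_diff (r + 1) (sum_list ns) (\<lambda>z. z * h_elem ns x) f z - h_char ns \<alpha> x * f z) \<in> hg_operators r ns \<alpha>"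
      unfolding hg_operators_def by blast
    from first_order_symbol_vanishes[OF X ch' this hg_operator_Tor] show ?thesis
      unfolding Tor symb.simps ev .
  next
    case (Row Y)
    \<comment> \<open>\<open>valid\<close> puts no condition on the dimensions of \<open>Y\<close>;
      cutting it down to the required size leaves the symbol unchanged.\<close>
    define Y' where "Y' = mat (r + 1) (r + 1) (\<lambda>ab. Y $$ ab)"
    have c: "Y' \<in> carrier_mat (r + 1) (r + 1)" by (simp add: Y'_def)
    have "(\<lambda>f z. trace_diff (r + 1) (sum_list ns) (\<lambda>z. Y' * z) f z + (\<Sum>i<r + 1. Y' $$ (i, i)) * f z) \<in> hg_operators r ns \<alpha>"
      unfolding hg_operators_def using c by blast
    from first_order_symbol_vanishes[OF X ch' this hg_operator_Row[OF _ c]]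
    have "peval (\<lambda>x. x) (\<lambda>x. \<xi> $$ x) (symb r ns (\<lambda>ip. z $$ ip) (Row Y')) = 0"
      unfolding symb.simps ev .
    moreover have "(\<Sum>b\<in>cells r ns. tens ns 0 (Row Y') a b * z $$ b) = (\<Sum>b\<in>cells r ns. tens ns 0 (Row Y) a b * z $$ b)"
      if "a \<in> cells r ns" for a
      by (rule sum.cong[OF refl]) (use that in \<open>auto simp: Y'_def cells_def\<close>)
    then have "symb r ns (\<lambda>ip. z $$ ip) (Row Y') = symb r ns (\<lambda>ip. z $$ ip) (Row Y)"
      unfolding symb.simps by (intro sum.cong[OF refl]) (simp only:)
    ultimately show ?thesis unfolding Row by simp
  qed
qed

text \<open>Evaluation at \<open>\<xi>\<close> kills the symbol ideal, which contains a power of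
  each variable.\<close>

lemma char_variety_imp_zero:
  assumes ch: "(z, \<xi>) \<in> char_variety (r + 1) (sum_list ns) (generic_stratum r ns) (hg_ideal r ns \<alpha>)"
    and rN: "r + 1 \<le> sum_list ns"
  shows "\<xi> = 0\<^sub>m (r + 1) (sum_list ns)"
proof -
  have z: "z \<in> generic_stratum r ns" and c: "\<xi> \<in> carrier_mat (r + 1) (sum_list ns)"
    using ch by (auto simp: char_variety_def)
  have ideal: "peval (\<lambda>x. x) (\<lambda>x. \<xi> $$ x) v = 0" if "v \<in> symbol_ideal r ns (\<lambda>ip. z $$ ip)" for v
    using that
  proof (induction rule: symbol_ideal.induct)
    case zero
    show ?case by (rule peval_0[OF id_hom])
  next
    case (step v g u)
    show ?case
      unfolding peval_add[OF id_hom] peval_mult[OF id_hom] peval_symb[OF ch step.hyps(2)] step.IH by simp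
  qed
  have "\<xi> $$ x = 0" if x: "x \<in> cells r ns" for x
  proof -
    from Var_nilpotent[OF z rN x] obtain n where "Var x ^ n \<in> symbol_ideal r ns (\<lambda>ip. z $$ ip)" by blast
    from ideal[OF this] have "(\<xi> $$ x) ^ n = 0" unfolding peval_power[OF id_hom] peval_Var[OF id_hom] .
    then show ?thesis by (simp add: power_eq_0_iff)
  qed
  then have "\<xi> $$ (i, p) = 0" if "i < r + 1" "p < sum_list ns" for i p
    using that by (simp only: cells_def mem_Times_iff fst_conv snd_conv lessThan_iff)
  then show ?thesis using c by (intro eq_matI) simp_all
qed

text \<open>At \<open>\<xi> = 0\<close> a symbol of positive degree vanishes by homogeneity. In
  degree zero the operator is multiplication by a function, and
  \<open>multiplication_operator_vanishes\<close> applies near the point.\<close>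

lemma zero_in_char_variety:
  assumes z: "z \<in> generic_stratum r ns" and rN: "r + 1 < sum_list ns" and pos: "\<forall>n\<in>set ns. n \<ge> 1"
    and weight: "(\<Sum>k<length ns. \<alpha> k 0) = - of_nat r - 1"
  shows "(z, 0\<^sub>m (r + 1) (sum_list ns)) \<in> char_variety (r + 1) (sum_list ns) (generic_stratum r ns) (hg_ideal r ns \<alpha>)"
  unfolding char_variety_def
proof (intro CollectI case_prodI conjI z zero_carrier_mat allI impI)
  let ?nr = "r + 1" and ?nc = "sum_list ns" and ?o = "(\<lambda>_. 0) :: multi_index"
  fix U a assume U: "z \<in> U" and a: "a \<in> hg_ideal r ns \<alpha> U"
  have diff: "a \<in> diff_ops ?nr ?nc U" using a by (simp add: hg_ideal_def generated_ideal_def)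
  show "principal_symbol ?nr ?nc U a z (0\<^sub>m ?nr ?nc) = 0"
    unfolding principal_symbol_def
  proof (rule sum.neutral, rule ballI)
    fix \<beta> assume "\<beta> \<in> {\<beta>. \<beta> \<in> coeff_supp U a \<and> mi_deg ?nr ?nc \<beta> = op_order ?nr ?nc U a}"
    then have \<beta>: "\<beta> \<in> coeff_supp U a" "mi_deg ?nr ?nc \<beta> = op_order ?nr ?nc U a" by simp_all
    have mi: "\<gamma> \<in> multi_indices ?nr ?nc" if "\<gamma> \<in> coeff_supp U a" for \<gamma>
      using diff that by (auto simp: diff_ops_def)
    show "a \<beta> z * mi_monom ?nr ?nc \<beta> (0\<^sub>m ?nr ?nc) = 0"
    proof (cases "\<beta> = ?o")
      case False
      have "\<not> (\<forall>x. \<beta> x = 0)"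
      proof
        assume "\<forall>x. \<beta> x = 0"
        then have "\<beta> = ?o" by (intro ext) (rule spec)
        then show False using False by (rule notE[rotated])
      qed
      then obtain x where x': "\<beta> x \<noteq> 0" unfolding not_all by (rule exE)
      then have x: "x \<in> {..<?nr} \<times> {..<?nc}"
        using mi[OF \<beta>(1)] unfolding multi_indices_def mem_Collect_eq by metis
      then have "(0\<^sub>m ?nr ?nc $$ x) ^ \<beta> x = (0 :: complex)" using x' by (cases x) auto
      then have "mi_monom ?nr ?nc \<beta> (0\<^sub>m ?nr ?nc) = 0"
        unfolding mi_monom_def using x by (intro prod_zero) auto
      then show ?thesis by simp
    next
      case True
      \<comment> \<open>The zero index attains the maximal degree of the support, so no other index
        occurs.\<close>
      have "\<gamma> = ?o" if \<gamma>: "\<gamma> \<in> coeff_supp U a" for \<gamma>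
      proof (rule ext)
        fix x
        have "finite (coeff_supp U a)" using diff by (simp add: diff_ops_def)
        then have "mi_deg ?nr ?nc \<gamma> \<le> op_order ?nr ?nc U a"
          unfolding op_order_def using \<gamma> by (intro Max_ge) auto
        then have deg: "(\<Sum>x\<in>{..<?nr} \<times> {..<?nc}. \<gamma> x) = 0"
          unfolding \<beta>(2)[symmetric] unfolding True mi_deg_def by (simp del: lessThan_Suc)
        have "\<gamma> x = 0" if "x \<in> {..<?nr} \<times> {..<?nc}"
          using member_le_sum[of x "{..<?nr} \<times> {..<?nc}" \<gamma>, OF that] unfolding deg by simp
        then show "\<gamma> x = 0" using mi[OF \<gamma>] unfolding multi_indices_def mem_Collect_eq by metis
      qed
      then have supp: "coeff_supp U a \<subseteq> {?o}" by blast
      have "\<exists>V. openin (zar_mat ?nr ?nc) V \<and> z \<in> V \<and> V \<subseteq> U \<and> a \<in> left_span ?nr ?nc (hg_operators r ns \<alpha>) V"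
        using a U unfolding hg_ideal_def generated_ideal_def mem_Collect_eq by (metis (no_types, lifting))
      then obtain V where V: "openin (zar_mat ?nr ?nc) V" "z \<in> V" "V \<subseteq> U"
        "a \<in> left_span ?nr ?nc (hg_operators r ns \<alpha>) V" by (elim exE conjE)
      have "coeff_supp V a \<subseteq> {?o}" using supp V(3) unfolding coeff_supp_def by blast
      from multiplication_operator_vanishes[OF V(1,2,4) this z rN pos weight] show ?thesis
        unfolding True by simp
    qed
  qed
qed

section \<open>Krull dimension of the zero section\<close>

lemma topspace_zariski: "topspace (zariski crd X) = X"
proof
  show "topspace (zariski crd X) \<subseteq> X"
    using openin_topspace[of "zariski crd X"] unfolding openin_zariski by blast
  have "openin (zariski crd X) X"
    unfolding openin_zariski by (intro exI[of _ "{\<lambda>_. 1}"]) (auto intro: poly_funs.const)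
  then show "X \<subseteq> topspace (zariski crd X)" by (rule openin_subset)
qed

text \<open>Pullback respects sums and products, so testing the coordinate functions
  suffices.\<close>

lemma continuous_map_zariski:
  assumes f: "f \<in> X \<rightarrow> Y" and c: "\<And>c. c \<in> crd' \<Longrightarrow> (\<lambda>x. c (f x)) \<in> poly_funs crd"
  shows "continuous_map (zariski crd X) (zariski crd' Y) f"
proof -
  have pull: "(\<lambda>x. p (f x)) \<in> poly_funs crd" if "p \<in> poly_funs crd'" for p
    using that by induction (auto intro: poly_funs.intros c)
  have "openin (zariski crd X) {x \<in> X. f x \<in> U}" if U: "openin (zariski crd' Y) U" for U
  proof -
    obtain S where S: "S \<subseteq> poly_funs crd'" "U = {y \<in> Y. \<exists>p\<in>S. p y \<noteq> 0}"
      using U unfolding openin_zariski by blast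
    have "{x \<in> X. f x \<in> U} = {x \<in> X. \<exists>p\<in>(\<lambda>p x. p (f x)) ` S. p x \<noteq> 0}"
      using f S(2) by auto
    moreover have "(\<lambda>p x. p (f x)) ` S \<subseteq> poly_funs crd" using S(1) pull by auto
    ultimately show ?thesis unfolding openin_zariski by blast
  qed
  then show ?thesis using f unfolding continuous_map topspace_zariski by auto
qed

lemma irreducible_closed_image:
  assumes h: "homeomorphic_maps S T f g" and C: "irreducible_closed S C"
  shows "irreducible_closed T (f ` C)"
proof -
  have f: "homeomorphic_map S T f" and g: "homeomorphic_map T S g"
    and gf: "\<And>x. x \<in> topspace S \<Longrightarrow> g (f x) = x" and fg: "\<And>y. y \<in> topspace T \<Longrightarrow> f (g y) = y"
    using h unfolding homeomorphic_maps_map by auto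
  have CS: "C \<subseteq> topspace S" "closedin S C" "C \<noteq> {}"
    using C closedin_subset unfolding irreducible_closed_def by auto
  show ?thesis
    unfolding irreducible_closed_def
  proof (intro conjI allI impI)
    show "closedin T (f ` C)" using homeomorphic_map_closedness[OF f CS(1)] CS(2) by simp
    show "f ` C \<noteq> {}" using CS(3) by simp
    fix A B assume AB: "closedin T A" "closedin T B" "f ` C \<subseteq> A \<union> B"
    have sub: "A \<subseteq> topspace T" "B \<subseteq> topspace T"
      using closedin_subset[OF AB(1)] closedin_subset[OF AB(2)] by simp_all
    have "closedin S (g ` A)" "closedin S (g ` B)"
      using homeomorphic_map_closedness[OF g] sub AB by auto
    moreover have "C \<subseteq> g ` A \<union> g ` B"
    proof
      fix x assume x: "x \<in> C"
      then have "f x \<in> A \<union> B" "x = g (f x)" using AB(3) gf CS(1) by auto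
      then show "x \<in> g ` A \<union> g ` B" by blast
    qed
    ultimately have "C \<subseteq> g ` A \<or> C \<subseteq> g ` B" using C unfolding irreducible_closed_def by blast
    then show "f ` C \<subseteq> A \<or> f ` C \<subseteq> B" using fg sub by (force simp: subset_iff)
  qed
qed

text \<open>A homeomorphism carries strict chains of irreducible closed sets to such chains; used in
  both directions, this gives invariance of the dimension.\<close>

lemma krull_dim_mono_homeomorphic:
  assumes h: "homeomorphic_maps S T f g"
  shows "krull_dim S \<le> krull_dim T"
  unfolding krull_dim_def
proof (rule Sup_subset_mono, safe)
  fix n C assume C: "\<forall>i\<le>n. irreducible_closed S (C i)" "\<forall>i<n. C i \<subset> C (Suc i)"
  have inj: "inj_on f (topspace S)"
    using h unfolding homeomorphic_maps_def by (metis inj_on_inverseI)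
  have sub: "C i \<subseteq> topspace S" if "i \<le> n" for i
    using C(1) that closedin_subset unfolding irreducible_closed_def by blast
  have "f ` C i \<subset> f ` C (Suc i)" if "i < n" for i
    using inj_on_image_eq_iff[OF inj sub sub, of i "Suc i"] C(2) that by auto
  then show "\<exists>m. enat n = enat m \<and> (\<exists>C. (\<forall>i\<le>m. irreducible_closed T (C i)) \<and> (\<forall>i<m. C i \<subset> C (Suc i)))"
    using irreducible_closed_image[OF h] C(1) by (intro exI[of _ n] conjI refl exI[of _ "\<lambda>i. f ` C i"]) auto
qed

text \<open>The zero section and the first projection are polynomial maps inverse to each other,
  hence homeomorphisms of the Zariski topologies.\<close>

lemma krull_dim_zero_section:
  assumes "X \<subseteq> carrier_mat nr nc"
  shows "krull_dim (subtopology (zar_cot nr nc) (X \<times> {0\<^sub>m nr nc})) = krull_dim (subtopology (zar_mat nr nc) X)"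
proof -
  let ?S = "subtopology (zar_mat nr nc) X" and ?T = "subtopology (zar_cot nr nc) (X \<times> {0\<^sub>m nr nc})"
  let ?f = "\<lambda>z. (z, 0\<^sub>m nr nc :: complex mat)"
  have "continuous_map (zar_mat nr nc) (zar_cot nr nc) ?f"
    by (rule continuous_map_zariski)
       (auto simp: cot_coords_def intro: poly_funs.const intro!: poly_funs_entry)
  then have f: "continuous_map ?S ?T ?f"
    by (intro continuous_map_into_subtopology[OF continuous_map_from_subtopology]) (auto simp: topspace_zariski)
  have "continuous_map (zar_cot nr nc) (zar_mat nr nc) fst"
    by (rule continuous_map_zariski) (auto simp: cot_coords_def mat_coords_def intro!: poly_funs.coord)
  then have g: "continuous_map ?T ?S fst"
    by (intro continuous_map_into_subtopology[OF continuous_map_from_subtopology]) (auto simp: topspace_zariski)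
  have "homeomorphic_maps ?S ?T ?f fst" "homeomorphic_maps ?T ?S fst ?f"
    using f g by (auto simp: homeomorphic_maps_def)
  then show ?thesis by (intro antisym krull_dim_mono_homeomorphic)
qed

theorem proposition5p7:
  fixes r N :: nat and ns :: "nat list" and \<alpha> :: "nat \<Rightarrow> nat \<Rightarrow> complex"
  assumes r: "r \<ge> 1" and rN: "r + 1 < N"
    and partition: "\<forall>n\<in>set ns. n \<ge> 1" "sum_list ns = N"
    and weight: "(\<Sum>k<length ns. \<alpha> k 0) = - of_nat r - 1"
    and simple_blocks: "\<forall>k<length ns. ns ! k = 1 \<longrightarrow> \<alpha> k (ns ! k - 1) \<notin> \<int>"
    and other_blocks: "\<forall>k<length ns. ns ! k > 1 \<longrightarrow> \<alpha> k (ns ! k - 1) \<noteq> 0"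
  shows "char_variety (r + 1) N (generic_stratum r ns) (hg_ideal r ns \<alpha>) =
           {(z, \<xi>). z \<in> generic_stratum r ns \<and> \<xi> \<in> carrier_mat (r + 1) N \<and> \<xi> = 0\<^sub>m (r + 1) N}
       \<and> holonomic (r + 1) N (generic_stratum r ns) (hg_ideal r ns \<alpha>)
       \<and> singular_locus (r + 1) N (generic_stratum r ns) (hg_ideal r ns \<alpha>) = {}"
proof -
  let ?Ch = "char_variety (r + 1) N (generic_stratum r ns) (hg_ideal r ns \<alpha>)"
  have Ch: "?Ch = generic_stratum r ns \<times> {0\<^sub>m (r + 1) N :: complex mat}"
  proof (intro Set.set_eqI iffI)
    fix w assume w: "w \<in> ?Ch"
    then have "(fst w, snd w) \<in> char_variety (r + 1) (sum_list ns) (generic_stratum r ns) (hg_ideal r ns \<alpha>)"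
      unfolding partition(2) by simp
    from char_variety_imp_zero[OF this] have "snd w = 0\<^sub>m (r + 1) N" using rN partition(2) by simp
    moreover have "fst w \<in> generic_stratum r ns" using w by (auto simp: char_variety_def)
    ultimately show "w \<in> generic_stratum r ns \<times> {0\<^sub>m (r + 1) N}" by (simp add: mem_Times_iff)
  next
    fix w assume "w \<in> generic_stratum r ns \<times> {0\<^sub>m (r + 1) N :: complex mat}"
    then obtain z where z: "w = (z, 0\<^sub>m (r + 1) N)" "z \<in> generic_stratum r ns" by blast
    show "w \<in> ?Ch"
      using zero_in_char_variety[where \<alpha>=\<alpha>, OF z(2) _ partition(1) weight] rN unfolding z(1) partition(2) by simp
  qed
  have sub: "generic_stratum r ns \<subseteq> carrier_mat (r + 1) N"
    using partition(2) by (auto simp: generic_stratum_def)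
  have "holonomic (r + 1) N (generic_stratum r ns) (hg_ideal r ns \<alpha>)"
    unfolding holonomic_def Ch using krull_dim_zero_section[OF sub] by blast
  then show ?thesis unfolding singular_locus_def Ch by auto
qed

end
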